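(* Let $(R,F)$ be a one-dimensional commutative formal group law over a commutative domain $R$ and let $(\Lambda,\Phi,\varrho)$ be a reduced root system with simple roots $\{\alpha_i\}_{i\in I}$. Suppose $i,j\in I$ and let $m_{ij}$ be the order of $s_is_j$ in $W$. Then $$\underbrace{X_jX_iX_j\cdots}_{m_{ij}\text{ terms}}-\underbrace{X_iX_jX_i\cdots}_{m_{ij}\text{ terms}}=\sum_{w\in W,\ 1\le\ell(w)\le m_{ij}-2}X_w\eta_w^{ji}$$ for some $\eta_w^{ji}\in Q^F$. In particular: (1) If $\langle\alpha_i^\vee,\alpha_j\rangle=0$, so that $m_{ij}=2$, then $X_iX_j=X_jX_i$. (2) If $\langle \alpha_i^\vee, \alpha_j \rangle = \langle \alpha_j^\vee, \alpha_i \rangle=-1$, so that $m_{ij}=3$, then $$X_jX_iX_j-X_iX_jX_i=X_i\kappa_{i,j}-X_j\kappa_{j,i}.$$ (3) If $\langle \alpha_i^\vee, \alpha_j \rangle=-1$ and $\langle \alpha_j^\vee, \alpha_i \rangle=-2$, so that $m_{ij}=4$, then $$X_{jiji}-X_{ijij}=X_{ij}(\kappa_{i+2j,-j}+\kappa_{j,i})-X_{ji}(\kappa_{i+j,j}+\kappa_{i,j})+X_j\big(\Delta_i(\kappa_{i+j,j}+\kappa_{i,j})\big)-X_i\big(\Delta_j(\kappa_{i+2j,-j}+\kappa_{j,i})\big).$$ (4) If $\langle \alpha_i^\vee, \alpha_j \rangle=-1$ and $\langle \alpha_j^\vee, \alpha_i \rangle=-3$, so that $m_{ij}=6$, then $$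\begin{aligned}X_{jijiji}-X_{ijijij}={}&X_{ijij}(\kappa_{j,i}+\kappa_{2i+3j,-i-2j}+\kappa_{-i-3j,i+2j}+\kappa_{i+2j,-j})\\&-X_{jiji}(\kappa_{i,j}+\kappa_{-2i-3j,i+2j}+\kappa_{-i-2j,i+3j}+\kappa_{i+j,j})\\&+X_{jij}\big(\Delta_i(\kappa_{i,j}+\kappa_{-2i-3j,i+2j}+\kappa_{-i-2j,i+3j}+\kappa_{i+j,j})\big)\\&-X_{iji}\big(\Delta_j(\kappa_{j,i}+\kappa_{2i+3j,-i-2j}+\kappa_{-i-3j,i+2j}+\kappa_{i+2j,-j})\big)\\&+X_{ij}\xi_{ij}-X_{ji}\xi_{ji}+X_j(\Delta_i(\xi_{ji}))-X_i(\Delta_j(\xi_{ij})),\end{aligned}$$ where $$\xi_{ij}=\tfrac{1}{x_i x_{i+j} x_{i+2j} x_{2i+3j}}+\tfrac{1}{x_ix_jx_{i+2j}x_{-2i-3j}}+\tfrac{1}{x_ix_jx_{2i+3j}x_{-i-j}}-\tfrac{1}{x_ix_{i+j}x_{i+2j}x_{-i-3j}}-\tfrac{1}{x_ix_{i+j}x_{i+3j}x_{-j}}+\tfrac{1}{x_{i+j}x_{i+3j}x_{-j}x_{-2i-3j}}+\tfrac{1}{x_{i+3j}x_{2i+3j}x_{-j}x_{-i-2j}}+\tfrac{1}{x_{i+j}x_{i+2j}x_{-i-3j}x_{-2i-3j}}-\tfrac{1}{x_ix_jx_{i+2j}x_{i+3j}}$$ and $$\xi_{ji}=\tfrac{1}{x_ix_jx_{2i+3j}x_{-i-2j}}+\tfrac{1}{x_ix_jx_{i+2j}x_{-i-3j}}+\tfrac{1}{x_jx_{i+2j}x_{i+3j}x_{2i+3j}}-\tfrac{1}{x_ix_jx_{i+j}x_{2i+3j}}+\tfrac{1}{x_{i+j}x_{i+2j}x_{-i}x_{-2i-3j}}+\tfrac{1}{x_{i+3j}x_{2i+3j}x_{-i-j}x_{-i-2j}}+\tfrac{1}{x_{i+j}x_{i+3j}x_{-i}x_{-i-2j}}-\tfrac{1}{x_j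 x_{i+3j}x_{2i+3j}x_{-i-j}}-\tfrac{1}{x_jx_{i+j}x_{i+3j}x_{-i}}.$$
   Context: A one-dimensional commutative formal group law (FGL) $(R,F)$ is a commutative ring $R$ and $F\in R[[u,v]]$ with $F(u,0)=F(0,u)=u$, $F(u,v)=F(v,u)$, $F(u,F(v,w))=F(F(u,v),w)$; one writes $u+_Fv=F(u,v)$. Formal group algebra: for an abelian group $\Lambda$, $R[[x_\Lambda]]$ is the completion of the polynomial ring $R[x_\lambda\mid\lambda\in\Lambda]$ at the kernel of the augmentation $x_\lambda\mapsto 0$; $R[[\Lambda]]_F$ is its quotient by the closure of the ideal generated by $x_0$ and $x_{\lambda_1+\lambda_2}-(x_{\lambda_1}+_Fx_{\lambda_2})$, $\lambda_1,\lambda_2\in\Lambda$. For $\Lambda\cong\mathbb{Z}^n$ it is isomorphic to $R[[x_1,\dots,x_n]]$. Root system: $(\Lambda,\Phi,\varrho)$ is a reduced root system (root datum in the sense of Demazure): a free $\mathbb{Z}$-module $\Lambda$ of finite rank, a finite set of roots $\Phi\subset\Lambda$, and a map $\varrho:\Phi\to\Lambda^\vee=\mathrm{Hom}_{\mathbb{Z}}(\Lambda,\mathbb{Z})$, $\alpha\mapsto\alpha^\vee$, satisfying the usual axioms. $W$ is the Weyl group generated by $s_\alpha(\lambda)=\lambda-\langle\alpha^\vee,\lambda\rangle\alpha$; $s_i=s_{\alpha_i}$; $\ell$ is the length function. $W$ acts on $R[[\Lambda]]_F$ by $w(x_\lambda)=x_{w(\lambda)}$. $Q^F$ is the subring of the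 fraction field of $R[[\Lambda]]_F$ generated by $R[[\Lambda]]_F$ and all $x_\lambda^{-1}$, $\lambda\in\Lambda\setminus\{0\}$. The twisted formal group algebra $Q_W^F$ is $R[W]\otimes_RQ^F$ with multiplication $(\delta_{w'}\psi')(\delta_w\psi)=\delta_{w'w}w^{-1}(\psi')\psi$, where $\delta_w\in R[W]$ corresponds to $w\in W$, and $\psi,\psi'\in Q^F$. The formal Demazure operator is $\Delta_\alpha(\psi)=\frac{\psi-s_\alpha(\psi)}{x_\alpha}$ on $Q^F$; $\Delta_i=\Delta_{\alpha_i}$. The formal Demazure element (distinct from the operator) is $X_\alpha=\frac{1}{x_\alpha}(1-\delta_{s_\alpha})\in Q_W^F$; $X_i=X_{\alpha_i}$, $X_{i_1\cdots i_k}=X_{i_1}\cdots X_{i_k}$. For each $w\in W$ a reduced decomposition $w=s_{i_1}\cdots s_{i_k}$ is fixed and $X_w=X_{i_1}\cdots X_{i_k}$. Write $x_{ni+mj}=x_{n\alpha_i+m\alpha_j}$ for integers $n,m$ (e.g. $x_{-i}=x_{-\alpha_i}$). For $\lambda,\nu\in\Lambda\setminus\{0\}$ with $\lambda+\nu\ne0$, $$\kappa_{\lambda,\nu}=\frac{1}{x_{\lambda+\nu}x_\nu}-\frac{1}{x_{\lambda+\nu}x_{-\lambda}}-\frac{1}{x_\lambda x_\nu}\in R[[\Lambda]]_F,$$ and $\kappa_{n_1i+m_1j,\,n_2i+m_2j}=\kappa_{n_1\alpha_i+m_1\alpha_j,\,n_2\alpha_i+m_2\alpha_j}$; in particular $\kappa_{i,j}=\kappa_{\alpha_i,\alpha_j}$.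 *)

theory Defs
  imports
    "HOL-Library.Multiset"
    "HOL-Library.Poly_Mapping"
    "HOL-Computational_Algebra.Formal_Power_Series"
    "HOL-Algebra.Bij"
    "HOL-Algebra.Generated_Groups"
    "HOL-Algebra.Generated_Rings"
    "HOL-Algebra.Ideal_Product"
    "HOL-Algebra.Multiplicative_Group"
    "HOL-Algebra.QuotRing"
begin

section \<open>Formal group laws\<close>

text \<open>
  A power series F(u,v) is an element of (R[[v]])[[u]], so that
  \<open>fps_nth (fps_nth F a) b\<close> is the coefficient of \<open>u^a v^b\<close>.
  The last conjunct compares the coefficients of \<open>u^a v^b w^c\<close> in F(u,F(v,w)) and F(F(u,v),w).
  As F has no constant term, \<open>F^k\<close> only has terms of total degree at least k, which makes
  the ranges of summation exhaustive.
\<close>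

definition formal_group_law :: "'r::comm_ring_1 fps fps \<Rightarrow> bool" where
  "formal_group_law F \<longleftrightarrow>
     (\<forall>a. fps_nth (fps_nth F a) 0 = (if a = 1 then 1 else 0)) \<and>
     (\<forall>b. fps_nth (fps_nth F 0) b = (if b = 1 then 1 else 0)) \<and>
     (\<forall>a b. fps_nth (fps_nth F a) b = fps_nth (fps_nth F b) a) \<and>
     (\<forall>a b c.
        (\<Sum>k\<le>b + c. fps_nth (fps_nth F a) k * fps_nth (fps_nth (F ^ k) b) c) =
        (\<Sum>k\<le>a + b. fps_nth (fps_nth F k) c * fps_nth (fps_nth (F ^ k) a) b))"


section \<open>The formal group algebra\<close>

text \<open>
  The polynomial ring \<open>R[x_\<lambda> | \<lambda> \<in> \<Lambda>]\<close> is the monoid algebra of the free commutative monoid of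
  monomials, a monomial being the multiset of its variables. The lattice \<open>\<Lambda>\<close> is a whole type \<open>'l\<close>.
\<close>

type_synonym ('r, 'l) polynomials = "'l multiset \<Rightarrow>\<^sub>0 'r"
type_synonym ('r, 'l) series = "nat \<Rightarrow> ('r, 'l) polynomials set"
type_synonym ('r, 'l) fga = "('r, 'l) series set"
type_synonym ('r, 'l) fga_frac = "(('r, 'l) fga \<times> ('r, 'l) fga) set"

definition poly_ring :: "('r::comm_ring_1, 'l) polynomials ring" where
  "poly_ring = \<lparr>carrier = UNIV, mult = (*), one = 1, zero = 0, add = (+)\<rparr>"

definition pvar :: "'l \<Rightarrow> ('r::comm_ring_1, 'l) polynomials" where
  "pvar l = Poly_Mapping.single {#l#} 1"

definition pconst :: "'r::comm_ring_1 \<Rightarrow> ('r, 'l) polynomials" where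
  "pconst c = Poly_Mapping.single {#} c"

definition augmentation_ideal :: "('r::comm_ring_1, 'l) polynomials set" where
  "augmentation_ideal = {p. Poly_Mapping.lookup p {#} = 0}"

primrec ideal_power :: "('a, 'b) ring_scheme \<Rightarrow> 'a set \<Rightarrow> nat \<Rightarrow> 'a set" where
  "ideal_power A I 0 = carrier A"
| "ideal_power A I (Suc n) = ideal_prod A I (ideal_power A I n)"

text \<open>
  The inverse limit of the rings \<open>A/I^n\<close>. Cosets are sets, and the transition map sends
  the coset \<open>s (Suc n)\<close> of \<open>I^(n+1)\<close> to the unique coset of \<open>I^n\<close> containing it.
\<close>

definition completion :: "('a, 'b) ring_scheme \<Rightarrow> 'a set \<Rightarrow> (nat \<Rightarrow> 'a set) ring" where
  "completion A I =
     \<lparr>carrier = {s. \<forall>n. s n \<in> carrier (A Quot ideal_power A I n) \<and> s (Suc n) \<subseteq> s n},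
      mult = (\<lambda>s t n. s n \<otimes>\<^bsub>A Quot ideal_power A I n\<^esub> t n),
      one = (\<lambda>n. \<one>\<^bsub>A Quot ideal_power A I n\<^esub>),
      zero = (\<lambda>n. \<zero>\<^bsub>A Quot ideal_power A I n\<^esub>),
      add = (\<lambda>s t n. s n \<oplus>\<^bsub>A Quot ideal_power A I n\<^esub> t n)\<rparr>"

text \<open>Closure for the inverse limit topology, each \<open>A/I^n\<close> being discrete.\<close>

definition completion_closure ::
    "('a, 'b) ring_scheme \<Rightarrow> 'a set \<Rightarrow> (nat \<Rightarrow> 'a set) set \<Rightarrow> (nat \<Rightarrow> 'a set) set" where
  "completion_closure A I J = {s \<in> carrier (completion A I). \<forall>n. \<exists>t\<in>J. t n = s n}"

abbreviation aug_power :: "nat \<Rightarrow> ('r::comm_ring_1, 'l) polynomials set" where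
  "aug_power n \<equiv> ideal_power poly_ring augmentation_ideal n"

definition series_ring :: "('r::comm_ring_1, 'l) series ring" where
  "series_ring = completion poly_ring augmentation_ideal"

definition svar :: "'l \<Rightarrow> ('r::comm_ring_1, 'l) series" where
  "svar l = (\<lambda>n. aug_power n +>\<^bsub>poly_ring\<^esub> pvar l)"

text \<open>
  The element \<open>x_\<lambda> +\<^sub>F x_\<mu> = F(x_\<lambda>, x_\<mu>)\<close> of the completion: modulo the n-th power
  of the augmentation ideal only the terms with \<open>a, b < n\<close> can be nonzero.
\<close>

definition fgl_sum :: "'r::comm_ring_1 fps fps \<Rightarrow> 'l \<Rightarrow> 'l \<Rightarrow> ('r, 'l) series" where
  "fgl_sum F l m = (\<lambda>n. aug_power n +>\<^bsub>poly_ring\<^esub>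
     (\<Sum>a<n. \<Sum>b<n. pconst (fps_nth (fps_nth F a) b) * pvar l ^ a * pvar m ^ b))"

definition fga_relations :: "'r::comm_ring_1 fps fps \<Rightarrow> ('r, 'l::ab_group_add) series set" where
  "fga_relations F =
     insert (svar 0) {svar (l + m) \<ominus>\<^bsub>series_ring\<^esub> fgl_sum F l m |l m. True}"

definition fga_ideal :: "'r::comm_ring_1 fps fps \<Rightarrow> ('r, 'l::ab_group_add) series set" where
  "fga_ideal F = completion_closure poly_ring augmentation_ideal
     (Idl\<^bsub>series_ring\<^esub> (fga_relations F))"

definition formal_group_algebra ::
    "'r::comm_ring_1 fps fps \<Rightarrow> ('r, 'l::ab_group_add) fga ring" where
  "formal_group_algebra F = series_ring Quot fga_ideal F"

definition fga_var :: "'r::comm_ring_1 fps fps \<Rightarrow> 'l::ab_group_add \<Rightarrow> ('r, 'l) fga" where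
  "fga_var F l = fga_ideal F +>\<^bsub>series_ring\<^esub> svar l"


section \<open>Fraction fields\<close>

definition fraction_rel :: "('a, 'b) ring_scheme \<Rightarrow> (('a \<times> 'a) \<times> ('a \<times> 'a)) set" where
  "fraction_rel A = {((a, b), (c, d)).
     a \<in> carrier A \<and> b \<in> carrier A - {\<zero>\<^bsub>A\<^esub>} \<and> c \<in> carrier A \<and> d \<in> carrier A - {\<zero>\<^bsub>A\<^esub>} \<and>
     a \<otimes>\<^bsub>A\<^esub> d = c \<otimes>\<^bsub>A\<^esub> b}"

definition fraction :: "('a, 'b) ring_scheme \<Rightarrow> 'a \<Rightarrow> 'a \<Rightarrow> ('a \<times> 'a) set" where
  "fraction A a b = fraction_rel A `` {(a, b)}"

text \<open>The fraction field of a domain; sums and products do not depend on the representatives.\<close>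

definition fraction_field :: "('a, 'b) ring_scheme \<Rightarrow> ('a \<times> 'a) set ring" where
  "fraction_field A =
     \<lparr>carrier = (carrier A \<times> (carrier A - {\<zero>\<^bsub>A\<^esub>})) // fraction_rel A,
      mult = (\<lambda>x y. \<Union>(a, b)\<in>x. \<Union>(c, d)\<in>y. fraction A (a \<otimes>\<^bsub>A\<^esub> c) (b \<otimes>\<^bsub>A\<^esub> d)),
      one = fraction A \<one>\<^bsub>A\<^esub> \<one>\<^bsub>A\<^esub>,
      zero = fraction A \<zero>\<^bsub>A\<^esub> \<one>\<^bsub>A\<^esub>,
      add = (\<lambda>x y. \<Union>(a, b)\<in>x. \<Union>(c, d)\<in>y.
        fraction A (a \<otimes>\<^bsub>A\<^esub> d \<oplus>\<^bsub>A\<^esub> c \<otimes>\<^bsub>A\<^esub> b) (b \<otimes>\<^bsub>A\<^esub> d))\<rparr>"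

text \<open>Inversion in a field, with the usual convention that the inverse of zero is zero.\<close>

definition field_inverse :: "('a, 'b) ring_scheme \<Rightarrow> 'a \<Rightarrow> 'a" where
  "field_inverse K y = (if y = \<zero>\<^bsub>K\<^esub> then \<zero>\<^bsub>K\<^esub> else inv\<^bsub>K\<^esub> y)"


section \<open>Root data\<close>

definition zscale :: "int \<Rightarrow> 'l::ab_group_add \<Rightarrow> 'l" where
  "zscale n l = (\<Sum>k<nat n. l) - (\<Sum>k<nat (- n). l)"

lemma zscale_diff_nat: "zscale (int m - int n) l = (\<Sum>k<m. l) - (\<Sum>k<n. l)"
proof -
  have split: "(\<Sum>k<a + b. l) = (\<Sum>k<a. l) + (\<Sum>k<b. l)" for a b :: nat
    by (induction b) (simp_all add: algebra_simps)
  show ?thesis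
  proof (cases "n \<le> m")
    case True
    then obtain d where "m = n + d" using le_Suc_ex by blast
    then show ?thesis by (simp add: zscale_def split)
  next
    case False
    then obtain d where "n = m + d" by (metis le_Suc_ex nat_le_linear)
    then show ?thesis by (simp add: zscale_def split)
  qed
qed

global_interpretation zmodule: Modules.module "zscale :: int \<Rightarrow> 'l::ab_group_add \<Rightarrow> 'l"
proof
  have add: "(\<Sum>k<a + b. l) = (\<Sum>k<a. l) + (\<Sum>k<b. l)" for a b :: nat and l :: 'l
    by (induction b) (simp_all add: algebra_simps)
  have mult: "(\<Sum>k<a. \<Sum>k<b. l) = (\<Sum>k<a * b. l)" for a b :: nat and l :: 'l
    by (induction a) (simp_all add: add algebra_simps)
  fix a b :: int and x y :: 'l
  show "zscale a (x + y) = zscale a x + zscale a y"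
    by (simp add: zscale_def sum.distrib algebra_simps)
  obtain m n where a: "a = int m - int n" by (metis int_diff_cases)
  obtain p q where b: "b = int p - int q" by (metis int_diff_cases)
  have "a + b = int (m + p) - int (n + q)" by (simp add: a b)
  then show "zscale (a + b) x = zscale a x + zscale b x"
    unfolding a b by (simp only: zscale_diff_nat add) simp
  have "a * b = int (m * p + n * q) - int (m * q + n * p)"
    by (simp add: a b algebra_simps)
  then show "zscale a (zscale b x) = zscale (a * b) x"
    unfolding a b by (simp only: zscale_diff_nat add sum_subtractf mult) simp
  show "zscale 1 x = x" by (simp add: zscale_def)
qed

text \<open>
  \<open>coroot D \<alpha>\<close> is the functional \<open>\<lambda> \<mapsto> \<langle>\<alpha>\<^sup>\<or>, \<lambda>\<rangle>\<close>; only its values for roots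
  \<open>\<alpha>\<close> matter. The simple roots are \<open>simple_root D i\<close> for \<open>i \<in> index_set D\<close>.
\<close>

record ('l, 'i) based_root_datum =
  roots :: "'l set"
  coroot :: "'l \<Rightarrow> 'l \<Rightarrow> int"
  index_set :: "'i set"
  simple_root :: "'i \<Rightarrow> 'l"

definition reflection :: "('l::ab_group_add, 'i) based_root_datum \<Rightarrow> 'l \<Rightarrow> 'l \<Rightarrow> 'l" where
  "reflection D a l = l - zscale (coroot D a l) a"

text \<open>The axioms of SGA 3, Exp. XXI, for the root datum and for its being reduced.\<close>

locale reduced_root_datum =
  fixes D :: "('l::ab_group_add, 'i) based_root_datum"
  assumes free_finite_rank: "\<exists>B :: 'l set. finite B \<and> zmodule.independent B \<and> zmodule.span B = UNIV"
    and finite_roots: "finite (roots D)"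
    and coroot_additive: "a \<in> roots D \<Longrightarrow> additive (coroot D a)"
    and coroot_inj: "inj_on (coroot D) (roots D)"
    and coroot_self: "a \<in> roots D \<Longrightarrow> coroot D a a = 2"
    and reflection_root: "a \<in> roots D \<Longrightarrow> b \<in> roots D \<Longrightarrow> reflection D a b \<in> roots D"
    and reflection_coroot: "a \<in> roots D \<Longrightarrow> b \<in> roots D \<Longrightarrow>
      (\<lambda>l. coroot D b l - coroot D b a * coroot D a l) \<in> coroot D ` roots D"
    and reduced: "a \<in> roots D \<Longrightarrow> a + a \<notin> roots D"

locale reduced_based_root_datum = reduced_root_datum D
  for D :: "('l::ab_group_add, 'i) based_root_datum" +
  assumes simple_root_inj: "inj_on (simple_root D) (index_set D)"
    and simple_root_in: "simple_root D ` index_set D \<subseteq> roots D"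
    and simple_root_independent: "zmodule.independent (simple_root D ` index_set D)"
    and root_expansion: "b \<in> roots D \<Longrightarrow> \<exists>c :: 'i \<Rightarrow> nat.
      b = (\<Sum>i\<in>index_set D. zscale (int (c i)) (simple_root D i)) \<or>
      b = - (\<Sum>i\<in>index_set D. zscale (int (c i)) (simple_root D i))"

definition weyl_group :: "('l::ab_group_add, 'i) based_root_datum \<Rightarrow> ('l \<Rightarrow> 'l) monoid" where
  "weyl_group D = (BijGroup UNIV)
     \<lparr>carrier := generate (BijGroup UNIV) (reflection D ` roots D)\<rparr>"

definition simple_reflection :: "('l::ab_group_add, 'i) based_root_datum \<Rightarrow> 'i \<Rightarrow> 'l \<Rightarrow> 'l" where
  "simple_reflection D i = reflection D (simple_root D i)"

definition reflection_order :: "('l::ab_group_add, 'i) based_root_datum \<Rightarrow> 'i \<Rightarrow> 'i \<Rightarrow> nat" where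
  "reflection_order D i j =
     group.ord (weyl_group D) (simple_reflection D i \<otimes>\<^bsub>weyl_group D\<^esub> simple_reflection D j)"

definition word_product :: "('l::ab_group_add, 'i) based_root_datum \<Rightarrow> 'i list \<Rightarrow> 'l \<Rightarrow> 'l" where
  "word_product D is =
     foldr (\<lambda>i w. simple_reflection D i \<otimes>\<^bsub>weyl_group D\<^esub> w) is \<one>\<^bsub>weyl_group D\<^esub>"

definition weyl_length :: "('l::ab_group_add, 'i) based_root_datum \<Rightarrow> ('l \<Rightarrow> 'l) \<Rightarrow> nat" where
  "weyl_length D w =
     (LEAST n. \<exists>is. set is \<subseteq> index_set D \<and> word_product D is = w \<and> length is = n)"

definition reduced_decomposition ::
    "('l::ab_group_add, 'i) based_root_datum \<Rightarrow> ('l \<Rightarrow> 'l) \<Rightarrow> 'i list \<Rightarrow> bool" where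
  "reduced_decomposition D w is \<longleftrightarrow>
     set is \<subseteq> index_set D \<and> word_product D is = w \<and> length is = weyl_length D w"

text \<open>The word i j i j \<open>\<dots>\<close> with m letters.\<close>

definition alternating :: "'i \<Rightarrow> 'i \<Rightarrow> nat \<Rightarrow> 'i list" where
  "alternating i j m = map (\<lambda>k. if even k then i else j) [0..<m]"


section \<open>The twisted formal group algebra\<close>

text \<open>
  The action \<open>w(x_\<lambda>) = x_(w \<lambda>)\<close>. It preserves the ideals and the relation by
  which cosets and fractions are formed, so it acts on a coset or fraction by taking images.
\<close>

definition poly_action :: "('l \<Rightarrow> 'l) \<Rightarrow> ('r::comm_ring_1, 'l) polynomials \<Rightarrow> ('r, 'l) polynomials" where
  "poly_action w p =
     (\<Sum>m\<in>Poly_Mapping.keys p. Poly_Mapping.single (image_mset w m) (Poly_Mapping.lookup p m))"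

definition series_action :: "('l \<Rightarrow> 'l) \<Rightarrow> ('r::comm_ring_1, 'l) series \<Rightarrow> ('r, 'l) series" where
  "series_action w s = (\<lambda>n. poly_action w ` s n)"

definition fga_action :: "('l \<Rightarrow> 'l) \<Rightarrow> ('r::comm_ring_1, 'l) fga \<Rightarrow> ('r, 'l) fga" where
  "fga_action w c = series_action w ` c"

definition frac_action :: "('l \<Rightarrow> 'l) \<Rightarrow> ('r::comm_ring_1, 'l) fga_frac \<Rightarrow> ('r, 'l) fga_frac" where
  "frac_action w q = map_prod (fga_action w) (fga_action w) ` q"

definition fga_fraction_field ::
    "'r::comm_ring_1 fps fps \<Rightarrow> ('r, 'l::ab_group_add) fga_frac ring" where
  "fga_fraction_field F = fraction_field (formal_group_algebra F)"

definition to_frac :: "'r::comm_ring_1 fps fps \<Rightarrow> ('r, 'l::ab_group_add) fga \<Rightarrow> ('r, 'l) fga_frac" where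
  "to_frac F a = fraction (formal_group_algebra F) a \<one>\<^bsub>formal_group_algebra F\<^esub>"

definition xvar :: "'r::comm_ring_1 fps fps \<Rightarrow> 'l::ab_group_add \<Rightarrow> ('r, 'l) fga_frac" where
  "xvar F l = to_frac F (fga_var F l)"

text \<open>
  The reciprocal of the product of the \<open>x_\<lambda>\<close> over a list of \<open>\<lambda>\<close>. If R has positive
  characteristic, \<open>x_\<lambda>\<close> may vanish for some nonzero \<open>\<lambda>\<close> (for the additive formal group
  law, \<open>x_(p\<lambda>) = p x_\<lambda>\<close>); its inverse is then zero by convention.
\<close>

definition xrecip :: "'r::comm_ring_1 fps fps \<Rightarrow> 'l::ab_group_add list \<Rightarrow> ('r, 'l) fga_frac" where
  "xrecip F ls = field_inverse (fga_fraction_field F)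
     (foldr (\<lambda>l y. xvar F l \<otimes>\<^bsub>fga_fraction_field F\<^esub> y) ls \<one>\<^bsub>fga_fraction_field F\<^esub>)"

definition Q_ring :: "'r::comm_ring_1 fps fps \<Rightarrow> ('r, 'l::ab_group_add) fga_frac ring" where
  "Q_ring F = (fga_fraction_field F)
     \<lparr>carrier := generate_ring (fga_fraction_field F)
        (to_frac F ` carrier (formal_group_algebra F) \<union> {xrecip F [l] |l. l \<noteq> 0})\<rparr>"

text \<open>
  \<open>R[W] \<otimes>\<^sub>R Q\<close> is the free right Q-module on the elements \<open>\<delta>_w\<close>: the function f stands for
  the sum of the \<open>\<delta>_w f(w)\<close> over the finite group W. Multiplication is the biadditive extension
  of \<open>(\<delta>_w' \<psi>') (\<delta>_w \<psi>) = \<delta>_(w'w) w\<^sup>-\<^sup>1(\<psi>') \<psi>\<close>.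
\<close>

definition twisted_algebra ::
    "'r::comm_ring_1 fps fps \<Rightarrow> ('l::ab_group_add, 'i) based_root_datum \<Rightarrow>
      (('l \<Rightarrow> 'l) \<Rightarrow> ('r, 'l) fga_frac) ring" where
  "twisted_algebra F D =
     \<lparr>carrier = {f. (\<forall>w\<in>carrier (weyl_group D). f w \<in> carrier (Q_ring F)) \<and>
                    (\<forall>w. w \<notin> carrier (weyl_group D) \<longrightarrow> f w = \<zero>\<^bsub>Q_ring F\<^esub>)},
      mult = (\<lambda>f g v. finsum (Q_ring F)
        (\<lambda>(w', w). frac_action (inv\<^bsub>weyl_group D\<^esub> w) (f w') \<otimes>\<^bsub>Q_ring F\<^esub> g w)
        {(w', w). w' \<in> carrier (weyl_group D) \<and> w \<in> carrier (weyl_group D) \<and>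
          w' \<otimes>\<^bsub>weyl_group D\<^esub> w = v}),
      one = (\<lambda>w. if w = \<one>\<^bsub>weyl_group D\<^esub> then \<one>\<^bsub>Q_ring F\<^esub> else \<zero>\<^bsub>Q_ring F\<^esub>),
      zero = (\<lambda>w. \<zero>\<^bsub>Q_ring F\<^esub>),
      add = (\<lambda>f g w. f w \<oplus>\<^bsub>Q_ring F\<^esub> g w)\<rparr>"

definition delta :: "'r::comm_ring_1 fps fps \<Rightarrow> ('l::ab_group_add \<Rightarrow> 'l) \<Rightarrow> ('l \<Rightarrow> 'l) \<Rightarrow> ('r, 'l) fga_frac" where
  "delta F w = (\<lambda>v. if v = w then \<one>\<^bsub>Q_ring F\<^esub> else \<zero>\<^bsub>Q_ring F\<^esub>)"

definition Q_embed ::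
    "'r::comm_ring_1 fps fps \<Rightarrow> ('l::ab_group_add, 'i) based_root_datum \<Rightarrow>
      ('r, 'l) fga_frac \<Rightarrow> ('l \<Rightarrow> 'l) \<Rightarrow> ('r, 'l) fga_frac" where
  "Q_embed F D q = (\<lambda>v. if v = \<one>\<^bsub>weyl_group D\<^esub> then q else \<zero>\<^bsub>Q_ring F\<^esub>)"


section \<open>Formal Demazure operators and elements\<close>

definition demazure_operator ::
    "'r::comm_ring_1 fps fps \<Rightarrow> ('l::ab_group_add, 'i) based_root_datum \<Rightarrow>
      'l \<Rightarrow> ('r, 'l) fga_frac \<Rightarrow> ('r, 'l) fga_frac" where
  "demazure_operator F D a q =
     (q \<ominus>\<^bsub>Q_ring F\<^esub> frac_action (reflection D a) q) \<otimes>\<^bsub>Q_ring F\<^esub> xrecip F [a]"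

definition demazure_element ::
    "'r::comm_ring_1 fps fps \<Rightarrow> ('l::ab_group_add, 'i) based_root_datum \<Rightarrow>
      'l \<Rightarrow> ('l \<Rightarrow> 'l) \<Rightarrow> ('r, 'l) fga_frac" where
  "demazure_element F D a =
     Q_embed F D (xrecip F [a]) \<otimes>\<^bsub>twisted_algebra F D\<^esub>
     (\<one>\<^bsub>twisted_algebra F D\<^esub> \<ominus>\<^bsub>twisted_algebra F D\<^esub> delta F (reflection D a))"

definition demazure_word ::
    "'r::comm_ring_1 fps fps \<Rightarrow> ('l::ab_group_add, 'i) based_root_datum \<Rightarrow>
      'i list \<Rightarrow> ('l \<Rightarrow> 'l) \<Rightarrow> ('r, 'l) fga_frac" where
  "demazure_word F D is =
     foldr (\<lambda>i y. demazure_element F D (simple_root D i) \<otimes>\<^bsub>twisted_algebra F D\<^esub> y) is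
       \<one>\<^bsub>twisted_algebra F D\<^esub>"

definition kappa :: "'r::comm_ring_1 fps fps \<Rightarrow> 'l::ab_group_add \<Rightarrow> 'l \<Rightarrow> ('r, 'l) fga_frac" where
  "kappa F l n = xrecip F [l + n, n] \<ominus>\<^bsub>Q_ring F\<^esub> xrecip F [l + n, - l]
     \<ominus>\<^bsub>Q_ring F\<^esub> xrecip F [l, n]"

text \<open>
  \<open>lincomb a b (n, m)\<close> is the weight abbreviated by the index \<open>ni + mj\<close>, where
  \<open>a = \<alpha>\<^sub>i\<close> and \<open>b = \<alpha>\<^sub>j\<close>; likewise for \<open>\<kappa>\<close> and for reciprocals of products of \<open>x_(ni + mj)\<close>.
\<close>

definition lincomb :: "'l::ab_group_add \<Rightarrow> 'l \<Rightarrow> int \<times> int \<Rightarrow> 'l" where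
  "lincomb a b = (\<lambda>(n, m). zscale n a + zscale m b)"

definition kappa2 ::
    "'r::comm_ring_1 fps fps \<Rightarrow> 'l::ab_group_add \<Rightarrow> 'l \<Rightarrow> int \<times> int \<Rightarrow> int \<times> int \<Rightarrow> ('r, 'l) fga_frac" where
  "kappa2 F a b p q = kappa F (lincomb a b p) (lincomb a b q)"

definition xrecip2 ::
    "'r::comm_ring_1 fps fps \<Rightarrow> 'l::ab_group_add \<Rightarrow> 'l \<Rightarrow> (int \<times> int) list \<Rightarrow> ('r, 'l) fga_frac" where
  "xrecip2 F a b ps = xrecip F (map (lincomb a b) ps)"

text \<open>
  \<open>xi_ij\<close> and \<open>xi_ji\<close> are two different functions of \<open>a = \<alpha>\<^sub>i\<close> and \<open>b = \<alpha>\<^sub>j\<close>: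
  they are not exchanged by swapping a and b.
\<close>

definition xi_ij :: "'r::comm_ring_1 fps fps \<Rightarrow> 'l::ab_group_add \<Rightarrow> 'l \<Rightarrow> ('r, 'l) fga_frac" where
  "xi_ij F a b =
     xrecip2 F a b [(1,0), (1,1), (1,2), (2,3)]
     \<oplus>\<^bsub>Q_ring F\<^esub> xrecip2 F a b [(1,0), (0,1), (1,2), (-2,-3)]
     \<oplus>\<^bsub>Q_ring F\<^esub> xrecip2 F a b [(1,0), (0,1), (2,3), (-1,-1)]
     \<ominus>\<^bsub>Q_ring F\<^esub> xrecip2 F a b [(1,0), (1,1), (1,2), (-1,-3)]
     \<ominus>\<^bsub>Q_ring F\<^esub> xrecip2 F a b [(1,0), (1,1), (1,3), (0,-1)]
     \<oplus>\<^bsub>Q_ring F\<^esub> xrecip2 F a b [(1,1), (1,3), (0,-1), (-2,-3)]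
     \<oplus>\<^bsub>Q_ring F\<^esub> xrecip2 F a b [(1,3), (2,3), (0,-1), (-1,-2)]
     \<oplus>\<^bsub>Q_ring F\<^esub> xrecip2 F a b [(1,1), (1,2), (-1,-3), (-2,-3)]
     \<ominus>\<^bsub>Q_ring F\<^esub> xrecip2 F a b [(1,0), (0,1), (1,2), (1,3)]"

definition xi_ji :: "'r::comm_ring_1 fps fps \<Rightarrow> 'l::ab_group_add \<Rightarrow> 'l \<Rightarrow> ('r, 'l) fga_frac" where
  "xi_ji F a b =
     xrecip2 F a b [(1,0), (0,1), (2,3), (-1,-2)]
     \<oplus>\<^bsub>Q_ring F\<^esub> xrecip2 F a b [(1,0), (0,1), (1,2), (-1,-3)]
     \<oplus>\<^bsub>Q_ring F\<^esub> xrecip2 F a b [(0,1), (1,2), (1,3), (2,3)]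
     \<ominus>\<^bsub>Q_ring F\<^esub> xrecip2 F a b [(1,0), (0,1), (1,1), (2,3)]
     \<oplus>\<^bsub>Q_ring F\<^esub> xrecip2 F a b [(1,1), (1,2), (-1,0), (-2,-3)]
     \<oplus>\<^bsub>Q_ring F\<^esub> xrecip2 F a b [(1,3), (2,3), (-1,-1), (-1,-2)]
     \<oplus>\<^bsub>Q_ring F\<^esub> xrecip2 F a b [(1,1), (1,3), (-1,0), (-1,-2)]
     \<ominus>\<^bsub>Q_ring F\<^esub> xrecip2 F a b [(0,1), (1,3), (2,3), (-1,-1)]
     \<ominus>\<^bsub>Q_ring F\<^esub> xrecip2 F a b [(0,1), (1,1), (1,3), (-1,0)]"

end

theory Submission
  imports Defs "HOL-Computational_Algebra.Fraction_Field"
begin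

text \<open>
  Write \<open>y\<^sub>\<lambda>\<close> for the reciprocal of \<open>x\<^sub>\<lambda>\<close>. An element of the twisted algebra is a function on the
  Weyl group W, and left multiplication by \<open>X\<^sub>\<alpha> = y\<^sub>\<alpha> (1 - \<delta>)\<close> sends such a function f to
  \<open>w \<mapsto> y\<^sub>\<mu> (f w - f (s\<^sub>\<alpha> w))\<close> with \<open>\<mu> = w\<^sup>-\<^sup>1 \<alpha>\<close>. Multiplication by an element of Q on the
  right is pointwise. Hence the coefficients of a product of Demazure elements are given by a
  recursion (\<open>word_coeff_Cons\<close>), and they are polynomials with integer coefficients in the
  \<open>y\<^sub>\<mu>\<close>. So are \<open>\<kappa>\<close>, \<open>\<xi>\<close> and their images under \<open>\<Delta>\<close>. All identities of the theorem turn out to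
  hold already when the \<open>y\<^sub>\<mu>\<close> are replaced by independent variables, one for each root \<open>\<mu>\<close> in the
  plane of \<open>\<alpha>\<^sub>i\<close> and \<open>\<alpha>\<^sub>j\<close>: what matters is only that w sends the reciprocal at \<open>\<mu>\<close> to the one at \<open>w \<mu>\<close>. Every
  element of the dihedral group generated by \<open>s\<^sub>i\<close> and \<open>s\<^sub>j\<close> is determined by an integral 2 by 2
  matrix, so that for each Cartan matrix there are \<open>2m\<close> polynomial identities to be checked
  (\<open>identity2\<close>, \<open>identity3\<close>, \<open>identity4\<close>, \<open>identity6\<close>); outside the dihedral group all coefficients
  vanish. As the identities are polynomial in the reciprocals, they persist when some \<open>x\<^sub>\<mu>\<close> is
  zero and its reciprocal is zero by convention.

  To reason in Q at all, one has to know that the formal group algebra is a domain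
  and that W acts on it. For a basis B of the lattice, F gives a group structure on the power
  series in t without constant term, over a polynomial ring K in variables \<open>X\<^sub>b\<close>, and the map
  \<open>b \<mapsto> t X\<^sub>b\<close> extends to a group homomorphism defined on the whole lattice. It induces a ring
  homomorphism from the completed polynomial ring to \<open>K[[t]]\<close> in which the power of t records the
  degree of a monomial, so that nothing is lost compared with power series in several variables.
  Its kernel is exactly the closed ideal of relations (\<open>fga_ideal_kernel\<close>): modulo the relations
  every element is congruent to a polynomial in the \<open>x\<^sub>b\<close> with b in B, and on those the map is
  injective. Hence the formal group algebra embeds in \<open>K[[t]]\<close>, its fraction field embeds
  in the fraction field of \<open>K[[t]]\<close>, and identities in Q may be verified there.

  For the first claim the words of the explicit formulas must be identified with
  the chosen reduced decompositions. Counting the positive roots that are made negative shows that an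
  alternating word in \<open>s\<^sub>i\<close> and \<open>s\<^sub>j\<close> with fewer than m letters is the unique reduced word of its
  product (\<open>alt_end_unique\<close>). The classification of the pairs of Cartan integers and the value of m come
  from an invariant form (\<open>cartan_product\<close>) and from the powers of the matrix of \<open>s\<^sub>i s\<^sub>j\<close>
  (\<open>reflection_order_pair\<close>).
\<close>

section \<open>Root data and the Weyl group\<close>

lemma zscale_additive: "additive f \<Longrightarrow> f (zscale n x) = zscale n (f x)"
  by (simp add: zscale_def additive.diff additive.sum)

lemma zscale_int [simp]: "zscale n (k::int) = n * k"
  by (cases "n \<ge> 0") (simp_all add: zscale_def)

lemma additive_zscale_int: "additive (f :: 'l::ab_group_add \<Rightarrow> int) \<Longrightarrow> f (zscale n x) = n * f x"
  by (simp add: zscale_additive)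

lemmas zscale_add_right = zmodule.scale_right_distrib
lemmas zscale_add_left = zmodule.scale_left_distrib

context reduced_root_datum
begin

abbreviation \<Phi> where "\<Phi> \<equiv> roots D"
abbreviation cr where "cr \<equiv> coroot D"
abbreviation refl where "refl \<equiv> reflection D"

lemma cr_add: "a \<in> \<Phi> \<Longrightarrow> cr a (x + y) = cr a x + cr a y"
  and cr_diff: "a \<in> \<Phi> \<Longrightarrow> cr a (x - y) = cr a x - cr a y"
  and cr_minus: "a \<in> \<Phi> \<Longrightarrow> cr a (- x) = - cr a x"
  and cr_zero: "a \<in> \<Phi> \<Longrightarrow> cr a 0 = 0"
  and cr_zscale: "a \<in> \<Phi> \<Longrightarrow> cr a (zscale n x) = n * cr a x"
  using coroot_additive by (simp_all add: additive.add additive.diff additive.minus additive.zero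
      additive.sum additive_zscale_int)

lemma root_nonzero: "a \<in> \<Phi> \<Longrightarrow> a \<noteq> 0"
  using coroot_self cr_zero by force

lemma refl_self: "a \<in> \<Phi> \<Longrightarrow> refl a a = - a"
proof -
  have "zscale 2 a = a + a" using zscale_add_left[of 1 1 a] by simp
  then show "a \<in> \<Phi> \<Longrightarrow> refl a a = - a" by (simp add: reflection_def coroot_self)
qed

lemma refl_additive: "a \<in> \<Phi> \<Longrightarrow> additive (refl a)"
  by unfold_locales (simp add: reflection_def cr_add zscale_add_left algebra_simps)

lemma refl_refl: "a \<in> \<Phi> \<Longrightarrow> refl a (refl a x) = x"
  by (simp add: reflection_def cr_diff cr_zscale coroot_self zmodule.scale_minus_left)

lemma bij_refl: "a \<in> \<Phi> \<Longrightarrow> bij (refl a)"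
  by (rule o_bij[of "refl a"]) (auto simp: refl_refl)

lemma cr_refl: "a \<in> \<Phi> \<Longrightarrow> b \<in> \<Phi> \<Longrightarrow> cr b (refl a x) = cr b x - cr b a * cr a x"
  by (simp add: reflection_def cr_diff cr_zscale)

text \<open>
  An invariant form on the lattice. It is only semidefinite, but on the span of the roots it is
  definite, and it expresses each coroot by its root (\<open>form_root\<close>).
\<close>

definition form where "form x y = (\<Sum>g\<in>\<Phi>. cr g x * cr g y)"

text \<open>
  The dual reflection permutes the coroots, since it is an involution that maps them to coroots.
\<close>

lemma sum_roots_dual_reflection:
  assumes a: "a \<in> \<Phi>"
  shows "(\<Sum>g\<in>\<Phi>. h (cr g)) = (\<Sum>g\<in>\<Phi>. h (\<lambda>l. cr g (refl a l)))"
proof -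
  let ?T = "\<lambda>f l. f (refl a l)"
  have "(\<Sum>g\<in>\<Phi>. h (cr g)) = (\<Sum>f\<in>cr ` \<Phi>. h f)"
    using coroot_inj by (simp add: sum.reindex)
  also have "\<dots> = (\<Sum>f\<in>cr ` \<Phi>. h (?T f))"
  proof (rule sum.reindex_bij_witness[of _ ?T ?T])
    fix f assume "f \<in> cr ` \<Phi>"
    then obtain b where b: "b \<in> \<Phi>" "f = cr b" by auto
    show "(\<lambda>l. (\<lambda>l. f (refl a l)) (refl a l)) = f" by (simp add: refl_refl a)
    show "(\<lambda>l. (\<lambda>l. f (refl a l)) (refl a l)) = f" by (simp add: refl_refl a)
    show "(\<lambda>l. f (refl a l)) \<in> cr ` \<Phi>"
      using reflection_coroot[OF a b(1)] by (simp add: b cr_refl a)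
    show "(\<lambda>l. f (refl a l)) \<in> cr ` \<Phi>"
      using reflection_coroot[OF a b(1)] by (simp add: b cr_refl a)
    show "h (\<lambda>l. (\<lambda>l. f (refl a l)) (refl a l)) = h f" by (simp add: refl_refl a)
  qed
  also have "\<dots> = (\<Sum>g\<in>\<Phi>. h (\<lambda>l. cr g (refl a l)))"
    using coroot_inj by (simp add: sum.reindex)
  finally show ?thesis .
qed

lemma form_refl: "a \<in> \<Phi> \<Longrightarrow> form (refl a x) (refl a y) = form x y"
  unfolding form_def using sum_roots_dual_reflection[of a "\<lambda>f. f x * f y"] by simp

text \<open>
  Applying the invariance of the form to \<open>s\<^sub>a\<close>, which negates a, gives the same sum with
  the opposite sign up to a multiple of \<open>\<langle>a\<^sup>\<or>, x\<rangle>\<close>.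
\<close>

lemma form_root: assumes "a \<in> \<Phi>" shows "2 * form a x = form a a * cr a x"
proof -
  have "form a x = form (refl a a) (refl a x)" by (simp add: form_refl assms)
  also have "\<dots> = (\<Sum>g\<in>\<Phi>. cr g a * cr g a * cr a x - cr g a * cr g x)"
    unfolding form_def refl_self[OF assms]
    by (intro sum.cong refl) (simp add: cr_refl assms cr_minus algebra_simps)
  also have "\<dots> = form a a * cr a x - form a x"
    by (simp add: form_def sum_subtractf sum_distrib_right)
  finally show ?thesis by simp
qed

lemma form_pos: assumes "a \<in> \<Phi>" shows "form a a > 0"
  unfolding form_def
proof (rule sum_pos2[OF finite_roots assms])
  show "0 < cr a a * cr a a" by (simp add: coroot_self assms)
qed auto

lemma form_zero_imp: assumes "form x x = 0" "g \<in> \<Phi>" shows "cr g x = 0"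
proof -
  have "cr g x * cr g x = 0"
    using assms sum_nonneg_eq_0_iff[of \<Phi> "\<lambda>g. cr g x * cr g x"] finite_roots
    by (auto simp: form_def)
  then show ?thesis by simp
qed

text \<open>
  The axioms do not say that the coroot of \<open>s\<^sub>a b\<close> is the dual reflection of the coroot of b.
  It is, because the form determines a coroot from its root and is invariant.
\<close>

lemma coroot_of_reflection:
  assumes a: "a \<in> \<Phi>" and b: "b \<in> \<Phi>"
  shows "cr (refl a b) (refl a x) = cr b x"
proof -
  have "form b b * cr (refl a b) (refl a x) = 2 * form (refl a b) (refl a x)"
    using form_root[OF reflection_root[OF a b], of "refl a x"] form_refl[OF a, of b b] by simp
  also have "\<dots> = form b b * cr b x" using form_root[OF b, of x] form_refl[OF a, of b x] by simp
  finally show ?thesis using form_pos[OF b] by simp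
qed

lemma torsion_free: assumes "zscale N x = 0" "N \<noteq> 0" shows "x = (0::'l)"
proof -
  obtain B :: "'l set" where B: "finite B" "zmodule.independent B" "zmodule.span B = UNIV"
    using free_finite_rank by blast
  then obtain u where u: "x = (\<Sum>b\<in>B. zscale (u b) b)"
    using zmodule.span_finite[OF B(1)] by (metis (no_types, lifting) UNIV_I imageE)
  have "(\<Sum>b\<in>B. zscale (N * u b) b) = 0"
    using assms(1) by (simp add: u zmodule.scale_sum_right)
  then have "\<And>b. b \<in> B \<Longrightarrow> N * u b = 0"
    using zmodule.independentD[OF B(2,1) order_refl, of "\<lambda>b. N * u b"] by blast
  then show ?thesis using assms(2) by (simp add: u)
qed

lemma sum_roots_reflection:
  assumes a: "a \<in> \<Phi>" shows "(\<Sum>g\<in>\<Phi>. h g) = (\<Sum>g\<in>\<Phi>. h (refl a g))"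
  by (rule sum.reindex_bij_witness[of _ "refl a" "refl a"])
     (auto simp: refl_refl a reflection_root)

text \<open>
  A combination of roots on which all coroots vanish is zero. The map
  \<open>q(f) = \<Sum>\<^sub>\<gamma> f(\<gamma>) \<gamma>\<close> sends each coroot to a positive multiple of its root, so a multiple of x is
  \<open>q(f)\<close> for a combination f of coroots. Then \<open>f(q(f)) = \<Sum>\<^sub>\<gamma> f(\<gamma>)\<^sup>2\<close>, while \<open>f(x) = 0\<close>; hence f
  vanishes on the roots and \<open>q(f) = 0\<close>.
\<close>

lemma root_span_coroots_faithful:
  assumes x: "x \<in> zmodule.span \<Phi>" and 0: "\<And>g. g \<in> \<Phi> \<Longrightarrow> cr g x = 0"
  shows "x = 0"
proof -
  define q where "q f = (\<Sum>g\<in>\<Phi>. zscale (f g) g)" for f :: "'l \<Rightarrow> int"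
  define C where "C b = (\<Sum>g\<in>\<Phi>. cr b g * cr b g)" for b
  have Cpos: "C b > 0" if "b \<in> \<Phi>" for b
    unfolding C_def by (rule sum_pos2[OF finite_roots that]) (simp_all add: coroot_self that)
  have q: "zscale 2 (q (cr b)) = zscale (C b) b" if b: "b \<in> \<Phi>" for b
  proof -
    have "q (cr b) = (\<Sum>g\<in>\<Phi>. zscale (cr b (refl b g)) (refl b g))"
      unfolding q_def using sum_roots_reflection[OF b] .
    also have "\<dots> = (\<Sum>g\<in>\<Phi>. zscale (cr b g * cr b g) b - zscale (cr b g) g)"
    proof (intro sum.cong refl)
      fix g
      have "cr b (refl b g) = - cr b g" by (simp add: cr_refl b coroot_self)
      then show "zscale (cr b (refl b g)) (refl b g) =
          zscale (cr b g * cr b g) b - zscale (cr b g) g"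
        by (simp add: reflection_def zmodule.scale_right_diff_distrib zmodule.scale_minus_left)
    qed
    also have "\<dots> = zscale (C b) b - q (cr b)"
      by (simp add: sum_subtractf C_def q_def zmodule.scale_sum_left)
    finally have "q (cr b) + q (cr b) = zscale (C b) b" by (metis diff_add_cancel)
    then show ?thesis using zscale_add_left[of 1 1 "q (cr b)"] by simp
  qed
  obtain c where c: "x = (\<Sum>b\<in>\<Phi>. zscale (c b) b)"
    using x zmodule.span_finite[OF finite_roots] by auto
  \<comment> \<open>N clears the factors \<open>C b\<close>, and \<open>2 e b\<close> are the coefficients for which \<open>q f = N x\<close>.\<close>
  define N where "N = (\<Prod>b\<in>\<Phi>. C b)"
  define e where "e b = c b * (\<Prod>b'\<in>\<Phi> - {b}. C b')" for b
  have eC: "e b * C b = N * c b" if "b \<in> \<Phi>" for b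
    using that finite_roots by (simp add: e_def N_def prod.remove[of _ b] algebra_simps)
  have N: "N \<noteq> 0" unfolding N_def using Cpos finite_roots by (metis less_irrefl prod_zero_iff)
  define f where "f l = (\<Sum>b\<in>\<Phi>. 2 * e b * cr b l)" for l
  have fz: "f (zscale n l) = n * f l" for n l
    by (simp add: f_def cr_zscale sum_distrib_left algebra_simps)
  have fsum: "f (sum h S) = (\<Sum>x\<in>S. f (h x))" for h S
    by (induction S rule: infinite_finite_induct)
       (simp_all add: f_def cr_zero cr_add sum.distrib algebra_simps)
  have "q f = (\<Sum>g\<in>\<Phi>. \<Sum>b\<in>\<Phi>. zscale (e b) (zscale 2 (zscale (cr b g) g)))"
    unfolding q_def f_def by (simp add: zmodule.scale_sum_left algebra_simps)
  also have "\<dots> = (\<Sum>b\<in>\<Phi>. \<Sum>g\<in>\<Phi>. zscale (e b) (zscale 2 (zscale (cr b g) g)))"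
    by (rule sum.swap)
  also have "\<dots> = (\<Sum>b\<in>\<Phi>. zscale (e b) (zscale 2 (q (cr b))))"
    by (simp only: q_def zmodule.scale_sum_right)
  also have "\<dots> = (\<Sum>b\<in>\<Phi>. zscale N (zscale (c b) b))"
    by (intro sum.cong refl) (simp add: q eC)
  also have "\<dots> = zscale N x" by (simp add: c zmodule.scale_sum_right)
  finally have qf: "q f = zscale N x" .
  have "(\<Sum>g\<in>\<Phi>. f g * f g) = f (q f)" by (simp add: q_def fsum fz)
  also have "\<dots> = N * f x" by (simp add: qf fz)
  also have "f x = 0" by (simp add: f_def 0)
  finally have "\<And>g. g \<in> \<Phi> \<Longrightarrow> f g = 0"
    using sum_nonneg_eq_0_iff[of \<Phi> "\<lambda>g. f g * f g"] finite_roots by auto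
  then have "q f = 0" by (simp add: q_def)
  then show ?thesis using torsion_free[OF _ N] qf by simp
qed

abbreviation WG where "WG \<equiv> weyl_group D"
abbreviation W where "W \<equiv> carrier (weyl_group D)"

lemma Bij_UNIV: "Bij UNIV = {f. bij f}"
  by (auto simp: Bij_def)

lemma BijGroup_mult: "bij f \<Longrightarrow> bij g \<Longrightarrow> f \<otimes>\<^bsub>BijGroup UNIV\<^esub> g = f \<circ> g"
  by (auto simp: BijGroup_def Bij_UNIV compose_def)

lemma BijGroup_one: "\<one>\<^bsub>BijGroup UNIV\<^esub> = id"
  by (auto simp: BijGroup_def)

lemma BijGroup_inv: "bij f \<Longrightarrow> inv\<^bsub>BijGroup UNIV\<^esub> f = inv_into UNIV f"
  by (simp add: inv_BijGroup Bij_UNIV restrict_UNIV)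

lemma refl_in_Bij: "refl ` \<Phi> \<subseteq> carrier (BijGroup UNIV)"
  using bij_refl by (auto simp: BijGroup_def Bij_UNIV)

lemma group_weyl: "group WG"
  unfolding weyl_group_def
  using group.generate_is_subgroup[OF group_BijGroup refl_in_Bij] group_BijGroup
  by (rule subgroup.subgroup_is_group)

lemma weyl_bij: assumes "w \<in> W" shows "bij w"
proof -
  have "w \<in> carrier (BijGroup UNIV)"
    using assms group.generate_incl[OF group_BijGroup refl_in_Bij] by (auto simp: weyl_group_def)
  then show ?thesis by (simp add: BijGroup_def Bij_UNIV)
qed

lemma weyl_mult: "v \<in> W \<Longrightarrow> w \<in> W \<Longrightarrow> v \<otimes>\<^bsub>WG\<^esub> w = v \<circ> w"
  using BijGroup_mult[of v w] weyl_bij by (simp add: weyl_group_def)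

lemma weyl_one: "\<one>\<^bsub>WG\<^esub> = id"
  using BijGroup_one by (simp add: weyl_group_def)

lemma weyl_id: "id \<in> W"
  using group.is_monoid[OF group_weyl] monoid.one_closed weyl_one by metis

lemma weyl_comp: "v \<in> W \<Longrightarrow> w \<in> W \<Longrightarrow> v \<circ> w \<in> W"
  using weyl_mult monoid.m_closed[OF group.is_monoid[OF group_weyl]] by metis

lemma weyl_refl: "a \<in> \<Phi> \<Longrightarrow> refl a \<in> W"
  by (auto simp: weyl_group_def intro: generate.incl)

lemma weyl_inv: assumes "w \<in> W" shows "inv\<^bsub>WG\<^esub> w = inv_into UNIV w" and "inv_into UNIV w \<in> W"
proof -
  have "inv\<^bsub>WG\<^esub> w \<in> W" using group.inv_closed[OF group_weyl assms] .
  moreover have "w \<circ> inv\<^bsub>WG\<^esub> w = id"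
    using group.r_inv[OF group_weyl assms] weyl_mult[OF assms calculation] weyl_one by simp
  then have "inv\<^bsub>WG\<^esub> w = inv_into UNIV w"
    by (metis assms bij_def comp_assoc id_comp inv_o_cancel comp_id weyl_bij)
  ultimately show "inv\<^bsub>WG\<^esub> w = inv_into UNIV w" "inv_into UNIV w \<in> W" by simp_all
qed

lemma weyl_induct [consumes 1, case_names id refl comp]:
  assumes w: "w \<in> W" and "P id" and "\<And>a. a \<in> \<Phi> \<Longrightarrow> P (refl a)"
    and "\<And>v w. v \<in> W \<Longrightarrow> w \<in> W \<Longrightarrow> P v \<Longrightarrow> P w \<Longrightarrow> P (v \<circ> w)"
  shows "P w"
proof -
  have "w \<in> generate (BijGroup UNIV) (refl ` \<Phi>)" using w by (simp add: weyl_group_def)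
  then show ?thesis
  proof induction
    case one
    then show ?case using assms BijGroup_one by metis
  next
    case (incl h)
    then show ?case using assms by auto
  next
    case (inv h)
    then obtain a where a: "a \<in> \<Phi>" "h = refl a" by auto
    have "inv_into UNIV h = h"
      unfolding a by (rule inv_unique_comp) (auto simp: refl_refl a)
    then show ?case using a assms by (simp add: BijGroup_inv bij_refl)
  next
    case (eng h1 h2)
    then have "h1 \<in> W" "h2 \<in> W" by (auto simp: weyl_group_def)
    then show ?case using eng assms BijGroup_mult weyl_bij by metis
  qed
qed

lemma weyl_additive: "w \<in> W \<Longrightarrow> additive w"
  by (induction rule: weyl_induct) (use refl_additive in \<open>auto simp: additive_def\<close>)

lemma weyl_root: "w \<in> W \<Longrightarrow> b \<in> \<Phi> \<Longrightarrow> w b \<in> \<Phi>"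
  by (induction arbitrary: b rule: weyl_induct) (auto simp: reflection_root)

lemma weyl_coroot: "w \<in> W \<Longrightarrow> b \<in> \<Phi> \<Longrightarrow> cr (w b) (w x) = cr b x"
  by (induction arbitrary: b x rule: weyl_induct) (auto simp: coroot_of_reflection weyl_root)

lemma weyl_diff_span: "w \<in> W \<Longrightarrow> w x - x \<in> zmodule.span \<Phi>"
proof (induction arbitrary: x rule: weyl_induct)
  case (refl a)
  have "zscale (- cr a x) a \<in> zmodule.span \<Phi>"
    using refl by (intro zmodule.span_scale zmodule.span_base)
  then show ?case by (simp add: reflection_def zmodule.scale_minus_left)
next
  case (comp v w)
  have "v (w x) - w x + (w x - x) \<in> zmodule.span \<Phi>"
    using comp by (intro zmodule.span_add) auto
  then show ?case by simp
qed (simp add: zmodule.span_zero)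

text \<open>
  If w fixes the roots, then \<open>w x - x\<close> is a combination of roots, and all coroots take the same
  value on x and \<open>w x\<close>.
\<close>

lemma weyl_fixes_roots_imp_id:
  assumes w: "w \<in> W" and fixes_roots: "\<And>b. b \<in> \<Phi> \<Longrightarrow> w b = b" shows "w = id"
proof
  fix x
  have "w x - x = 0"
  proof (rule root_span_coroots_faithful[OF weyl_diff_span[OF w]])
    fix g assume "g \<in> \<Phi>"
    then show "cr g (w x - x) = 0" using weyl_coroot[OF w, of g x] fixes_roots by (simp add: cr_diff)
  qed
  then show "w x = id x" by simp
qed

text \<open>
  An element of W is determined by the permutation of the finite set of roots that it induces.
  Finiteness matters because the product of the twisted algebra is a sum over W.
\<close>

lemma finite_weyl: "finite W"
proof (rule finite_imageD)
  have "(\<lambda>w. restrict w \<Phi>) ` W \<subseteq> \<Phi> \<rightarrow>\<^sub>E \<Phi>" by (auto simp: weyl_root)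
  then show "finite ((\<lambda>w. restrict w \<Phi>) ` W)"
    using finite_PiE[OF finite_roots, of "\<lambda>_. \<Phi>"] finite_roots finite_subset by blast
  show "inj_on (\<lambda>w. restrict w \<Phi>) W"
  proof (rule inj_onI)
    fix v w assume vw: "v \<in> W" "w \<in> W" "restrict v \<Phi> = restrict w \<Phi>"
    have "inv_into UNIV v \<circ> w = id"
    proof (rule weyl_fixes_roots_imp_id)
      show "inv_into UNIV v \<circ> w \<in> W" using vw by (simp add: weyl_comp weyl_inv)
      fix b assume "b \<in> \<Phi>"
      then have "w b = v b" using vw(3) by (metis restrict_apply')
      then show "(inv_into UNIV v \<circ> w) b = b" using weyl_bij[OF vw(1)] by (simp add: bij_is_inj)
    qed
    then have "v \<circ> (inv_into UNIV v \<circ> w) = v" by simp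
    then have "(v \<circ> inv_into UNIV v) \<circ> w = v" by (simp add: comp_assoc)
    then show "v = w" using weyl_bij[OF vw(1)] by (metis bij_is_surj id_comp surj_iff)
  qed
qed

end

section \<open>Positive roots and reduced words\<close>

context reduced_based_root_datum
begin

abbreviation I where "I \<equiv> index_set D"
abbreviation \<alpha> where "\<alpha> \<equiv> simple_root D"
abbreviation s where "s \<equiv> simple_reflection D"

lemma simple_root: "k \<in> I \<Longrightarrow> \<alpha> k \<in> \<Phi>"
  using simple_root_in by auto

lemma finite_index: "finite I"
  using finite_imageD[OF _ simple_root_inj] finite_subset[OF simple_root_in finite_roots] by blast

definition coord where "coord k x = zmodule.representation (\<alpha> ` I) x (\<alpha> k)"

abbreviation L where "L \<equiv> zmodule.span (\<alpha> ` I)"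

lemma simple_span: "k \<in> I \<Longrightarrow> \<alpha> k \<in> L" by (intro zmodule.span_base) auto

lemma root_in_span: assumes "b \<in> \<Phi>" shows "b \<in> L"
proof -
  have *: "(\<Sum>i\<in>I. zscale (int (c i)) (\<alpha> i)) \<in> L" for c
    by (intro zmodule.span_sum zmodule.span_scale simple_span)
  show ?thesis using root_expansion[OF assms] *  zmodule.span_neg by metis
qed

lemma coord_add: "x \<in> L \<Longrightarrow> y \<in> L \<Longrightarrow> coord k (x + y) = coord k x + coord k y"
  by (simp add: coord_def zmodule.representation_add[OF simple_root_independent])

lemma coord_minus: "x \<in> L \<Longrightarrow> coord k (- x) = - coord k x"
  by (simp add: coord_def zmodule.representation_neg[OF simple_root_independent])

lemma coord_diff: "x \<in> L \<Longrightarrow> y \<in> L \<Longrightarrow> coord k (x - y) = coord k x - coord k y"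
  by (simp add: coord_def zmodule.representation_diff[OF simple_root_independent])

lemma coord_scale: "x \<in> L \<Longrightarrow> coord k (zscale n x) = n * coord k x"
  by (simp add: coord_def zmodule.representation_scale[OF simple_root_independent])

lemma coord_simple: "k \<in> I \<Longrightarrow> l \<in> I \<Longrightarrow> coord k (\<alpha> l) = (if k = l then 1 else 0)"
  using inj_onD[OF simple_root_inj, of k l]
  by (auto simp: coord_def zmodule.representation_basis[OF simple_root_independent])

lemma coord_zero: "coord k 0 = 0"
  by (simp add: coord_def zmodule.representation_zero)

lemma coord_sum: "(\<And>i. i \<in> S \<Longrightarrow> h i \<in> L) \<Longrightarrow> coord k (sum h S) = (\<Sum>i\<in>S. coord k (h i))"
  by (induction S rule: infinite_finite_induct)
     (auto simp: coord_add zmodule.span_sum coord_zero)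

lemma coord_expansion: assumes "x \<in> L" shows "x = (\<Sum>i\<in>I. zscale (coord i x) (\<alpha> i))"
proof -
  have "(\<Sum>b\<in>\<alpha> ` I. zscale (zmodule.representation (\<alpha> ` I) x b) b) = x"
    using assms by (intro zmodule.sum_representation_eq[OF simple_root_independent])
      (auto simp: finite_index)
  then show ?thesis by (simp add: sum.reindex[OF simple_root_inj] coord_def)
qed

definition pos where "pos x \<longleftrightarrow> (\<forall>k\<in>I. coord k x \<ge> 0)"

lemma root_sign: assumes "b \<in> \<Phi>" shows "pos b \<or> pos (- b)"
proof -
  have 1: "coord k (\<Sum>i\<in>I. zscale (int (c i)) (\<alpha> i)) = int (c k)" if "k \<in> I" for c k
    using that finite_index
    by (simp add: coord_sum coord_scale coord_simple zmodule.span_scale simple_span if_distrib sum.delta cong: if_cong)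
  then show ?thesis using root_expansion[OF assms] unfolding pos_def by fastforce
qed

lemma root_sign_unique: assumes "b \<in> \<Phi>" "pos b" shows "\<not> pos (- b)"
proof
  assume "pos (- b)"
  then have "\<And>k. k \<in> I \<Longrightarrow> coord k b = 0"
    using assms by (force simp: pos_def coord_minus root_in_span)
  then have "b = 0" using coord_expansion[OF root_in_span[OF assms(1)]] by simp
  then show False using root_nonzero assms by auto
qed

lemma root_pos_if: assumes "b \<in> \<Phi>" "k \<in> I" "coord k b > 0" shows "pos b"
  using root_sign[OF assms(1)] assms by (fastforce simp: pos_def coord_minus root_in_span)

lemma s_apply: "s k x = x - zscale (cr (\<alpha> k) x) (\<alpha> k)"
  by (simp add: simple_reflection_def reflection_def)

lemma pos_simple: "k \<in> I \<Longrightarrow> pos (\<alpha> k)"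
  by (simp add: pos_def coord_simple)

lemma s_simple: "k \<in> I \<Longrightarrow> s k (\<alpha> k) = - \<alpha> k"
  by (simp add: simple_reflection_def refl_self simple_root)

lemma s_s: "k \<in> I \<Longrightarrow> s k (s k x) = x"
  by (simp add: simple_reflection_def refl_refl simple_root)

lemma s_weyl: "k \<in> I \<Longrightarrow> s k \<in> W"
  by (simp add: simple_reflection_def weyl_refl simple_root)

text \<open>
  A positive root that is not a multiple of \<open>\<alpha> k\<close> has a positive coordinate away from k, which
  the reflection does not change. The only positive multiple of \<open>\<alpha> k\<close> that is a root is
  \<open>\<alpha> k\<close>: the coroot of \<open>n \<alpha> k\<close> takes the value 2 there, so n divides 2, and 2 is excluded as the
  root datum is reduced.
\<close>

lemma simple_reflection_pos:
  assumes b: "b \<in> \<Phi>" and p: "pos b" and k: "k \<in> I" and ne: "b \<noteq> \<alpha> k"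
  shows "pos (s k b)"
proof -
  have "\<exists>l\<in>I. l \<noteq> k \<and> coord l b > 0"
  proof (rule ccontr)
    assume "\<not> ?thesis"
    then have z: "\<And>l. l \<in> I \<Longrightarrow> l \<noteq> k \<Longrightarrow> coord l b = 0" using p by (force simp: pos_def)
    have "b = (\<Sum>i\<in>I. if i = k then zscale (coord k b) (\<alpha> k) else 0)"
      by (subst coord_expansion[OF root_in_span[OF b]], rule sum.cong) (auto simp: z)
    then have bk: "b = zscale (coord k b) (\<alpha> k)" using k finite_index by (simp add: sum.delta)
    have "cr b b = coord k b * cr b (\<alpha> k)" by (subst (2) bk) (simp add: cr_zscale b)
    then have "coord k b dvd 2" by (metis coroot_self b dvd_triv_left)
    moreover have "coord k b \<ge> 0" using p k by (simp add: pos_def)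
    moreover have "coord k b \<noteq> 0" using bk root_nonzero[OF b] by auto
    moreover have "coord k b \<noteq> 1" using bk ne by auto
    moreover have "coord k b \<le> 2" using zdvd_imp_le[OF calculation(1)] by simp
    ultimately have "coord k b = 1 + 1" by linarith
    then have "b = \<alpha> k + \<alpha> k" using bk zscale_add_left[of 1 1 "\<alpha> k"] by simp
    then show False using reduced simple_root[OF k] b by auto
  qed
  then obtain l where l: "l \<in> I" "l \<noteq> k" "coord l b > 0" by blast
  have "coord l (s k b) = coord l b"
    by (simp add: s_apply coord_diff coord_scale root_in_span b simple_span zmodule.span_scale k coord_simple l)
  then show ?thesis using root_pos_if[of "s k b" l] l weyl_root[OF s_weyl[OF k] b] by simp
qed

definition inv_set where "inv_set w = {b \<in> \<Phi>. pos b \<and> \<not> pos (w b)}"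

lemma finite_inv_set: "finite (inv_set w)"
  by (simp add: inv_set_def finite_roots)

text \<open>
  The reflection \<open>s k\<close> permutes the positive roots other than \<open>\<alpha> k\<close>, so that the inversions
  of w and of \<open>w s k\<close> correspond to each other except for \<open>\<alpha> k\<close>, which is an inversion of exactly
  one of the two.
\<close>

lemma card_inv_set_comp:
  assumes w: "w \<in> W" and k: "k \<in> I"
  shows "card (inv_set (w \<circ> s k)) + (if pos (w (\<alpha> k)) then 0 else 1) =
         card (inv_set w) + (if pos (w (\<alpha> k)) then 1 else 0)"
proof -
  have sub: "s k ` (inv_set v - {\<alpha> k}) \<subseteq> inv_set (v \<circ> s k) - {\<alpha> k}" for v
  proof
    fix c assume "c \<in> s k ` (inv_set v - {\<alpha> k})"
    then obtain b where b: "c = s k b" "b \<in> \<Phi>" "pos b" "\<not> pos (v b)" "b \<noteq> \<alpha> k"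
      by (auto simp: inv_set_def)
    have "c \<noteq> \<alpha> k"
    proof
      assume "c = \<alpha> k"
      then have "b = - \<alpha> k" using b(1) s_s[OF k] s_simple[OF k] by metis
      then show False using b(3) root_sign_unique[OF simple_root[OF k] pos_simple[OF k]] by simp
    qed
    then show "c \<in> inv_set (v \<circ> s k) - {\<alpha> k}"
      using b simple_reflection_pos[OF b(2,3) k b(5)] weyl_root[OF s_weyl[OF k] b(2)] s_s[OF k]
      by (simp add: inv_set_def)
  qed
  have "inv_set (w \<circ> s k) - {\<alpha> k} = s k ` (inv_set w - {\<alpha> k})"
  proof
    show "inv_set (w \<circ> s k) - {\<alpha> k} \<subseteq> s k ` (inv_set w - {\<alpha> k})"
    proof
      fix c assume c: "c \<in> inv_set (w \<circ> s k) - {\<alpha> k}"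
      have "(w \<circ> s k) \<circ> s k = w" using s_s[OF k] by auto
      then have "s k c \<in> inv_set w - {\<alpha> k}" using sub[of "w \<circ> s k"] c by auto
      then show "c \<in> s k ` (inv_set w - {\<alpha> k})" using s_s[OF k, of c] by (metis imageI)
    qed
  qed (rule sub)
  moreover have "inj (s k)" using s_s[OF k] by (metis injI)
  ultimately have c: "card (inv_set (w \<circ> s k) - {\<alpha> k}) = card (inv_set w - {\<alpha> k})"
    by (simp add: card_image inj_on_subset)
  have wk: "w (\<alpha> k) \<in> \<Phi>" "w (- \<alpha> k) = - w (\<alpha> k)"
    using weyl_root[OF w simple_root[OF k]] additive.minus[OF weyl_additive[OF w]] by auto
  have 1: "\<alpha> k \<in> inv_set w \<longleftrightarrow> \<not> pos (w (\<alpha> k))"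
    by (simp add: inv_set_def simple_root k pos_simple)
  have 2: "\<alpha> k \<in> inv_set (w \<circ> s k) \<longleftrightarrow> pos (w (\<alpha> k))"
    using root_sign[OF wk(1)] root_sign_unique[OF wk(1)]
    by (auto simp: inv_set_def simple_root k pos_simple s_simple wk)
  have card_remove: "card A = card (A - {\<alpha> k}) + (if \<alpha> k \<in> A then 1 else 0)" if "finite A" for A
    using that by (cases "\<alpha> k \<in> A") (simp_all add: card_Suc_Diff1 del: card_Diff_insert)
  have "card (inv_set (w \<circ> s k)) = card (inv_set w - {\<alpha> k}) + (if pos (w (\<alpha> k)) then 1 else 0)"
    using card_remove[OF finite_inv_set, of "w \<circ> s k"] unfolding c 2 .
  moreover have "card (inv_set w) = card (inv_set w - {\<alpha> k}) + (if \<not> pos (w (\<alpha> k)) then 1 else 0)"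
    using card_remove[OF finite_inv_set, of w] unfolding 1 .
  ultimately show ?thesis by (cases "pos (w (\<alpha> k))") (simp_all del: card_Diff_insert)
qed

lemma inv_set_id: "inv_set id = {}" by (auto simp: inv_set_def)

abbreviation wp where "wp \<equiv> word_product D"

lemma wp_Nil: "wp [] = id" by (simp add: word_product_def weyl_one)

lemma wp_Cons_mult: "wp (k # u) = s k \<otimes>\<^bsub>WG\<^esub> wp u"
  by (simp add: word_product_def)

lemma wp_weyl: "set u \<subseteq> I \<Longrightarrow> wp u \<in> W"
proof (induction u)
  case Nil
  then show ?case by (subst wp_Nil) (rule weyl_id)
next
  case (Cons k u)
  then have "k \<in> I" "wp u \<in> W" by auto
  then show ?case
    by (subst wp_Cons_mult) (auto intro: monoid.m_closed[OF group.is_monoid[OF group_weyl]] s_weyl)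
qed

lemma wp_Cons: "k \<in> I \<Longrightarrow> set u \<subseteq> I \<Longrightarrow> wp (k # u) = s k \<circ> wp u"
  by (subst wp_Cons_mult) (rule weyl_mult[OF s_weyl wp_weyl])

lemma wp_append: "set u \<subseteq> I \<Longrightarrow> set v \<subseteq> I \<Longrightarrow> wp (u @ v) = wp u \<circ> wp v"
proof (induction u)
  case Nil
  show ?case by (subst wp_Nil) simp
next
  case (Cons k u)
  have k: "k \<in> I" "set u \<subseteq> I" "set (u @ v) \<subseteq> I" using Cons.prems by auto
  have "wp ((k # u) @ v) = s k \<circ> wp (u @ v)" using wp_Cons[OF k(1,3)] by simp
  also have "wp (u @ v) = wp u \<circ> wp v" using Cons k by blast
  also have "s k \<circ> (wp u \<circ> wp v) = wp (k # u) \<circ> wp v"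
    by (subst wp_Cons[OF k(1,2)]) (rule comp_assoc[symmetric])
  finally show ?case .
qed

lemma wp_single: "k \<in> I \<Longrightarrow> wp [k] = s k"
  using wp_Cons[of k "[]"] unfolding wp_Nil comp_id by simp

lemma wp_snoc: "set u \<subseteq> I \<Longrightarrow> k \<in> I \<Longrightarrow> wp (u @ [k]) = wp u \<circ> s k"
  using wp_append[of u "[k]"] wp_single by simp

lemma card_inv_set_word: "set u \<subseteq> I \<Longrightarrow> card (inv_set (wp u)) \<le> length u"
proof (induction u rule: rev_induct)
  case Nil
  show ?case by (subst wp_Nil, subst inv_set_id) simp
next
  case (snoc k u)
  have u: "set u \<subseteq> I" "k \<in> I" using snoc by auto
  show ?case
    using snoc.IH[OF u(1)] card_inv_set_comp[OF wp_weyl[OF u(1)] u(2)]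
    by (subst wp_snoc[OF u]) (simp split: if_splits)
qed

fun alt_end :: "'i \<Rightarrow> 'i \<Rightarrow> nat \<Rightarrow> 'i list" where
  "alt_end y x 0 = []"
| "alt_end y x (Suc n) = alt_end x y n @ [y]"

lemma length_alt_end: "length (alt_end y x n) = n"
  by (induction n arbitrary: y x) auto

lemma set_alt_end: "set (alt_end y x n) \<subseteq> {x, y}"
  by (induction n arbitrary: y x) auto

text \<open>
  As long as the alternating word u keeps sending the next simple root to a positive root, its
  product has as many inversions as u has letters, so no word for it is shorter. If v is another
  word of this length, its last letter z must be a descent: \<open>\<alpha> z\<close> goes to a negative root. This
  excludes all letters but the last letter of u, and the induction removes it.
\<close>

lemma alt_end_unique:
  assumes ij: "i \<in> I" "j \<in> I"
    and asc: "\<And>n x y. n < m \<Longrightarrow> {x, y} = {i, j} \<Longrightarrow> pos (wp (alt_end y x n) (\<alpha> x))"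
    and other: "\<And>u k. set u \<subseteq> {i, j} \<Longrightarrow> k \<in> I \<Longrightarrow> k \<notin> {i, j} \<Longrightarrow> pos (wp u (\<alpha> k))"
  shows "n < m \<Longrightarrow> {x, y} = {i, j} \<Longrightarrow> set v \<subseteq> I \<Longrightarrow> length v \<le> n \<Longrightarrow>
    wp v = wp (alt_end y x n) \<Longrightarrow> v = alt_end y x n"
proof (induction n arbitrary: x y v)
  case 0
  then show ?case by simp
next
  case (Suc n)
  have setw: "set (alt_end y x n) \<subseteq> I" "set (alt_end y x n) \<subseteq> {i, j}" if "{x, y} = {i, j}" for x y n
    using set_alt_end[of y x n] that ij by auto
  have card: "card (inv_set (wp (alt_end y x n))) = n" if "n \<le> m" "{x, y} = {i, j}" for n x y
    using that
  proof (induction n arbitrary: x y)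
    case 0
    show ?case by (subst alt_end.simps, subst wp_Nil, subst inv_set_id) simp
  next
    case (Suc n)
    have yx: "{y, x} = {i, j}" using Suc.prems(2) by auto
    have "y \<in> I" using ij Suc.prems(2) by auto
    have "card (inv_set (wp (alt_end x y n) \<circ> s y)) = Suc n"
      using Suc.IH[of y x] Suc.prems yx card_inv_set_comp[OF wp_weyl[OF setw(1)[OF yx]] \<open>y \<in> I\<close>, of n]
        asc[of n y x] by simp
    then show ?case unfolding alt_end.simps by (subst wp_snoc[OF setw(1)[OF yx] \<open>y \<in> I\<close>])
  qed
  let ?u = "alt_end y x (Suc n)"
  have Nv: "card (inv_set (wp v)) = Suc n" using card[of "Suc n" x y] Suc.prems by simp
  then have "length v = Suc n" using card_inv_set_word[OF Suc.prems(3)] Suc.prems(4) by simp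
  then obtain v' z where v: "v = v' @ [z]" "length v' = n" by (metis length_Suc_conv_rev)
  have z: "z \<in> I" "set v' \<subseteq> I" using Suc.prems(3) v by auto
  have ss: "s z \<circ> s z = id" using s_s[OF z(1)] by auto
  have "wp v \<circ> s z = wp v'"
    unfolding v(1) by (subst wp_snoc[OF z(2,1)]) (simp only: comp_assoc ss comp_id)
  then have N': "card (inv_set (wp v \<circ> s z)) \<le> n" using card_inv_set_word[OF z(2)] v by simp
  have npos: "\<not> pos (wp v (\<alpha> z))"
    using card_inv_set_comp[OF wp_weyl[OF Suc.prems(3)] z(1)] N' Nv by (auto split: if_splits)
  have "z \<in> {i, j}" using other[OF setw(2)[OF Suc.prems(2)] z(1)] npos Suc.prems(5) by metis
  moreover have "z \<noteq> x" using asc[OF Suc.prems(1,2)] npos Suc.prems(5) by metis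
  ultimately have zy: "z = y" using Suc.prems(2) by blast
  have yx: "{y, x} = {i, j}" using Suc.prems(2) by auto
  have "wp v' = wp ?u \<circ> s z" using \<open>wp v \<circ> s z = wp v'\<close> Suc.prems(5) by metis
  also have "wp ?u = wp (alt_end x y n) \<circ> s z"
    unfolding alt_end.simps zy using wp_snoc[OF setw(1)[OF yx]] z zy by blast
  also have "wp (alt_end x y n) \<circ> s z \<circ> s z = wp (alt_end x y n)" by (simp only: comp_assoc ss comp_id)
  finally have "v' = alt_end x y n"
    using Suc.IH[of y x v'] Suc.prems(1) yx z v by simp
  then show ?case using v zy by simp
qed

end

section \<open>Pairs of simple roots\<close>

type_synonym vec2 = "int \<times> int"

text \<open>
  The two simple reflections in the coordinates of the plane of two simple roots with Cartan integers x and y. In the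
  words below, \<open>True\<close> stands for the first reflection and \<open>False\<close> for the second.
\<close>

fun reflect2 :: "int \<Rightarrow> int \<Rightarrow> bool \<Rightarrow> vec2 \<Rightarrow> vec2" where
  "reflect2 x y True (p, q) = (- p - x * q, q)"
| "reflect2 x y False (p, q) = (p, - q - y * p)"

text \<open>
  A pair of vectors stands for the matrix with these columns.
\<close>

fun mat_apply :: "vec2 \<times> vec2 \<Rightarrow> vec2 \<Rightarrow> vec2" where
  "mat_apply ((a, b), (c, d)) (p, q) = (p * a + q * c, p * b + q * d)"

text \<open>
  The matrix of v composed with a simple reflection, in terms of the matrix of v.
\<close>

definition mat_step :: "int \<Rightarrow> int \<Rightarrow> bool \<Rightarrow> vec2 \<times> vec2 \<Rightarrow> vec2 \<times> vec2" where
  "mat_step x y t M = (mat_apply M (reflect2 x y t (1, 0)), mat_apply M (reflect2 x y t (0, 1)))"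

fun alt_letters :: "bool \<Rightarrow> nat \<Rightarrow> bool list" where
  "alt_letters t 0 = []"
| "alt_letters t (Suc n) = alt_letters (\<not> t) n @ [t]"

definition cartan_order :: "int \<Rightarrow> int \<Rightarrow> nat" where
  "cartan_order x y = (if x * y = 0 then 2 else if x * y = 1 then 3 else if x * y = 2 then 4 else 6)"

definition finite_cartan :: "(int \<times> int) set" where
  "finite_cartan = {(0, 0), (-1, -1), (-1, -2), (-2, -1), (-1, -3), (-3, -1)}"

lemma alt_letters_unfold:
  "alt_letters t (Suc 0) = [t]"
  "alt_letters t 2 = [\<not> t, t]"
  "alt_letters t 3 = [t, \<not> t, t]"
  "alt_letters t 4 = [\<not> t, t, \<not> t, t]"
  "alt_letters t 5 = [t, \<not> t, t, \<not> t, t]"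
  by (simp_all add: eval_nat_numeral)

text \<open>
  This finite check replaces the description of the positive roots of each rank two system.
\<close>

lemma alt_letters_ascending:
  assumes "(x, y) \<in> finite_cartan" "n < cartan_order x y"
  shows "case foldr (reflect2 x y) (alt_letters t n) (if t then (0, 1) else (1, 0)) of (p, q) \<Rightarrow> p \<ge> 0 \<and> q \<ge> 0"
proof -
  consider "n = 0" | "n = Suc 0" | "n = 2" | "2 < cartan_order x y" "n = 3" | "3 < cartan_order x y" "n = 3"
    | "4 < cartan_order x y" "n = 4" | "5 < cartan_order x y" "n = 5"
    using assms(2) by (force simp: cartan_order_def split: if_splits)
  then show ?thesis
    by cases (use assms in \<open>cases t; force simp: finite_cartan_def cartan_order_def alt_letters_unfold\<close>)+
qed

locale simple_root_pair = reduced_based_root_datum D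
  for D :: "('l::ab_group_add, 'i) based_root_datum" +
  fixes i j :: 'i
  assumes i: "i \<in> index_set D" and j: "j \<in> index_set D" and ij: "i \<noteq> j"
begin

abbreviation cij where "cij \<equiv> cr (\<alpha> i) (\<alpha> j)"
abbreviation cji where "cji \<equiv> cr (\<alpha> j) (\<alpha> i)"
abbreviation lc where "lc \<equiv> lincomb (\<alpha> i) (\<alpha> j)"

text \<open>
  The root \<open>s\<^sub>i \<alpha>\<^sub>j\<close> has coordinate 1 at j, so it is positive.
\<close>

lemma cartan_nonpos: "cij \<le> 0"
proof (rule ccontr)
  assume c: "\<not> ?thesis"
  have r: "s i (\<alpha> j) \<in> \<Phi>" using weyl_root[OF s_weyl[OF i] simple_root[OF j]] .
  have "coord j (s i (\<alpha> j)) = 1" "coord i (s i (\<alpha> j)) = - cij"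
    using ij i j by (simp_all add: s_apply coord_diff coord_scale simple_span zmodule.span_scale coord_simple)
  then show False using root_pos_if[OF r j] c i by (auto simp: pos_def)
qed

lemma form_commute: "form x y = form y x" by (simp add: form_def mult.commute)

lemma cartan_zero_iff: "cij = 0 \<longleftrightarrow> cji = 0"
  using form_root[OF simple_root[OF i], of "\<alpha> j"] form_root[OF simple_root[OF j], of "\<alpha> i"]
    form_pos[OF simple_root[OF i]] form_pos[OF simple_root[OF j]]
  by (simp add: form_commute[of "\<alpha> j" "\<alpha> i"]) auto

lemma lc_span: "lc z \<in> L"
  by (cases z) (simp add: lincomb_def zmodule.span_add zmodule.span_scale simple_span i j)

lemma coord_lc: "coord i (lc (p, q)) = p" "coord j (lc (p, q)) = q"
  "k \<in> I \<Longrightarrow> k \<noteq> i \<Longrightarrow> k \<noteq> j \<Longrightarrow> coord k (lc (p, q)) = 0"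
  using ij i j by (simp_all add: lincomb_def coord_add coord_scale zmodule.span_scale simple_span coord_simple)

lemma lc_inj: "lc z = lc z' \<longleftrightarrow> z = z'"
  using coord_lc by (metis prod.exhaust)

lemma lc_unit: "lc (1, 0) = \<alpha> i" "lc (0, 1) = \<alpha> j"
  by (simp_all add: lincomb_def)

lemma form_diff_scale: "form (zscale m x - zscale n y) (zscale m x - zscale n y) =
   m * m * form x x - 2 * m * n * form x y + n * n * form y y"
  by (simp add: form_def cr_diff cr_zscale sum_distrib_left sum_subtractf[symmetric]
      sum.distrib[symmetric] algebra_simps)

text \<open>
  The strict Cauchy-Schwarz inequality for the form: \<open>cij * cji\<close> is four times the squared cosine
  of the angle between the two simple roots.
\<close>

lemma cartan_product: "cij * cji < 4"
proof -
  let ?ii = "form (\<alpha> i) (\<alpha> i)" and ?jj = "form (\<alpha> j) (\<alpha> j)" and ?ij = "form (\<alpha> i) (\<alpha> j)"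
  \<comment> \<open>A multiple of the component of \<open>\<alpha> j\<close> orthogonal to \<open>\<alpha> i\<close>.\<close>
  let ?v = "zscale ?ii (\<alpha> j) - zscale ?ij (\<alpha> i)"
  have pos: "?ii > 0" "?jj > 0" using form_pos simple_root i j by auto
  have v: "?v = lc (- ?ij, ?ii)" by (simp add: lincomb_def zmodule.scale_minus_left)
  have "lc (0, 0) = 0" by (simp add: lincomb_def)
  then have "?v \<noteq> 0" using lc_inj[of "(- ?ij, ?ii)" "(0, 0)"] pos(1) unfolding v by simp
  moreover have "?v \<in> zmodule.span \<Phi>"
    by (intro zmodule.span_diff zmodule.span_scale zmodule.span_base simple_root i j)
  ultimately have "form ?v ?v \<noteq> 0"
    using root_span_coroots_faithful form_zero_imp by blast
  moreover have "form ?v ?v \<ge> 0" by (auto simp: form_def intro: sum_nonneg)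
  ultimately have "form ?v ?v > 0" by simp
  also have "form ?v ?v = ?ii * (?ii * ?jj - ?ij * ?ij)"
    by (simp add: form_diff_scale form_commute[of "\<alpha> j" "\<alpha> i"] algebra_simps)
  finally have d: "?ij * ?ij < ?ii * ?jj" using pos by (simp add: zero_less_mult_iff)
  have "2 * ?ij = ?ii * cij" "2 * ?ij = ?jj * cji"
    using form_root[OF simple_root[OF i], of "\<alpha> j"] form_root[OF simple_root[OF j], of "\<alpha> i"]
    by (simp_all add: form_commute[of "\<alpha> j" "\<alpha> i"])
  have "(?ii * ?jj) * (cij * cji) = 4 * (?ij * ?ij)"
  proof -
    have "(?ii * cij) * (?jj * cji) = (2 * ?ij) * (2 * ?ij)"
      using \<open>2 * ?ij = ?ii * cij\<close> \<open>2 * ?ij = ?jj * cji\<close> by simp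
    then show ?thesis by (simp add: algebra_simps)
  qed
  then have "(?ii * ?jj) * (cij * cji) < (?ii * ?jj) * 4" using d by simp
  moreover have "?ii * ?jj > 0" using pos by simp
  ultimately show ?thesis by (simp only: mult_less_cancel_left_pos)
qed

lemma swapped: "simple_root_pair D j i"
  using i j ij by unfold_locales auto

lemma cartan_finite: "(cij, cji) \<in> finite_cartan"
proof -
  interpret sw: simple_root_pair D j i by (rule swapped)
  define a b where "a = - cij" and "b = - cji"
  have ab: "a \<ge> 0" "b \<ge> 0" "a * b < 4" "a = 0 \<longleftrightarrow> b = 0"
    using cartan_nonpos sw.cartan_nonpos cartan_product cartan_zero_iff by (auto simp: a_def b_def)
  have "a < 4"
  proof (cases "b = 0")
    case False
    then have "a * 1 \<le> a * b" using ab by (intro mult_left_mono) auto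
    then show ?thesis using ab by linarith
  qed (use ab in simp)
  moreover have "b < 4"
  proof (cases "a = 0")
    case False
    then have "1 * b \<le> a * b" using ab by (intro mult_right_mono) auto
    then show ?thesis using ab by linarith
  qed (use ab in simp)
  ultimately have "a \<in> {0, 1, 2, 3}" "b \<in> {0, 1, 2, 3}" using ab by auto
  then have "(- a, - b) \<in> finite_cartan" using ab(3,4) by (auto simp: finite_cartan_def)
  then show ?thesis by (simp add: a_def b_def)
qed

definition letter where "letter t = (if t then i else j)"

lemma letter_index: "letter t \<in> I" by (simp add: letter_def i j)

lemma letters: "set (map letter u) \<subseteq> I" using letter_index by auto

lemma s_letter: "s (letter t) (lc z) = lc (reflect2 cij cji t z)"
proof -
  obtain p q where z: "z = (p, q)" by force
  have c: "cr (\<alpha> i) (lc (p, q)) = 2 * p + cij * q" "cr (\<alpha> j) (lc (p, q)) = cji * p + 2 * q"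
    unfolding lincomb_def using i j by (simp_all add: cr_add cr_zscale coroot_self simple_root)
  have "lc (p, q) - zscale c (\<alpha> i) = lc (p - c, q)" "lc (p, q) - zscale c (\<alpha> j) = lc (p, q - c)" for c
    by (simp_all add: lincomb_def zmodule.scale_left_diff_distrib)
  then show ?thesis
    by (cases t) (simp_all only: z letter_def s_apply if_True if_False c reflect2.simps, simp_all add: algebra_simps)
qed

lemma wp_letters: "wp (map letter u) (lc z) = lc (foldr (reflect2 cij cji) u z)"
proof (induction u)
  case Nil
  show ?case by (simp add: wp_Nil)
next
  case (Cons t u)
  then show ?case
    using fun_cong[OF wp_Cons[OF letter_index letters[of u]], of t "lc z"] by (simp add: s_letter)
qed

lemma wp_letters_fix: "wp (map letter u) x - x \<in> range lc"
proof (induction u)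
  case Nil
  have "lc (0, 0) = 0" by (simp add: lincomb_def)
  then show ?case by (metis wp_Nil cancel_comm_monoid_add_class.diff_cancel id_apply list.simps(8) rangeI)
next
  case (Cons t u)
  then obtain p q where z: "wp (map letter u) x - x = lc (p, q)" by force
  have "s (letter t) y - y = lc (if t then (- cr (\<alpha> i) y, 0) else (0, - cr (\<alpha> j) y))" for y
    by (cases t) (simp_all add: letter_def s_apply lincomb_def zmodule.scale_minus_left)
  then obtain p' q' where z': "s (letter t) (wp (map letter u) x) - wp (map letter u) x = lc (p', q')"
    by (metis prod.exhaust)
  have "wp (map letter (t # u)) x - x =
      (s (letter t) (wp (map letter u) x) - wp (map letter u) x) + (wp (map letter u) x - x)"
    using fun_cong[OF wp_Cons[OF letter_index letters[of u]], of t x] by simp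
  also have "\<dots> = lc (p' + p, q' + q)"
    unfolding z z' by (simp add: lincomb_def zscale_add_left)
  finally show ?case by (metis rangeI)
qed

text \<open>
  The first conjunct restricts v to the dihedral group, where the action on the plane determines
  v (\<open>has_matrix_id_iff\<close>).
\<close>

definition has_matrix :: "('l \<Rightarrow> 'l) \<Rightarrow> vec2 \<times> vec2 \<Rightarrow> bool" where
  "has_matrix v M \<longleftrightarrow> v \<in> range (\<lambda>u. wp (map letter u)) \<and> v (\<alpha> i) = lc (fst M) \<and> v (\<alpha> j) = lc (snd M)"

lemma has_matrix_weyl: "has_matrix v M \<Longrightarrow> v \<in> W"
  using wp_weyl[OF letters] by (auto simp: has_matrix_def)

lemma has_matrix_id: "has_matrix id ((1, 0), (0, 1))"
  using wp_Nil by (auto simp: has_matrix_def lc_unit intro: range_eqI[of _ _ "[]"])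

lemma has_matrix_apply: assumes "has_matrix v M" shows "v (lc z) = lc (mat_apply M z)"
proof -
  have ad: "additive v" using weyl_additive has_matrix_weyl[OF assms] .
  obtain a b c d p q where Mz: "M = ((a, b), (c, d))" "z = (p, q)" by (metis prod.exhaust)
  have "v (lc (p, q)) = zscale p (v (\<alpha> i)) + zscale q (v (\<alpha> j))"
    using ad by (simp add: lincomb_def additive.add zscale_additive)
  also have "\<dots> = zscale p (lc (a, b)) + zscale q (lc (c, d))"
    using assms by (simp add: has_matrix_def Mz)
  also have "\<dots> = lc (p * a + q * c, p * b + q * d)"
    by (simp only: lincomb_def prod.case zscale_add_left zscale_add_right zmodule.scale_scale add_ac)
  finally show ?thesis by (simp add: Mz)
qed

lemma has_matrix_step: assumes "has_matrix v M" shows "has_matrix (v \<circ> s (letter t)) (mat_step cij cji t M)"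
proof -
  obtain u where u: "v = wp (map letter u)" using assms by (auto simp: has_matrix_def)
  have "v \<circ> s (letter t) = wp (map letter (u @ [t]))"
    unfolding u using wp_snoc[OF letters letter_index, of u t] by simp
  then have "v \<circ> s (letter t) \<in> range (\<lambda>u. wp (map letter u))" by (metis rangeI)
  moreover have "s (letter t) (\<alpha> i) = lc (reflect2 cij cji t (1, 0))"
    "s (letter t) (\<alpha> j) = lc (reflect2 cij cji t (0, 1))" by (simp_all flip: s_letter add: lc_unit)
  ultimately show ?thesis by (simp add: has_matrix_def mat_step_def has_matrix_apply[OF assms])
qed

text \<open>
  If v fixes both simple roots, then \<open>v x - x\<close> lies in their plane and is killed by both coroots.
  The Cartan matrix is nondegenerate, hence \<open>v x = x\<close>.
\<close>

lemma has_matrix_id_iff: assumes "has_matrix v M" shows "v = id \<longleftrightarrow> M = ((1, 0), (0, 1))"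
proof
  assume "v = id"
  then have "lc (fst M) = lc (1, 0)" "lc (snd M) = lc (0, 1)"
    using assms by (simp_all add: has_matrix_def lc_unit)
  then show "M = ((1, 0), (0, 1))" by (simp add: lc_inj prod_eq_iff)
next
  assume M: "M = ((1, 0), (0, 1))"
  have fixed: "v (\<alpha> i) = \<alpha> i" "v (\<alpha> j) = \<alpha> j" using assms by (simp_all add: has_matrix_def M lc_unit)
  show "v = id"
  proof
    fix x
    obtain u where "v = wp (map letter u)" using assms by (auto simp: has_matrix_def)
    then obtain p q where pq: "v x - x = lc (p, q)" using wp_letters_fix[of u x] by force
    have "cr (\<alpha> i) (v x - x) = 0" "cr (\<alpha> j) (v x - x) = 0"
      using weyl_coroot[OF has_matrix_weyl[OF assms] simple_root[OF i], of x]
        weyl_coroot[OF has_matrix_weyl[OF assms] simple_root[OF j], of x]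
      by (simp_all add: cr_diff simple_root i j fixed)
    then have e: "2 * p + q * cij = 0" "p * cji + 2 * q = 0"
      unfolding pq using i j by (simp_all add: lincomb_def cr_add cr_zscale coroot_self simple_root)
    have "p = 0 \<and> q = 0" using cartan_finite e by (auto simp: finite_cartan_def)
    then show "v x = id x" using pq by (simp add: lincomb_def)
  qed
qed

lemma not_dihedral_not_id: "v \<notin> range (\<lambda>u. wp (map letter u)) \<Longrightarrow> v \<noteq> id"
  using wp_Nil by (metis list.simps(8) rangeI)

lemma not_dihedral_step:
  assumes "v \<notin> range (\<lambda>u. wp (map letter u))"
  shows "v \<circ> s (letter t) \<notin> range (\<lambda>u. wp (map letter u))"
proof
  assume "v \<circ> s (letter t) \<in> range (\<lambda>u. wp (map letter u))"
  then obtain u where "v \<circ> s (letter t) = wp (map letter u)" by auto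
  then have "v \<circ> s (letter t) \<circ> s (letter t) = wp (map letter (u @ [t]))"
    using wp_snoc[OF letters letter_index, of u t] by simp
  moreover have "v \<circ> s (letter t) \<circ> s (letter t) = v"
    using s_s[OF letter_index] by (auto simp: fun_eq_iff)
  ultimately show False using assms by (metis rangeI)
qed

lemma has_matrix_closed:
  assumes "((1, 0), (0, 1)) \<in> Ms" "\<And>M t. M \<in> Ms \<Longrightarrow> mat_step cij cji t M \<in> Ms"
    and "v \<in> range (\<lambda>u. wp (map letter u))"
  shows "\<exists>M\<in>Ms. has_matrix v M"
proof -
  have "\<exists>M\<in>Ms. has_matrix (wp (map letter u)) M" for u
  proof (induction u rule: rev_induct)
    case Nil
    have "has_matrix (wp (map letter [])) ((1, 0), (0, 1))"
      by (subst list.map(1), subst wp_Nil) (rule has_matrix_id)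
    then show ?case using assms(1) by blast
  next
    case (snoc t u)
    then obtain M where M: "M \<in> Ms" "has_matrix (wp (map letter u)) M" by auto
    have "wp (map letter (u @ [t])) = wp (map letter u) \<circ> s (letter t)"
      using wp_snoc[OF letters letter_index, of u t] by simp
    from has_matrix_step[OF M(2), of t, folded this] show ?case using assms(2)[OF M(1), of t] by blast
  qed
  then show ?thesis using assms(3) by auto
qed

definition rot where "rot = s i \<circ> s j"

definition mrot where "mrot = mat_step cij cji False \<circ> mat_step cij cji True"

lemma has_matrix_rot: "has_matrix (rot ^^ n) ((mrot ^^ n) ((1, 0), (0, 1)))"
proof (induction n)
  case 0
  show ?case using has_matrix_id by (simp add: id_def)
next
  case (Suc n)
  have r: "rot ^^ Suc n = (rot ^^ n) \<circ> s (letter True) \<circ> s (letter False)"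
    by (simp only: funpow_Suc_right letter_def if_True if_False comp_assoc rot_def)
  have m: "(mrot ^^ Suc n) M = mat_step cij cji False (mat_step cij cji True ((mrot ^^ n) M))" for M
    by (simp add: mrot_def)
  show ?case unfolding m by (subst r) (rule has_matrix_step[OF has_matrix_step[OF Suc]])
qed

lemma rot_power_id_iff: "rot ^^ n = id \<longleftrightarrow> (mrot ^^ n) ((1, 0), (0, 1)) = ((1, 0), (0, 1))"
  by (rule has_matrix_id_iff[OF has_matrix_rot])

lemma rot_weyl: "rot \<in> W" unfolding rot_def by (intro weyl_comp s_weyl i j)

lemma weyl_pow: assumes "w \<in> W" shows "w [^]\<^bsub>WG\<^esub> (n::nat) = w ^^ n"
proof -
  have "w [^]\<^bsub>WG\<^esub> n = w ^^ n \<and> w ^^ n \<in> W"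
  proof (induction n)
    case 0
    then show ?case using weyl_id by (simp add: weyl_one id_def)
  next
    case (Suc n)
    have "w [^]\<^bsub>WG\<^esub> Suc n = (w ^^ n) \<otimes>\<^bsub>WG\<^esub> w" using Suc by (simp add: nat_pow_Suc)
    also have "\<dots> = w ^^ Suc n" using weyl_mult[of "w ^^ n" w] Suc assms by (simp only: funpow_Suc_right)
    finally show ?case using weyl_comp[of "w ^^ n" w] Suc assms by (simp only: funpow_Suc_right)
  qed
  then show ?thesis by simp
qed

text \<open>
  By the matrix criterion the order can be read off from the powers of one integral matrix.
\<close>

lemma reflection_order_pair: "reflection_order D i j = cartan_order cij cji"
proof -
  have o: "reflection_order D i j = group.ord WG rot"
    using weyl_mult[OF s_weyl[OF i] s_weyl[OF j]] by (simp add: reflection_order_def rot_def)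
  define d where "d = group.ord WG rot"
  have dvd: "d dvd n \<longleftrightarrow> (mrot ^^ n) ((1, 0), (0, 1)) = ((1, 0), (0, 1))" for n
    using group.pow_eq_id[OF group_weyl rot_weyl, of n] weyl_pow[OF rot_weyl, of n]
      rot_power_id_iff[of n] by (simp add: weyl_one d_def)
  have small: "\<not> d dvd n" if n: "0 < n" "n < cartan_order cij cji" for n
  proof -
    consider "n = 1" | "2 < cartan_order cij cji" "n = 2" | "3 < cartan_order cij cji" "n = 3"
      | "4 < cartan_order cij cji" "n = 4" | "5 < cartan_order cij cji" "n = 5"
      using n by (force simp: cartan_order_def split: if_splits)
    then show ?thesis unfolding dvd
      by cases (use cartan_finite in \<open>force simp: finite_cartan_def mat_step_def mrot_def numeral_eq_Suc cartan_order_def\<close>)+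
  qed
  have d: "d dvd cartan_order cij cji" unfolding dvd using cartan_finite
    by (force simp: finite_cartan_def mat_step_def mrot_def numeral_eq_Suc cartan_order_def)
  have "cartan_order cij cji > 0" by (simp add: cartan_order_def)
  then have "d > 0" "d \<le> cartan_order cij cji" using d dvd_imp_le by (auto intro: dvd_pos_nat)
  then have "d = cartan_order cij cji" using small[of d] by force
  then show ?thesis using o by (simp add: d_def)
qed

lemma alt_end_letters: "alt_end (letter t) (letter (\<not> t)) n = map letter (alt_letters t n)"
proof (induction n arbitrary: t)
  case (Suc n)
  show ?case using Suc[of "\<not> t"] by simp
qed simp

lemma alt_end_pos:
  assumes "n < reflection_order D i j" "{x, y} = {i, j}"
  shows "pos (wp (alt_end y x n) (\<alpha> x))"
proof -
  define t where "t = (y = i)"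
  have yx: "y = letter t" "x = letter (\<not> t)" using assms(2) ij by (auto simp: t_def letter_def doubleton_eq_iff)
  have "\<alpha> x = lc (if t then (0, 1) else (1, 0))" unfolding yx by (simp add: letter_def lc_unit)
  moreover obtain p q where pq: "foldr (reflect2 cij cji) (alt_letters t n) (if t then (0, 1) else (1, 0)) = (p, q)" by force
  ultimately have "wp (alt_end y x n) (\<alpha> x) = lc (p, q)"
    unfolding yx alt_end_letters using wp_letters[of "alt_letters t n"] by metis
  moreover have "p \<ge> 0 \<and> q \<ge> 0"
    using alt_letters_ascending[OF cartan_finite, of n t] assms(1) pq by (simp add: reflection_order_pair)
  ultimately show ?thesis unfolding pos_def by (metis coord_lc order_refl)
qed

text \<open>
  Reflections in the plane do not change the coordinate 1 of \<open>\<alpha> k\<close> at k.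
\<close>

lemma pos_other: assumes "set u \<subseteq> {i, j}" "k \<in> I" "k \<notin> {i, j}" shows "pos (wp u (\<alpha> k))"
proof -
  have "u = map letter (map (\<lambda>x. x = i) u)" using assms(1) ij by (induction u) (auto simp: letter_def)
  then obtain u' where u': "u = map letter u'" by metis
  obtain p q where pq: "wp u (\<alpha> k) - \<alpha> k = lc (p, q)" using wp_letters_fix[of u' "\<alpha> k"] u' by force
  then have "wp u (\<alpha> k) = \<alpha> k + lc (p, q)" by (metis add.commute diff_add_cancel)
  then have "coord k (wp u (\<alpha> k)) = 1"
    using assms by (simp add: coord_add simple_span lc_span coord_simple coord_lc)
  moreover have "wp u (\<alpha> k) \<in> \<Phi>"
    unfolding u' using weyl_root[OF wp_weyl[OF letters] simple_root[OF assms(2)]] .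
  ultimately show ?thesis using root_pos_if[of _ k] assms by simp
qed

lemma alt_word_unique:
  assumes "n < reflection_order D i j" "{x, y} = {i, j}" "set v \<subseteq> I" "length v \<le> n"
    "wp v = wp (alt_end y x n)"
  shows "v = alt_end y x n"
  by (rule alt_end_unique[OF i j alt_end_pos pos_other assms])

lemma alt_word_length:
  assumes n: "n < reflection_order D i j" and xy: "{x, y} = {i, j}"
  shows "weyl_length D (wp (alt_end y x n)) = n"
proof -
  have set: "set (alt_end y x n) \<subseteq> I" using set_alt_end[of y x n] xy i j by auto
  let ?P = "\<lambda>n'. \<exists>v. set v \<subseteq> I \<and> wp v = wp (alt_end y x n) \<and> length v = n'"
  have "?P n" using set length_alt_end by metis
  moreover have "n \<le> n'" if P: "?P n'" for n'
  proof (rule ccontr)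
    assume "\<not> n \<le> n'"
    then obtain v where "set v \<subseteq> I" "wp v = wp (alt_end y x n)" "length v < n" using P by auto
    then show False using alt_word_unique[OF n xy, of v] length_alt_end[of y x n] by auto
  qed
  ultimately show ?thesis unfolding weyl_length_def by (rule Least_equality)
qed

lemma reduced_alt_word:
  assumes n: "n < reflection_order D i j" and xy: "{x, y} = {i, j}"
    and r: "reduced_decomposition D (wp (alt_end y x n)) r"
  shows "r = alt_end y x n"
  using alt_word_unique[OF n xy, of r] r alt_word_length[OF n xy]
  by (simp add: reduced_decomposition_def)

end

section \<open>Evaluation of polynomials\<close>

definition eval_poly :: "('r::comm_ring_1 \<Rightarrow> 'a::comm_ring_1) \<Rightarrow> ('l multiset \<Rightarrow> 'a) \<Rightarrow> ('r, 'l) polynomials \<Rightarrow> 'a" where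
  "eval_poly c e p = (\<Sum>m\<in>Poly_Mapping.keys p. c (Poly_Mapping.lookup p m) * e m)"

lemma poly_monomials: "(\<Sum>m\<in>Poly_Mapping.keys p. Poly_Mapping.single m (Poly_Mapping.lookup p m)) = p"
proof (rule poly_mapping_eqI)
  fix k
  have "(\<Sum>m\<in>Poly_Mapping.keys p. Poly_Mapping.lookup (Poly_Mapping.single m (Poly_Mapping.lookup p m)) k)
      = (\<Sum>m\<in>Poly_Mapping.keys p. if m = k then Poly_Mapping.lookup p k else 0)"
    by (intro sum.cong refl) (auto simp: lookup_single when_def)
  then show "Poly_Mapping.lookup (\<Sum>m\<in>Poly_Mapping.keys p. Poly_Mapping.single m (Poly_Mapping.lookup p m)) k
      = Poly_Mapping.lookup p k"
    by (simp add: lookup_sum sum.delta in_keys_iff)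
qed

text \<open>
  A homomorphism on coefficients and one on monomials extend to the polynomial ring. This is used
  for the evaluation in power series and for the action of W on polynomials.
\<close>

locale evaluation =
  fixes c :: "'r::comm_ring_1 \<Rightarrow> 'a::comm_ring_1" and e :: "'l multiset \<Rightarrow> 'a"
  assumes c_add: "c (x + y) = c x + c y" and c_mult: "c (x * y) = c x * c y" and c_one: "c 1 = 1"
    and e_empty: "e {#} = 1" and e_add: "e (m + n) = e m * e n"
begin

lemma c_zero: "c 0 = 0" using c_add[of 0 0] by simp

lemma eval_poly_superset:
  "finite S \<Longrightarrow> Poly_Mapping.keys p \<subseteq> S \<Longrightarrow> eval_poly c e p = (\<Sum>m\<in>S. c (Poly_Mapping.lookup p m) * e m)"
  unfolding eval_poly_def by (rule sum.mono_neutral_left) (auto simp: in_keys_iff c_zero)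

lemma eval_poly_add: "eval_poly c e (p + q) = eval_poly c e p + eval_poly c e q"
  using keys_add[of p q]
  by (simp add: eval_poly_superset[of "Poly_Mapping.keys p \<union> Poly_Mapping.keys q"] lookup_add c_add
      distrib_right sum.distrib)

lemma eval_poly_zero: "eval_poly c e 0 = 0" by (simp add: eval_poly_def)

lemma eval_poly_sum: "eval_poly c e (sum h S) = (\<Sum>x\<in>S. eval_poly c e (h x))"
  by (induction S rule: infinite_finite_induct) (simp_all add: eval_poly_zero eval_poly_add)

lemma eval_poly_single: "eval_poly c e (Poly_Mapping.single m r) = c r * e m"
  by (simp add: eval_poly_def c_zero)

lemma eval_poly_one: "eval_poly c e 1 = 1"
  using eval_poly_single[of 0 1] by (simp add: c_one e_empty)

lemma eval_poly_mult: "eval_poly c e (p * q) = eval_poly c e p * eval_poly c e q"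
proof -
  have "p * q = (\<Sum>m\<in>Poly_Mapping.keys p. \<Sum>n\<in>Poly_Mapping.keys q.
      Poly_Mapping.single (m + n) (Poly_Mapping.lookup p m * Poly_Mapping.lookup q n))"
    by (subst (1) poly_monomials[of p, symmetric], subst (1) poly_monomials[of q, symmetric])
       (simp add: sum_product mult_single)
  then have "eval_poly c e (p * q) = (\<Sum>m\<in>Poly_Mapping.keys p. \<Sum>n\<in>Poly_Mapping.keys q.
      (c (Poly_Mapping.lookup p m) * e m) * (c (Poly_Mapping.lookup q n) * e n))"
    by (simp add: eval_poly_sum eval_poly_single c_mult e_add algebra_simps)
  then show ?thesis by (simp add: eval_poly_def sum_product)
qed

lemma eval_poly_minus: "eval_poly c e (- p) = - eval_poly c e p"
  using eval_poly_add[of p "- p"] by (simp add: eval_poly_zero eq_neg_iff_add_eq_0 add.commute)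

lemma eval_poly_diff: "eval_poly c e (p - q) = eval_poly c e p - eval_poly c e q"
  using eval_poly_add[of p "- q"] eval_poly_minus[of q] by simp

lemma eval_poly_power: "eval_poly c e (p ^ n) = eval_poly c e p ^ n"
  by (induction n) (simp_all add: eval_poly_one eval_poly_mult)

lemma eval_poly_pconst: "eval_poly c e (pconst r) = c r"
  by (simp add: pconst_def eval_poly_single e_empty)

lemma eval_poly_pvar: "eval_poly c e (pvar l) = e {#l#}"
  by (simp add: pvar_def eval_poly_single c_one)

end

lemma pconst_add: "pconst (x + y) = pconst x + pconst y" by (simp add: pconst_def single_add)
lemma pconst_mult: "pconst (x * y) = pconst x * pconst y" by (simp add: pconst_def mult_single)
lemma pconst_one: "pconst 1 = 1" by (simp add: pconst_def flip: zero_multiset_def)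

section \<open>Powers of the augmentation ideal\<close>

definition type_ring :: "'a::comm_ring_1 ring" where
  "type_ring = \<lparr>carrier = UNIV, mult = (*), one = 1, zero = 0, add = (+)\<rparr>"

lemma type_ring_simps [simp]: "carrier type_ring = UNIV" "mult type_ring = (*)"
  "one type_ring = 1" "zero type_ring = 0" "add type_ring = (+)"
  by (simp_all add: type_ring_def)

lemma cring_type_ring: "cring (type_ring :: 'a::comm_ring_1 ring)"
proof (rule cringI)
  show "abelian_group (type_ring :: 'a ring)"
  proof (rule abelian_groupI)
    fix x :: 'a
    show "\<exists>y\<in>carrier type_ring. y \<oplus>\<^bsub>type_ring\<^esub> x = \<zero>\<^bsub>type_ring\<^esub>"
      by (intro bexI[of _ "- x"]) auto
  qed (auto simp: add_ac)
  show "comm_monoid (type_ring :: 'a ring)"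
    by (rule comm_monoidI) (auto simp: algebra_simps)
qed (auto simp: algebra_simps)

lemma poly_ring_simps [simp]: "carrier poly_ring = UNIV" "mult poly_ring = (*)"
  "one poly_ring = 1" "zero poly_ring = 0" "add poly_ring = (+)"
  by (simp_all add: poly_ring_def)

lemma cring_poly_ring: "cring (poly_ring :: ('r::comm_ring_1, 'l) polynomials ring)"
  unfolding poly_ring_def type_ring_def[symmetric] by (rule cring_type_ring)

definition deg_ge :: "nat \<Rightarrow> ('r::comm_ring_1, 'l) polynomials set" where
  "deg_ge n = {p. \<forall>m\<in>Poly_Mapping.keys p. n \<le> size m}"

lemma deg_ge_zero: "0 \<in> deg_ge n"
  and deg_ge_add: "p \<in> deg_ge n \<Longrightarrow> q \<in> deg_ge n \<Longrightarrow> p + q \<in> deg_ge n"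
  and deg_ge_minus: "p \<in> deg_ge n \<Longrightarrow> - p \<in> deg_ge n"
  and deg_ge_0: "p \<in> deg_ge 0"
  using keys_add[of p q] by (auto simp: deg_ge_def)

lemma deg_ge_diff: "p \<in> deg_ge n \<Longrightarrow> q \<in> deg_ge n \<Longrightarrow> p - q \<in> deg_ge n"
  using deg_ge_add[of p n "- q"] deg_ge_minus by auto

lemma deg_ge_sum: "(\<And>x. x \<in> S \<Longrightarrow> h x \<in> deg_ge n) \<Longrightarrow> sum h S \<in> deg_ge n"
  by (induction S rule: infinite_finite_induct) (auto simp: deg_ge_zero deg_ge_add)

lemma deg_ge_mult: "p \<in> deg_ge m \<Longrightarrow> q \<in> deg_ge n \<Longrightarrow> p * q \<in> deg_ge (m + n)"
  using keys_mult[of p q] by (fastforce simp: deg_ge_def)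

lemma deg_ge_mono: "m \<le> n \<Longrightarrow> deg_ge n \<subseteq> deg_ge m"
  by (auto simp: deg_ge_def)

lemma deg_ge_mult_left: "q \<in> deg_ge n \<Longrightarrow> p * q \<in> deg_ge n"
  using deg_ge_mult[OF deg_ge_0] by force

lemma deg_ge_mult_right: "p \<in> deg_ge n \<Longrightarrow> p * q \<in> deg_ge n"
  using deg_ge_mult_left[of p n q] by (simp add: mult.commute)

lemma deg_ge_pvar: "pvar l \<in> deg_ge 1"
  by (simp add: deg_ge_def pvar_def)

lemma deg_ge_power: "p \<in> deg_ge 1 \<Longrightarrow> p ^ n \<in> deg_ge n"
proof (induction n)
  case (Suc n)
  then show ?case using deg_ge_mult[of p 1 "p ^ n" n] by simp
qed (simp add: deg_ge_0)

text \<open>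
  A monomial of degree at least \<open>n + 1\<close> is a variable times a monomial of degree at least n.
\<close>

lemma aug_power_eq: "aug_power n = (deg_ge n :: ('r::comm_ring_1, 'l) polynomials set)"
proof (induction n)
  case 0
  show ?case by (auto simp: deg_ge_def)
next
  case (Suc n)
  have aug: "(augmentation_ideal :: ('r, 'l) polynomials set) = deg_ge 1"
    by (auto simp: augmentation_ideal_def deg_ge_def in_keys_iff Suc_le_eq nonempty_has_size[symmetric])
  let ?P = "ideal_prod poly_ring (deg_ge 1) (deg_ge n) :: ('r, 'l) polynomials set"
  have "?P = deg_ge (Suc n)"
  proof
    show "?P \<subseteq> deg_ge (Suc n)"
    proof
      fix p :: "('r, 'l) polynomials" assume "p \<in> ?P"
      then show "p \<in> deg_ge (Suc n)"
        by induction (use deg_ge_mult[of _ 1 _ n] in \<open>auto simp: deg_ge_add\<close>)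
    qed
    show "deg_ge (Suc n) \<subseteq> ?P"
    proof
      fix p :: "('r, 'l) polynomials" assume p: "p \<in> deg_ge (Suc n)"
      have mono: "Poly_Mapping.single m r \<in> ?P" if "Suc n \<le> size m" for m :: "'l multiset" and r :: 'r
      proof -
        have "m \<noteq> {#}" using that by auto
        then obtain x m' where m: "m = add_mset x m'" using multi_nonempty_split by metis
        have "Poly_Mapping.single m' r \<in> deg_ge n" using that m by (auto simp: deg_ge_def)
        from ideal_prod.prod[OF deg_ge_pvar[of x] this, of poly_ring]
        have "pvar x * Poly_Mapping.single m' r \<in> ?P" by simp
        then show ?thesis by (simp add: pvar_def mult_single m)
      qed
      have zero: "0 \<in> ?P"
        using ideal_prod.prod[OF deg_ge_zero[of 1] deg_ge_zero[of n], of poly_ring] by simp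
      have "(\<Sum>m\<in>S. Poly_Mapping.single m (Poly_Mapping.lookup p m)) \<in> ?P"
        if "finite S" "S \<subseteq> Poly_Mapping.keys p" for S
        using that
      proof (induction S)
        case (insert m S)
        have "Poly_Mapping.single m (Poly_Mapping.lookup p m) \<in> ?P"
          using p insert.prems by (intro mono) (auto simp: deg_ge_def)
        then show ?case
          using ideal_prod.sum[of "Poly_Mapping.single m (Poly_Mapping.lookup p m)" poly_ring] insert by simp
      qed (use zero in simp)
      from this[OF finite_keys order_refl] show "p \<in> ?P" by (simp add: poly_monomials)
    qed
  qed
  then show ?case by (subst ideal_power.simps, subst Suc.IH, subst aug)
qed

lemma a_inv_poly_ring: "\<ominus>\<^bsub>poly_ring\<^esub> p = - p"
proof -
  interpret cring "poly_ring :: ('b, 'a) polynomials ring" by (rule cring_poly_ring)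
  show ?thesis by (rule minus_equality) simp_all
qed

lemma ideal_deg_ge: "ideal (deg_ge n) (poly_ring :: ('r::comm_ring_1, 'l) polynomials ring)"
proof (rule idealI)
  show "ring (poly_ring :: ('r, 'l) polynomials ring)" using cring_poly_ring cring.axioms(1) by blast
  interpret cring "poly_ring :: ('r, 'l) polynomials ring" by (rule cring_poly_ring)
  show "subgroup (deg_ge n) (add_monoid (poly_ring :: ('r, 'l) polynomials ring))"
  proof (rule group.subgroupI[OF a_group])
    fix a :: "('r, 'l) polynomials" assume "a \<in> deg_ge n"
    then show "inv\<^bsub>add_monoid poly_ring\<^esub> a \<in> deg_ge n"
      using a_inv_poly_ring[of a, unfolded a_inv_def] deg_ge_minus[of a n] by metis
  qed (auto simp: deg_ge_add intro: deg_ge_zero)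
qed (auto simp: deg_ge_mult_left deg_ge_mult_right)

section \<open>The completed polynomial ring\<close>

definition coset :: "nat \<Rightarrow> ('r::comm_ring_1, 'l) polynomials \<Rightarrow> ('r, 'l) polynomials set" where
  "coset n p = {q. q - p \<in> deg_ge n}"

lemma coset_eq: "aug_power n +>\<^bsub>poly_ring\<^esub> p = coset n p"
proof -
  have "\<exists>h\<in>deg_ge n. q = h + p" if "q - p \<in> deg_ge n" for q
    using that by (intro bexI[of _ "q - p"]) auto
  then show ?thesis by (auto simp: a_r_coset_def r_coset_def coset_def aug_power_eq)
qed

lemma coset_self: "p \<in> coset n p" by (simp add: coset_def deg_ge_zero)

lemma coset_eq_iff: "coset n p = coset n q \<longleftrightarrow> p - q \<in> deg_ge n"
proof
  assume "coset n p = coset n q"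
  then show "p - q \<in> deg_ge n" using coset_self[of p n] by (simp add: coset_def)
next
  assume a: "p - q \<in> deg_ge n"
  have "r - q \<in> deg_ge n \<longleftrightarrow> r - p \<in> deg_ge n" for r
    using deg_ge_diff[OF _ a, of "r - q"] deg_ge_add[OF _ a, of "r - p"] by auto
  then show "coset n p = coset n q" by (auto simp: coset_def)
qed

lemma coset_Suc_subset: "coset (Suc n) p \<subseteq> coset n q \<longleftrightarrow> p - q \<in> deg_ge n"
proof
  assume "coset (Suc n) p \<subseteq> coset n q"
  then have "p \<in> coset n q" using coset_self by blast
  then show "p - q \<in> deg_ge n" by (simp add: coset_def)
next
  assume "p - q \<in> deg_ge n"
  then have "coset n p = coset n q" by (simp add: coset_eq_iff)
  moreover have "coset (Suc n) p \<subseteq> coset n p"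
    using deg_ge_mono[of n "Suc n"] by (auto simp: coset_def)
  ultimately show "coset (Suc n) p \<subseteq> coset n q" by simp
qed

text \<open>
  Elements of the completion are handled through representatives: a sequence of polynomials whose
  n-th member matters modulo terms of degree n and more.
\<close>

definition ser :: "(nat \<Rightarrow> ('r::comm_ring_1, 'l) polynomials) \<Rightarrow> ('r, 'l) series" where
  "ser p = (\<lambda>n. coset n (p n))"

definition coherent :: "(nat \<Rightarrow> ('r::comm_ring_1, 'l) polynomials) \<Rightarrow> bool" where
  "coherent p \<longleftrightarrow> (\<forall>n. p (Suc n) - p n \<in> deg_ge n)"

lemma Quot_poly_simps:
  fixes p q :: "('r::comm_ring_1, 'l) polynomials"
  shows
  "carrier (poly_ring Quot deg_ge n) = range (coset n :: _ \<Rightarrow> ('r, 'l) polynomials set)"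
  "coset n p \<otimes>\<^bsub>poly_ring Quot deg_ge n\<^esub> coset n q = coset n (p * q)"
  "coset n p \<oplus>\<^bsub>poly_ring Quot deg_ge n\<^esub> coset n q = coset n (p + q)"
  "\<one>\<^bsub>poly_ring Quot deg_ge n\<^esub> = coset n (1 :: ('r, 'l) polynomials)"
  "\<zero>\<^bsub>poly_ring Quot deg_ge n\<^esub> = coset n (0 :: ('r, 'l) polynomials)"
proof -
  interpret ideal "deg_ge n" "poly_ring :: ('r, 'l) polynomials ring" by (rule ideal_deg_ge)
  note c = coset_eq[unfolded aug_power_eq]
  show "carrier (poly_ring Quot deg_ge n) = range (coset n :: _ \<Rightarrow> ('r, 'l) polynomials set)"
    by (auto simp: FactRing_def A_RCOSETS_def' c)
  show "coset n p \<otimes>\<^bsub>poly_ring Quot deg_ge n\<^esub> coset n q = coset n (p * q)"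
    using rcoset_mult_add[of p q] by (simp add: FactRing_def c)
  show "coset n p \<oplus>\<^bsub>poly_ring Quot deg_ge n\<^esub> coset n q = coset n (p + q)"
    using a_rcos_sum[of p q] by (simp add: FactRing_def c)
  show "\<one>\<^bsub>poly_ring Quot deg_ge n\<^esub> = coset n (1 :: ('r, 'l) polynomials)" by (simp add: FactRing_def c)
  show "\<zero>\<^bsub>poly_ring Quot deg_ge n\<^esub> = coset n (0 :: ('r, 'l) polynomials)" by (simp add: FactRing_def coset_def)
qed

lemma carrier_series:
  "carrier (series_ring :: ('r::comm_ring_1, 'l) series ring) = {ser p |p. coherent p}"
proof -
  have carrier: "s \<in> carrier series_ring \<longleftrightarrow> (\<forall>n. s n \<in> range (coset n) \<and> s (Suc n) \<subseteq> s n)"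
    for s :: "('r, 'l) series"
    unfolding series_ring_def completion_def aug_power_eq partial_object.simps Quot_poly_simps
    by (rule mem_Collect_eq)
  show ?thesis
  proof (intro equalityI subsetI)
    fix s :: "('r, 'l) series" assume "s \<in> carrier series_ring"
    then have s: "\<And>n. s n \<in> range (coset n)" "\<And>n. s (Suc n) \<subseteq> s n" unfolding carrier by auto
    have "\<exists>q. s n = coset n q" for n using s(1)[of n] by auto
    then obtain p where p: "\<And>n. s n = coset n (p n)" by metis
    then have "s = ser p" "coherent p" using s(2) by (auto simp: ser_def coherent_def coset_Suc_subset)
    then show "s \<in> {ser p |p. coherent p}" by blast
  next
    fix s :: "('r, 'l) series" assume "s \<in> {ser p |p. coherent p}"
    then obtain p where p: "s = ser p" "coherent p" by blast
    show "s \<in> carrier series_ring" unfolding carrier p(1)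
      using p(2) by (simp add: ser_def coherent_def coset_Suc_subset)
  qed
qed

lemma series_simps:
  "ser p \<otimes>\<^bsub>series_ring\<^esub> ser q = ser (\<lambda>n. p n * q n)"
  "ser p \<oplus>\<^bsub>series_ring\<^esub> ser q = ser (\<lambda>n. p n + q n)"
  "\<one>\<^bsub>series_ring\<^esub> = ser (\<lambda>n. 1)"
  "\<zero>\<^bsub>series_ring\<^esub> = ser (\<lambda>n. 0)"
  by (simp_all add: series_ring_def completion_def aug_power_eq Quot_poly_simps ser_def)

lemma coherent_add: "coherent p \<Longrightarrow> coherent q \<Longrightarrow> coherent (\<lambda>n. p n + q n)"
  using deg_ge_add by (fastforce simp: coherent_def add_diff_add)

lemma coherent_minus: "coherent p \<Longrightarrow> coherent (\<lambda>n. - p n)"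
  using deg_ge_minus by (fastforce simp: coherent_def)

lemma coherent_mult: assumes "coherent p" "coherent q" shows "coherent (\<lambda>n. p n * q n)"
  unfolding coherent_def
proof
  fix n
  have "p (Suc n) * q (Suc n) - p n * q n = (p (Suc n) - p n) * q (Suc n) + p n * (q (Suc n) - q n)"
    by (simp add: algebra_simps)
  then show "p (Suc n) * q (Suc n) - p n * q n \<in> deg_ge n"
    using assms by (simp add: coherent_def deg_ge_add deg_ge_mult_left deg_ge_mult_right)
qed

lemma coherent_const: "coherent (\<lambda>n. p)" by (simp add: coherent_def deg_ge_zero)

lemma ser_in: "coherent p \<Longrightarrow> ser p \<in> carrier series_ring"
  by (auto simp: carrier_series)

lemma series_cases:
  assumes "x \<in> carrier series_ring" obtains p where "x = ser p" "coherent p"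
  using assms by (auto simp: carrier_series)

lemma cring_series_ring: "cring (series_ring :: ('r::comm_ring_1, 'l) series ring)"
proof (rule cringI)
  show "abelian_group (series_ring :: ('r, 'l) series ring)"
  proof (rule abelian_groupI)
    fix x :: "('r, 'l) series" assume "x \<in> carrier series_ring"
    then obtain p where "x = ser p" "coherent p" by (rule series_cases)
    then show "\<exists>y\<in>carrier series_ring. y \<oplus>\<^bsub>series_ring\<^esub> x = \<zero>\<^bsub>series_ring\<^esub>"
      by (intro bexI[of _ "ser (\<lambda>n. - p n)"]) (auto simp: ser_in series_simps coherent_minus)
  qed (auto elim!: series_cases simp: ser_in series_simps coherent_add coherent_const add_ac)
  show "comm_monoid (series_ring :: ('r, 'l) series ring)"
    by (rule comm_monoidI)
       (auto elim!: series_cases simp: ser_in series_simps coherent_mult coherent_const mult_ac)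
qed (auto elim!: series_cases simp: series_simps distrib_right)

lemma series_minus:
  fixes p :: "nat \<Rightarrow> ('r::comm_ring_1, 'l) polynomials"
  assumes "coherent p" shows "\<ominus>\<^bsub>series_ring\<^esub> ser p = ser (\<lambda>n. - p n)"
proof -
  interpret cring "series_ring :: ('r, 'l) series ring" by (rule cring_series_ring)
  show ?thesis
    by (rule minus_equality) (simp_all add: ser_in series_simps assms coherent_minus)
qed

lemma coherent_mono: assumes "coherent p" "m \<le> n" shows "p n - p m \<in> deg_ge m"
  using assms(2)
proof (induction n rule: dec_induct)
  case (step n)
  have "p (Suc n) - p n \<in> deg_ge m" using assms(1) deg_ge_mono[of m n] step by (auto simp: coherent_def)
  then show ?case using deg_ge_add[OF _ step.IH, of "p (Suc n) - p n"] by simp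
qed (simp add: deg_ge_zero)

lemma svar_ser: "svar l = ser (\<lambda>n. pvar l)"
  by (simp add: svar_def ser_def coset_eq)

definition fpart :: "('r \<Rightarrow> 'a::comm_ring_1) \<Rightarrow> 'r::comm_ring_1 fps fps \<Rightarrow> nat \<Rightarrow> 'a \<Rightarrow> 'a \<Rightarrow> 'a" where
  "fpart c F n x y = (\<Sum>a<n. \<Sum>b<n. c (fps_nth (fps_nth F a) b) * x ^ a * y ^ b)"

lemma fgl_sum_ser: "fgl_sum F l m = ser (\<lambda>n. fpart pconst F n (pvar l) (pvar m))"
  by (simp add: fgl_sum_def ser_def coset_eq fpart_def)

lemma coherent_fpart:
  assumes "x \<in> deg_ge 1" "y \<in> deg_ge 1" shows "coherent (\<lambda>n. fpart pconst F n x y)"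
  unfolding coherent_def
proof
  fix n
  let ?t = "\<lambda>a b. pconst (fps_nth (fps_nth F a) b) * x ^ a * y ^ b"
  have t: "?t a b \<in> deg_ge n" if "a \<ge> n \<or> b \<ge> n" for a b
  proof -
    have "?t a b \<in> deg_ge (a + b)"
      using deg_ge_mult[OF deg_ge_mult_left[OF deg_ge_power[OF assms(1)]] deg_ge_power[OF assms(2)]] .
    then show ?thesis using deg_ge_mono[of n "a + b"] that by auto
  qed
  have "fpart pconst F (Suc n) x y - fpart pconst F n x y = (\<Sum>a<n. ?t a n) + (\<Sum>b<Suc n. ?t n b)"
    by (simp add: fpart_def sum.distrib)
  then show "fpart pconst F (Suc n) x y - fpart pconst F n x y \<in> deg_ge n"
    by (simp only:) (intro deg_ge_add deg_ge_sum t, auto)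
qed

section \<open>Evaluation of power series\<close>

text \<open>
  If monomials of degree n are sent to multiples of \<open>t\<^sup>n\<close>, the evaluation of polynomials extends to the
  completion: the coefficient of \<open>t\<^sup>n\<close> can be read off from any representative modulo degree
  \<open>n + 1\<close>.
\<close>

locale series_evaluation = evaluation c e
  for c :: "'r::comm_ring_1 \<Rightarrow> 'a::comm_ring_1 fps" and e :: "'l multiset \<Rightarrow> 'a fps" +
  assumes e_order: "k < size m \<Longrightarrow> fps_nth (e m) k = 0"
begin

abbreviation ev where "ev \<equiv> eval_poly c e"

lemma ev_deg_ge: assumes "p \<in> deg_ge n" "k < n" shows "fps_nth (ev p) k = 0"
proof -
  have "fps_nth (c (Poly_Mapping.lookup p m) * e m) k = 0" if "m \<in> Poly_Mapping.keys p" for m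
    unfolding fps_mult_nth
  proof (intro sum.neutral ballI)
    fix x
    have "k - x < size m" using assms that by (auto simp: deg_ge_def intro: order.strict_trans2)
    then show "fps_nth (c (Poly_Mapping.lookup p m)) x * fps_nth (e m) (k - x) = 0" by (simp add: e_order)
  qed
  then show ?thesis by (simp add: eval_poly_def fps_sum_nth)
qed

definition seval :: "('r, 'l) series \<Rightarrow> 'a fps" where
  "seval s = Abs_fps (\<lambda>n. fps_nth (ev (SOME p. p \<in> s (Suc n))) n)"

lemma seval_nth: assumes "coherent p" "n < m" shows "fps_nth (seval (ser p)) n = fps_nth (ev (p m)) n"
proof -
  define q where "q = (SOME q. q \<in> ser p (Suc n))"
  have "q \<in> ser p (Suc n)" unfolding q_def by (rule someI[of _ "p (Suc n)"]) (simp add: ser_def coset_self)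
  then have "q - p (Suc n) \<in> deg_ge (Suc n)" by (simp add: ser_def coset_def)
  moreover have "p m - p (Suc n) \<in> deg_ge (Suc n)" using coherent_mono[OF assms(1), of "Suc n" m] assms(2) by simp
  ultimately have "q - p m \<in> deg_ge (Suc n)" using deg_ge_diff by fastforce
  then have "fps_nth (ev q) n = fps_nth (ev (p m)) n" using ev_deg_ge[of "q - p m" "Suc n" n] by (simp add: eval_poly_diff)
  then show ?thesis by (simp add: seval_def q_def)
qed

lemma seval_add: assumes "coherent p" "coherent q"
  shows "seval (ser (\<lambda>n. p n + q n)) = seval (ser p) + seval (ser q)"
  by (rule fps_ext) (simp add: seval_nth[OF assms(1) lessI] seval_nth[OF assms(2) lessI]
      seval_nth[OF coherent_add[OF assms] lessI] eval_poly_add)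

lemma seval_mult: assumes "coherent p" "coherent q"
  shows "seval (ser (\<lambda>n. p n * q n)) = seval (ser p) * seval (ser q)"
proof (rule fps_ext)
  fix n
  have "fps_nth (seval (ser p) * seval (ser q)) n = fps_nth (ev (p (Suc n)) * ev (q (Suc n))) n"
    unfolding fps_mult_nth
    by (intro sum.cong refl arg_cong2[of _ _ _ _ "(*)"] seval_nth assms) auto
  then show "fps_nth (seval (ser (\<lambda>n. p n * q n))) n = fps_nth (seval (ser p) * seval (ser q)) n"
    by (simp add: seval_nth[OF coherent_mult[OF assms] lessI] eval_poly_mult)
qed

lemma seval_one: "seval (ser (\<lambda>n. 1)) = 1"
  by (rule fps_ext) (simp add: seval_nth[OF coherent_const lessI] eval_poly_one)

lemma seval_const: "seval (ser (\<lambda>n. p)) = ev p"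
  by (rule fps_ext) (simp add: seval_nth[OF coherent_const lessI])

end

unbundle fps_syntax

section \<open>Formal group laws on power series\<close>

text \<open>
  Congruence modulo \<open>t\<^sup>N\<close>. Identities between infinite sums are proved modulo every
  \<open>t\<^sup>N\<close>, where all sums are finite.
\<close>

definition agree :: "nat \<Rightarrow> 'a::comm_ring_1 fps \<Rightarrow> 'a fps \<Rightarrow> bool" where
  "agree N f g \<longleftrightarrow> (\<forall>k<N. f $ k = g $ k)"

lemma agree_refl [simp]: "agree N f f" by (simp add: agree_def)
lemma agree_sym: "agree N f g \<Longrightarrow> agree N g f" by (simp add: agree_def)
lemma agree_trans [trans]: "agree N f g \<Longrightarrow> agree N g h \<Longrightarrow> agree N f h" by (simp add: agree_def)
lemma agree_add: "agree N f g \<Longrightarrow> agree N f' g' \<Longrightarrow> agree N (f + f') (g + g')" by (simp add: agree_def)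
lemma agree_diff: "agree N f g \<Longrightarrow> agree N f' g' \<Longrightarrow> agree N (f - f') (g - g')" by (simp add: agree_def)
lemma agree_mult: "agree N f g \<Longrightarrow> agree N f' g' \<Longrightarrow> agree N (f * f') (g * g')"
  by (auto simp: agree_def fps_mult_nth intro!: sum.cong)
lemma agree_sum: "(\<And>x. x \<in> S \<Longrightarrow> agree N (h x) (h' x)) \<Longrightarrow> agree N (sum h S) (sum h' S)"
  by (induction S rule: infinite_finite_induct) (auto intro: agree_add)
lemma agree_power: "agree N f g \<Longrightarrow> agree N (f ^ n) (g ^ n)"
  by (induction n) (auto intro: agree_mult)
lemma agree_mono: "agree N f g \<Longrightarrow> M \<le> N \<Longrightarrow> agree M f g" by (simp add: agree_def)
lemma agree_imp_eq: "(\<And>N. agree N f g) \<Longrightarrow> f = g" by (auto simp: agree_def fps_eq_iff)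

lemma agree_raise:
  assumes x: "x $ 0 = 0" and fg: "agree N f g" shows "agree (Suc N) (x * f) (x * g)"
  unfolding agree_def
proof (intro allI impI)
  fix k assume k: "k < Suc N"
  have "x $ i * f $ (k - i) = x $ i * g $ (k - i)" if ik: "i \<le> k" for i
  proof (cases "i = 0")
    case True
    then show ?thesis by (simp add: x)
  next
    case False
    show ?thesis
    proof (cases "k - i < N")
      case True
      then show ?thesis using fg by (simp add: agree_def)
    next
      case f: False
      then show ?thesis using False k ik by linarith
    qed
  qed
  then show "(x * f) $ k = (x * g) $ k" unfolding fps_mult_nth by (intro sum.cong refl) auto
qed

lemma power_order: "f $ 0 = 0 \<Longrightarrow> k < a \<Longrightarrow> (f ^ a) $ k = (0::'a::comm_ring_1)"
proof (induction a arbitrary: k)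
  case (Suc a)
  then have "agree a (f ^ a) 0" by (simp add: agree_def)
  from agree_raise[OF Suc.prems(1) this] show ?case using Suc.prems by (simp add: agree_def)
qed simp

lemma agree_power_zero: "f $ 0 = 0 \<Longrightarrow> N \<le> a \<Longrightarrow> agree N (f ^ a * y) (0::'a::comm_ring_1 fps)"
  using agree_mult[of N "f ^ a" 0 y y] by (simp add: agree_def power_order)

text \<open>Substitution of a series without constant term into a series with power series coefficients.\<close>

definition subst1 :: "'a::comm_ring_1 fps fps \<Rightarrow> 'a fps \<Rightarrow> 'a fps" where
  "subst1 x f = Abs_fps (\<lambda>n. (\<Sum>a\<le>n. x $ a * f ^ a) $ n)"

lemma subst1_trunc:
  assumes f: "f $ 0 = 0" and "N \<le> M" shows "agree N (subst1 x f) (\<Sum>a<M. x $ a * f ^ a)"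
  unfolding agree_def
proof (intro allI impI)
  fix k assume "k < N"
  have "(\<Sum>a<M. (x $ a * f ^ a) $ k) = (\<Sum>a\<le>k. (x $ a * f ^ a) $ k)"
  proof (rule sum.mono_neutral_right)
    show "\<forall>a\<in>{..<M} - {..k}. (x $ a * f ^ a) $ k = 0"
    proof
      fix a assume "a \<in> {..<M} - {..k}"
      then have "agree (Suc k) (f ^ a * x $ a) 0" using agree_power_zero[OF f] by auto
      then show "(x $ a * f ^ a) $ k = 0" by (simp add: agree_def mult.commute)
    qed
  qed (use \<open>k < N\<close> \<open>N \<le> M\<close> in auto)
  then show "subst1 x f $ k = (\<Sum>a<M. x $ a * f ^ a) $ k" by (simp add: subst1_def fps_sum_nth)
qed

lemma subst1_add: "subst1 (x + y) f = subst1 x f + subst1 y f"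
  by (simp add: subst1_def fps_eq_iff fps_sum_nth distrib_right sum.distrib)

lemma subst1_one: "subst1 1 f = 1"
proof (rule fps_ext)
  fix n
  have "(\<Sum>a\<le>n. (1 :: 'a fps fps) $ a * f ^ a) = (\<Sum>a\<le>n. if a = 0 then 1 else 0)"
    by (intro sum.cong refl) auto
  then show "subst1 1 f $ n = 1 $ n" by (simp add: subst1_def)
qed

text \<open>
  Modulo \<open>t\<^sup>N\<close> both sides are finite sums; the product has additional terms, but they are
  divisible by \<open>f\<^sup>N\<close>.
\<close>

lemma subst1_mult: assumes f: "f $ 0 = 0" shows "subst1 (x * y) f = subst1 x f * subst1 y f"
proof (rule agree_imp_eq)
  fix N
  let ?h = "\<lambda>a b. f ^ (a + b) * (x $ a * y $ b)"
  have "agree N (subst1 x f * subst1 y f) ((\<Sum>a<N. x $ a * f ^ a) * (\<Sum>b<N. y $ b * f ^ b))"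
    by (intro agree_mult subst1_trunc f order_refl)
  also have "(\<Sum>a<N. x $ a * f ^ a) * (\<Sum>b<N. y $ b * f ^ b) = (\<Sum>(a, b)\<in>{..<N} \<times> {..<N}. ?h a b)"
    by (simp add: sum_product sum.cartesian_product power_add algebra_simps)
  also have "\<dots> = (\<Sum>(a, b)\<in>{(a, b). a + b < N}. ?h a b) +
      (\<Sum>(a, b)\<in>{..<N} \<times> {..<N} - {(a, b). a + b < N}. ?h a b)"
    by (subst add.commute, rule sum.subset_diff) auto
  also have "agree N \<dots> ((\<Sum>(a, b)\<in>{(a, b). a + b < N}. ?h a b) +
      (\<Sum>(a, b)\<in>{..<N} \<times> {..<N} - {(a, b). a + b < N}. 0))"
    by (intro agree_add agree_sum agree_refl) (auto intro!: agree_power_zero f)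
  also have "\<dots> = (\<Sum>k<N. \<Sum>a\<le>k. ?h a (k - a))" by (simp add: sum.triangle_reindex)
  also have "\<dots> = (\<Sum>k<N. (x * y) $ k * f ^ k)"
    by (intro sum.cong refl) (simp add: fps_mult_nth sum_distrib_left atLeast0AtMost mult_ac)
  also have "agree N \<dots> (subst1 (x * y) f)" by (intro agree_sym[OF subst1_trunc] f order_refl)
  finally show "agree N (subst1 (x * y) f) (subst1 x f * subst1 y f)" by (rule agree_sym)
qed

definition map_coeffs :: "('a::zero \<Rightarrow> 'b::zero) \<Rightarrow> 'a fps \<Rightarrow> 'b fps" where
  "map_coeffs \<psi> h = Abs_fps (\<lambda>n. \<psi> (h $ n))"

lemma map_coeffs_nth: "map_coeffs \<psi> h $ n = \<psi> (h $ n)" by (simp add: map_coeffs_def)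

locale ring_map =
  fixes \<psi> :: "'a::comm_ring_1 \<Rightarrow> 'b::comm_ring_1"
  assumes add: "\<psi> (x + y) = \<psi> x + \<psi> y" and mult: "\<psi> (x * y) = \<psi> x * \<psi> y" and one: "\<psi> 1 = 1"
begin

lemma zero: "\<psi> 0 = 0" using add[of 0 0] by simp

lemma sum: "\<psi> (sum h S) = (\<Sum>x\<in>S. \<psi> (h x))"
  by (induction S rule: infinite_finite_induct) (simp_all add: zero add)

lemma power: "\<psi> (x ^ n) = \<psi> x ^ n"
  by (induction n) (simp_all add: one mult)

lemma map_coeffs: "ring_map (map_coeffs \<psi>)"
  by unfold_locales
    (auto simp: map_coeffs_def fps_eq_iff add fps_mult_nth sum mult zero one)

end

lemma ring_map_const: "ring_map (fps_const :: 'a::comm_ring_1 \<Rightarrow> 'a fps)"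
  by unfold_locales auto

lemma ring_map_comp: "ring_map \<psi> \<Longrightarrow> ring_map \<phi> \<Longrightarrow> ring_map (\<lambda>x. \<psi> (\<phi> x))"
  by (simp add: ring_map_def)

lemma ring_map_subst1: "f $ 0 = 0 \<Longrightarrow> ring_map (\<lambda>x. subst1 x f)"
  by unfold_locales (simp_all add: subst1_add subst1_mult subst1_one)

locale fgl_evaluation = ring_map c for c :: "'r::comm_ring_1 \<Rightarrow> 'a::comm_ring_1" +
  fixes F :: "'r fps fps"
  assumes fgl: "formal_group_law F"
begin

text \<open>
  The value \<open>H(f, g)\<close> of a series in two variables, obtained by substituting first g and then f. Two
  substitutions in one variable make \<open>H \<mapsto> H(f, g)\<close> a ring homomorphism at no extra cost.
\<close>

definition subst2 :: "'r fps fps \<Rightarrow> 'a fps \<Rightarrow> 'a fps \<Rightarrow> 'a fps" where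
  "subst2 H f g = subst1 (map_coeffs (\<lambda>h. subst1 (map_coeffs (\<lambda>r. fps_const (c r)) h) g) H) f"

lemma ring_map_subst2: assumes "f $ 0 = 0" "g $ 0 = 0" shows "ring_map (\<lambda>H. subst2 H f g)"
  unfolding subst2_def
  by (intro ring_map_comp[OF ring_map_subst1] ring_map.map_coeffs ring_map_comp[OF ring_map_const] assms ring_map_axioms)

lemma subst2_trunc:
  assumes f: "f $ 0 = 0" and g: "g $ 0 = 0" and "N \<le> M" "N \<le> M'"
  shows "agree N (subst2 H f g) (\<Sum>a<M. \<Sum>b<M'. fps_const (c (H $ a $ b)) * f ^ a * g ^ b)"
proof -
  have "agree N (subst2 H f g) (\<Sum>a<M. subst1 (map_coeffs (\<lambda>r. fps_const (c r)) (H $ a)) g * f ^ a)"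
    using subst1_trunc[OF f \<open>N \<le> M\<close>, of "map_coeffs (\<lambda>h. subst1 (map_coeffs (\<lambda>r. fps_const (c r)) h) g) H"]
    unfolding subst2_def map_coeffs_nth .
  also have "agree N \<dots> (\<Sum>a<M. (\<Sum>b<M'. fps_const (c (H $ a $ b)) * g ^ b) * f ^ a)"
    using subst1_trunc[OF g \<open>N \<le> M'\<close>, of "map_coeffs (\<lambda>r. fps_const (c r)) (H $ _)"] unfolding map_coeffs_nth
    by (intro agree_sum agree_mult agree_refl)
  also have "\<dots> = (\<Sum>a<M. \<Sum>b<M'. fps_const (c (H $ a $ b)) * f ^ a * g ^ b)"
    by (simp add: sum_distrib_left mult_ac)
  finally show ?thesis .
qed

lemma F_0: "F $ a $ 0 = (if a = 1 then 1 else 0)" "F $ 0 $ b = (if b = 1 then 1 else 0)"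
  and F_sym: "F $ a $ b = F $ b $ a"
  and F_assoc: "(\<Sum>k\<le>b + d. F $ a $ k * (F ^ k) $ b $ d) = (\<Sum>k\<le>a + b. F $ k $ d * (F ^ k) $ a $ b)"
  using fgl unfolding formal_group_law_def by blast+

lemma F_power_order: "a + b < k \<Longrightarrow> (F ^ k) $ a $ b = 0"
proof (induction k arbitrary: a b)
  case (Suc k)
  have "(F ^ Suc k) $ a $ b = (\<Sum>i\<le>a. \<Sum>j\<le>b. F $ i $ j * (F ^ k) $ (a - i) $ (b - j))"
    by (simp add: fps_mult_nth fps_sum_nth atLeast0AtMost)
  also have "\<dots> = 0"
  proof (intro sum.neutral ballI)
    fix i j assume "i \<in> {..a}" "j \<in> {..b}"
    then show "F $ i $ j * (F ^ k) $ (a - i) $ (b - j) = 0"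
      using Suc F_0[of 0] by (cases "i = 0 \<and> j = 0") auto
  qed
  finally show ?case .
qed simp

abbreviation fplus where "fplus f g \<equiv> subst2 F f g"

lemma fplus_0: assumes "f $ 0 = 0" "g $ 0 = 0" shows "fplus f g $ 0 = 0"
  using subst2_trunc[OF assms, of 1 1 1 F] F_0[of 0] by (simp add: agree_def zero)

lemma fplus_zero: assumes f: "f $ 0 = 0" shows "fplus f 0 = f"
proof (rule agree_imp_eq)
  fix N
  have "agree N (fplus f 0) (\<Sum>a<Suc (Suc N). \<Sum>b<Suc N. fps_const (c (F $ a $ b)) * f ^ a * 0 ^ b)"
    by (rule subst2_trunc) (auto simp: f)
  also have "\<dots> = (\<Sum>a<Suc (Suc N). fps_const (c (F $ a $ 0)) * f ^ a)"
    by (intro sum.cong refl, subst sum.lessThan_Suc_shift) simp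
  also have "\<dots> = (\<Sum>a<Suc (Suc N). if a = 1 then f else 0)"
    by (intro sum.cong refl) (auto simp: F_0 zero one)
  also have "\<dots> = f" by simp
  finally show "agree N (fplus f 0) f" .
qed

lemma fplus_commute: assumes f: "f $ 0 = 0" and g: "g $ 0 = 0" shows "fplus f g = fplus g f"
proof (rule agree_imp_eq)
  fix N
  have "agree N (fplus f g) (\<Sum>a<N. \<Sum>b<N. fps_const (c (F $ a $ b)) * f ^ a * g ^ b)"
    by (rule subst2_trunc) (auto simp: f g)
  also have "\<dots> = (\<Sum>b<N. \<Sum>a<N. fps_const (c (F $ b $ a)) * g ^ b * f ^ a)"
    by (subst sum.swap) (simp add: F_sym mult_ac)
  also have "agree N \<dots> (fplus g f)" by (rule agree_sym, rule subst2_trunc) (auto simp: f g)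
  finally show "agree N (fplus f g) (fplus g f)" .
qed

text \<open>
  The powers \<open>F(g, h)\<^sup>k\<close> are the values of the series \<open>F\<^sup>k\<close>, so that after collecting
  the coefficients of \<open>f\<^sup>a g\<^sup>b h\<^sup>d\<close> the claim is the associativity axiom, coefficient by coefficient. The range
  of k up to \<open>2N\<close> contains all indices up to \<open>b + d\<close>.
\<close>

lemma fplus_assoc:
  assumes f: "f $ 0 = 0" and g: "g $ 0 = 0" and h: "h $ 0 = 0"
  shows "fplus (fplus f g) h = fplus f (fplus g h)"
proof (rule agree_imp_eq)
  fix N
  define mono where "mono a b d = f ^ a * g ^ b * h ^ d" for a b d
  interpret gh: ring_map "\<lambda>H. subst2 H g h" by (rule ring_map_subst2[OF g h])
  interpret fg: ring_map "\<lambda>H. subst2 H f g" by (rule ring_map_subst2[OF f g])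
  interpret k: ring_map "\<lambda>r. fps_const (c r)" by (rule ring_map_comp[OF ring_map_const ring_map_axioms])
  have "agree N (fplus f (fplus g h)) (\<Sum>a<N. \<Sum>k<2*N. fps_const (c (F $ a $ k)) * f ^ a * (fplus g h) ^ k)"
    by (rule subst2_trunc) (auto simp: f fplus_0[OF g h])
  also have "agree N \<dots> (\<Sum>a<N. \<Sum>k<2*N. fps_const (c (F $ a $ k)) * f ^ a *
      (\<Sum>b<N. \<Sum>d<N. fps_const (c ((F ^ k) $ b $ d)) * g ^ b * h ^ d))"
    unfolding gh.power[symmetric] by (intro agree_sum agree_mult agree_refl subst2_trunc g h order_refl)
  also have "\<dots> = (\<Sum>a<N. \<Sum>k<2*N. \<Sum>b<N. \<Sum>d<N. fps_const (c (F $ a $ k * (F ^ k) $ b $ d)) * mono a b d)"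
    by (simp add: sum_distrib_left mono_def mult k.mult mult_ac)
  also have "\<dots> = (\<Sum>a<N. \<Sum>b<N. \<Sum>d<N. \<Sum>k<2*N. fps_const (c (F $ a $ k * (F ^ k) $ b $ d)) * mono a b d)"
  proof (intro sum.cong[OF refl])
    fix a
    let ?t = "\<lambda>k b d. fps_const (c (F $ a $ k * (F ^ k) $ b $ d)) * mono a b d"
    have "(\<Sum>k<2*N. \<Sum>b<N. \<Sum>d<N. ?t k b d) = (\<Sum>b<N. \<Sum>k<2*N. \<Sum>d<N. ?t k b d)" by (rule sum.swap)
    also have "\<dots> = (\<Sum>b<N. \<Sum>d<N. \<Sum>k<2*N. ?t k b d)" by (intro sum.cong refl sum.swap)
    finally show "(\<Sum>k<2*N. \<Sum>b<N. \<Sum>d<N. ?t k b d) = (\<Sum>b<N. \<Sum>d<N. \<Sum>k<2*N. ?t k b d)" .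
  qed
  also have "\<dots> = (\<Sum>a<N. \<Sum>b<N. \<Sum>d<N. fps_const (c (\<Sum>k\<le>b + d. F $ a $ k * (F ^ k) $ b $ d)) * mono a b d)"
  proof (intro sum.cong refl)
    fix a b d assume bd: "b \<in> {..<N}" "d \<in> {..<N}"
    have "(\<Sum>k<2*N. F $ a $ k * (F ^ k) $ b $ d) = (\<Sum>k\<le>b + d. F $ a $ k * (F ^ k) $ b $ d)"
      by (rule sum.mono_neutral_right) (use bd F_power_order in auto)
    then show "(\<Sum>k<2*N. fps_const (c (F $ a $ k * (F ^ k) $ b $ d)) * mono a b d) =
        fps_const (c (\<Sum>k\<le>b + d. F $ a $ k * (F ^ k) $ b $ d)) * mono a b d"
      by (simp only: sum_distrib_right[symmetric] k.sum[symmetric])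
  qed
  also have "\<dots> = (\<Sum>a<N. \<Sum>b<N. \<Sum>d<N. fps_const (c (\<Sum>k\<le>a + b. F $ k $ d * (F ^ k) $ a $ b)) * mono a b d)"
    by (simp only: F_assoc)
  also have "\<dots> = (\<Sum>a<N. \<Sum>b<N. \<Sum>d<N. \<Sum>k<2*N. fps_const (c (F $ k $ d * (F ^ k) $ a $ b)) * mono a b d)"
  proof (intro sum.cong refl)
    fix a b d assume bd: "a \<in> {..<N}" "b \<in> {..<N}"
    have "(\<Sum>k<2*N. F $ k $ d * (F ^ k) $ a $ b) = (\<Sum>k\<le>a + b. F $ k $ d * (F ^ k) $ a $ b)"
      by (rule sum.mono_neutral_right) (use bd F_power_order in auto)
    then show "fps_const (c (\<Sum>k\<le>a + b. F $ k $ d * (F ^ k) $ a $ b)) * mono a b d =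
        (\<Sum>k<2*N. fps_const (c (F $ k $ d * (F ^ k) $ a $ b)) * mono a b d)"
      by (simp only: sum_distrib_right[symmetric] k.sum[symmetric])
  qed
  also have "\<dots> = (\<Sum>k<2*N. \<Sum>d<N. \<Sum>a<N. \<Sum>b<N. fps_const (c (F $ k $ d * (F ^ k) $ a $ b)) * mono a b d)"
  proof -
    let ?t = "\<lambda>k d a b. fps_const (c (F $ k $ d * (F ^ k) $ a $ b)) * mono a b d"
    have "(\<Sum>a<N. \<Sum>b<N. \<Sum>d<N. \<Sum>k<2*N. ?t k d a b) = (\<Sum>a<N. \<Sum>b<N. \<Sum>k<2*N. \<Sum>d<N. ?t k d a b)"
      by (intro sum.cong refl sum.swap)
    also have "\<dots> = (\<Sum>a<N. \<Sum>k<2*N. \<Sum>b<N. \<Sum>d<N. ?t k d a b)" by (intro sum.cong refl sum.swap)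
    also have "\<dots> = (\<Sum>k<2*N. \<Sum>a<N. \<Sum>b<N. \<Sum>d<N. ?t k d a b)" by (rule sum.swap)
    also have "\<dots> = (\<Sum>k<2*N. \<Sum>a<N. \<Sum>d<N. \<Sum>b<N. ?t k d a b)" by (intro sum.cong refl sum.swap)
    also have "\<dots> = (\<Sum>k<2*N. \<Sum>d<N. \<Sum>a<N. \<Sum>b<N. ?t k d a b)" by (intro sum.cong refl sum.swap)
    finally show ?thesis .
  qed
  also have "\<dots> = (\<Sum>k<2*N. \<Sum>d<N. fps_const (c (F $ k $ d)) *
      (\<Sum>a<N. \<Sum>b<N. fps_const (c ((F ^ k) $ a $ b)) * f ^ a * g ^ b) * h ^ d)"
    by (simp add: sum_distrib_left sum_distrib_right mono_def mult k.mult mult_ac)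
  also have "agree N \<dots> (\<Sum>k<2*N. \<Sum>d<N. fps_const (c (F $ k $ d)) * (fplus f g) ^ k * h ^ d)"
    unfolding fg.power[symmetric] by (intro agree_sum agree_mult agree_refl agree_sym[OF subst2_trunc] f g order_refl)
  also have "agree N \<dots> (fplus (fplus f g) h)"
    by (rule agree_sym, rule subst2_trunc) (auto simp: h fplus_0[OF f g])
  finally show "agree N (fplus (fplus f g) h) (fplus f (fplus g h))" by (rule agree_sym)
qed

text \<open>
  All terms of \<open>F(f, h)\<close> other than h itself contain the factor f, which gains one order in t.
\<close>

lemma fplus_contract:
  assumes f: "f $ 0 = 0" and h: "h $ 0 = 0" and h': "h' $ 0 = 0" and N: "agree N h h'"
  shows "agree (Suc N) (fplus f h - h) (fplus f h' - h')"
proof -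
  let ?M = "Suc (Suc N)"
  have e: "agree (Suc N) (fplus f h - h) (\<Sum>a<Suc N. \<Sum>b<?M. fps_const (c (F $ Suc a $ b)) * f ^ Suc a * h ^ b)"
    if h: "h $ 0 = 0" for h
  proof -
    have "agree (Suc N) (fplus f h) (\<Sum>a<?M. \<Sum>b<?M. fps_const (c (F $ a $ b)) * f ^ a * h ^ b)"
      by (rule subst2_trunc) (auto simp: f h)
    also have "(\<Sum>a<?M. \<Sum>b<?M. fps_const (c (F $ a $ b)) * f ^ a * h ^ b) =
       (\<Sum>b<?M. fps_const (c (F $ 0 $ b)) * h ^ b) +
       (\<Sum>a<Suc N. \<Sum>b<?M. fps_const (c (F $ Suc a $ b)) * f ^ Suc a * h ^ b)"
      by (subst sum.lessThan_Suc_shift) simp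
    also have "(\<Sum>b<?M. fps_const (c (F $ 0 $ b)) * h ^ b) = (\<Sum>b<?M. if b = 1 then h else 0)"
      by (intro sum.cong refl) (auto simp: F_0 zero one)
    also have "\<dots> = h" by simp
    finally show ?thesis using agree_diff[of "Suc N" "fplus f h" _ h h] by fastforce
  qed
  have "agree (Suc N) (\<Sum>a<Suc N. \<Sum>b<?M. fps_const (c (F $ Suc a $ b)) * f ^ Suc a * h ^ b)
      (\<Sum>a<Suc N. \<Sum>b<?M. fps_const (c (F $ Suc a $ b)) * f ^ Suc a * h' ^ b)"
  proof (intro agree_sum)
    fix a b
    have "agree (Suc N) (f * (fps_const (c (F $ Suc a $ b)) * f ^ a * h ^ b))
      (f * (fps_const (c (F $ Suc a $ b)) * f ^ a * h' ^ b))"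
      by (intro agree_raise f agree_mult agree_refl agree_power N)
    then show "agree (Suc N) (fps_const (c (F $ Suc a $ b)) * f ^ Suc a * h ^ b)
        (fps_const (c (F $ Suc a $ b)) * f ^ Suc a * h' ^ b)" by (simp add: mult_ac)
  qed
  then show ?thesis using e[OF h] e[OF h'] agree_trans agree_sym by blast
qed

text \<open>
  By \<open>fplus_contract\<close> the map \<open>h \<mapsto> h - F(f, h)\<close> is a contraction; a fixed point is an inverse of f.
\<close>

lemma fplus_inverse: assumes f: "f $ 0 = 0" shows "\<exists>h. h $ 0 = 0 \<and> fplus h f = 0"
proof -
  define step where "step h = h - fplus f h" for h
  define H where "H n = (step ^^ n) 0" for n
  have H_Suc: "H (Suc n) = step (H n)" for n by (simp add: H_def)
  have H0: "H n $ 0 = 0" for n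
    by (induction n) (simp add: H_def, simp add: H_Suc step_def fplus_0 f)
  have step: "agree (Suc N) (step h) (step h')" if "h $ 0 = 0" "h' $ 0 = 0" "agree N h h'" for N h h'
    using fplus_contract[OF f that] unfolding step_def agree_def by (simp add: algebra_simps)
  have steps: "agree n (H n) (H (Suc n))" for n
    by (induction n) (simp add: agree_def, metis H_Suc H0 step)
  have lim: "agree n (H n) (H m)" if "n \<le> m" for n m
    using that
  proof (induction m rule: dec_induct)
    case (step m)
    then show ?case using \<open>\<And>n. agree n (H n) (H (Suc n))\<close> agree_mono agree_trans by blast
  qed simp
  \<comment> \<open>The iterates agree with all later ones modulo \<open>t\<^sup>n\<close>, so their limit is read off diagonally.\<close>
  define h where "h = Abs_fps (\<lambda>n. H (Suc n) $ n)"
  have hH: "agree n h (H n)" for n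
    unfolding agree_def
  proof (intro allI impI)
    fix k assume "k < n"
    then show "h $ k = H n $ k" using lim[of "Suc k" n] by (simp add: h_def agree_def)
  qed
  have h0: "h $ 0 = 0" by (simp add: h_def H0)
  have "h = step h"
  proof (rule agree_imp_eq)
    fix N
    have "agree N (step (H N)) (step h)"
      using step[OF H0 h0 agree_sym[OF hH]] agree_mono by (metis le_Suc_eq order_refl)
    moreover have "agree N h (H (Suc N))" using hH[of "Suc N"] agree_mono by (metis le_Suc_eq order_refl)
    ultimately show "agree N h (step h)" using agree_trans by (metis H_Suc)
  qed
  then have "fplus f h = 0" by (simp add: step_def)
  then show ?thesis using h0 fplus_commute[OF f h0] by metis
qed

definition fgroup :: "'a fps monoid" where
  "fgroup = \<lparr>carrier = {f. f $ 0 = 0}, mult = fplus, one = 0\<rparr>"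

lemma comm_group_fgroup: "comm_group fgroup"
proof (rule comm_groupI)
  fix x assume "x \<in> carrier fgroup"
  then show "\<exists>y\<in>carrier fgroup. y \<otimes>\<^bsub>fgroup\<^esub> x = \<one>\<^bsub>fgroup\<^esub>"
    using fplus_inverse[of x] by (auto simp: fgroup_def)
next
  fix x y assume "x \<in> carrier fgroup" "y \<in> carrier fgroup"
  then show "x \<otimes>\<^bsub>fgroup\<^esub> y = y \<otimes>\<^bsub>fgroup\<^esub> x"
    using fplus_commute[of x y] by (simp add: fgroup_def)
next
  fix x assume "x \<in> carrier fgroup"
  then show "\<one>\<^bsub>fgroup\<^esub> \<otimes>\<^bsub>fgroup\<^esub> x = x"
    using fplus_zero[of x] fplus_commute[of 0 x] by (simp add: fgroup_def)
qed (auto simp: fgroup_def fplus_0 fplus_assoc)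

lemma fplus_fpart:
  assumes "f $ 0 = 0" "g $ 0 = 0" shows "agree N (fplus f g) (fpart (\<lambda>r. fps_const (c r)) F N f g)"
  unfolding fpart_def by (rule subst2_trunc) (use assms in auto)

end

section \<open>Evaluation of the formal group algebra\<close>

text \<open>
  Polynomials over R in countably many variables. The linear order on the exponents makes them an
  integral domain.
\<close>

type_synonym 'r scalars = "(nat \<Rightarrow>\<^sub>0 nat) \<Rightarrow>\<^sub>0 'r"

locale fga_basis =
  fixes F :: "'r::idom fps fps" and B :: "'l::ab_group_add set"
  assumes fgl: "formal_group_law F"
    and finite_basis: "finite B" and indep: "zmodule.independent B" and span: "zmodule.span B = UNIV"
begin

definition scalar :: "'r \<Rightarrow> 'r scalars" where "scalar = Poly_Mapping.single 0"

sublocale fgl_evaluation scalar F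
  by unfold_locales (auto simp: scalar_def single_add mult_single fgl)

definition basis_index :: "'l \<Rightarrow> nat" where "basis_index = (SOME f. inj_on f B)"

lemma inj_basis_index: "inj_on basis_index B"
proof -
  obtain f :: "'l \<Rightarrow> nat" where "inj_on f B"
    using finite_imp_inj_to_nat_seg[OF finite_basis] by metis
  then show ?thesis unfolding basis_index_def by (rule someI[where P = "\<lambda>f. inj_on f B"])
qed


definition basis_point :: "'l \<Rightarrow> 'r scalars fps" where
  "basis_point b = fps_X * fps_const (Poly_Mapping.single (Poly_Mapping.single (basis_index b) 1) 1)"

text \<open>
  The homomorphism from the lattice to the group of the formal group law that sends b in B to \<open>t X\<^sub>b\<close>.
\<close>

definition fgl_point :: "'l \<Rightarrow> 'r scalars fps" where
  "fgl_point l = finprod fgroup (\<lambda>b. basis_point b [^]\<^bsub>fgroup\<^esub> (zmodule.representation B l b)) B"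

lemma basis_point_carrier: "basis_point b \<in> carrier fgroup" by (simp add: fgroup_def basis_point_def)

lemma fgl_point_carrier: "fgl_point l \<in> carrier fgroup"
proof -
  interpret G: comm_group fgroup by (rule comm_group_fgroup)
  show ?thesis unfolding fgl_point_def by (intro G.finprod_closed) (auto intro: G.int_pow_closed basis_point_carrier)
qed

lemma fgl_point_0: "fgl_point l $ 0 = 0"
  using fgl_point_carrier[of l] by (simp add: fgroup_def)

lemma fgl_point_add: "fgl_point (l + m) = fplus (fgl_point l) (fgl_point m)"
proof -
  interpret G: comm_group fgroup by (rule comm_group_fgroup)
  have "zmodule.representation B (l + m) b = zmodule.representation B l b + zmodule.representation B m b" for b
    by (subst zmodule.representation_add[OF indep]) (auto simp: span)
  then have "fgl_point (l + m) = fgl_point l \<otimes>\<^bsub>fgroup\<^esub> fgl_point m"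
    unfolding fgl_point_def
    by (subst G.finprod_multf[symmetric])
       (auto intro!: G.finprod_cong' simp: G.int_pow_mult basis_point_carrier G.int_pow_closed)
  then show ?thesis by (simp add: fgroup_def)
qed

lemma fgl_point_zero: "fgl_point 0 = 0"
proof -
  interpret G: comm_group fgroup by (rule comm_group_fgroup)
  have "fgl_point 0 = \<one>\<^bsub>fgroup\<^esub>" by (simp add: fgl_point_def zmodule.representation_zero G.finprod_one_eqI)
  then show ?thesis by (simp add: fgroup_def)
qed

lemma fgl_point_basis: assumes "b \<in> B" shows "fgl_point b = basis_point b"
proof -
  interpret G: comm_group fgroup by (rule comm_group_fgroup)
  have "fgl_point b = finprod fgroup (\<lambda>b'. if b = b' then basis_point b' else \<one>\<^bsub>fgroup\<^esub>) B"
    unfolding fgl_point_def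
    by (rule G.finprod_cong') (auto simp: zmodule.representation_basis[OF indep assms] basis_point_carrier G.int_pow_1)
  also have "\<dots> = basis_point b" by (rule G.finprod_singleton) (auto simp: assms finite_basis basis_point_carrier)
  finally show ?thesis .
qed

abbreviation const_series where "const_series \<equiv> (\<lambda>r. fps_const (scalar r))"

definition fgl_monomial :: "'l multiset \<Rightarrow> 'r scalars fps" where
  "fgl_monomial m = prod_mset (image_mset fgl_point m)"

lemma fgl_monomial_order: "k < size m \<Longrightarrow> fgl_monomial m $ k = 0"
proof (induction m arbitrary: k)
  case (add x m)
  have "agree (size m) (fgl_monomial m) 0" using add.IH by (simp add: agree_def)
  from agree_raise[OF fgl_point_0 this, of x] show ?case using add.prems by (simp add: agree_def fgl_monomial_def)
qed simp

sublocale se: series_evaluation const_series fgl_monomial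
proof
  show "const_series (x + y) = const_series x + const_series y" "const_series (x * y) = const_series x * const_series y" for x y
    by (simp_all add: add mult flip: fps_const_add fps_const_mult)
  show "const_series 1 = 1" by (simp add: one)
  show "fgl_monomial {#} = 1" "fgl_monomial (m + n) = fgl_monomial m * fgl_monomial n" for m n by (simp_all add: fgl_monomial_def)
qed (rule fgl_monomial_order)

lemma seval_svar: "se.seval (svar l) = fgl_point l"
  by (simp add: svar_ser se.seval_const se.eval_poly_pvar fgl_monomial_def)

lemma ev_fpart: "se.ev (fpart pconst F n x y) = fpart const_series F n (se.ev x) (se.ev y)"
  by (simp add: fpart_def se.eval_poly_sum se.eval_poly_mult se.eval_poly_power se.eval_poly_pconst)

lemma coherent_fgl_sum: "coherent (\<lambda>n. fpart pconst F n (pvar l) (pvar m))"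
  by (intro coherent_fpart deg_ge_pvar)

lemma seval_fgl_sum: "se.seval (fgl_sum F l m) = fplus (fgl_point l) (fgl_point m)"
proof (rule fps_ext)
  fix n
  have "agree (Suc n) (fplus (fgl_point l) (fgl_point m)) (fpart const_series F (Suc n) (fgl_point l) (fgl_point m))"
    by (rule fplus_fpart[OF fgl_point_0 fgl_point_0])
  then show "se.seval (fgl_sum F l m) $ n = fplus (fgl_point l) (fgl_point m) $ n"
    by (simp add: fgl_sum_ser se.seval_nth[OF coherent_fgl_sum lessI] ev_fpart se.eval_poly_pvar fgl_monomial_def agree_def)
qed

lemma seval_ring_hom: "ring_hom_ring series_ring type_ring se.seval"
proof (rule ring_hom_ringI2)
  show "ring (series_ring :: ('r, 'l) series ring)" using cring_series_ring cring.axioms(1) by blast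
  show "ring (type_ring :: 'r scalars fps ring)" using cring_type_ring cring.axioms(1) by blast
  show "se.seval \<in> ring_hom series_ring type_ring"
    by (rule ring_hom_memI)
       (auto elim!: series_cases simp: series_simps se.seval_mult se.seval_add se.seval_one)
qed

section \<open>The kernel of the evaluation\<close>


definition rel_ideal :: "('r, 'l) series set" where "rel_ideal = Idl\<^bsub>series_ring\<^esub> (fga_relations F)"

lemma fga_ideal_eq: "fga_ideal F = {s \<in> carrier series_ring. \<forall>n. \<exists>t\<in>rel_ideal. t n = s n}"
  by (simp add: fga_ideal_def rel_ideal_def completion_closure_def series_ring_def)

lemma fga_rel_ser: "svar (l + m) \<ominus>\<^bsub>series_ring\<^esub> fgl_sum F l m =
    ser (\<lambda>n. pvar (l + m) - fpart pconst F n (pvar l) (pvar m))"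
  by (simp add: a_minus_def svar_ser fgl_sum_ser series_minus[OF coherent_fgl_sum] series_simps)

lemma coherent_fga_rel: "coherent (\<lambda>n. pvar (l + m) - fpart pconst F n (pvar l) (pvar m))"
  using coherent_add[OF coherent_const coherent_minus[OF coherent_fgl_sum]] by simp

lemma relations_in_series: "fga_relations F \<subseteq> carrier (series_ring :: ('r, 'l) series ring)"
  unfolding fga_relations_def fga_rel_ser
  by (auto simp: svar_ser intro!: ser_in coherent_const coherent_fga_rel)

lemma ideal_rel_ideal: "ideal rel_ideal (series_ring :: ('r, 'l) series ring)"
  unfolding rel_ideal_def by (rule ring.genideal_ideal[OF cring.axioms(1)[OF cring_series_ring] relations_in_series])

lemma rel_ideal_generators: "svar 0 \<in> rel_ideal" "ser (\<lambda>n. pvar (l + m) - fpart pconst F n (pvar l) (pvar m)) \<in> rel_ideal"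
proof -
  have "fga_relations F \<subseteq> rel_ideal"
    unfolding rel_ideal_def by (rule ring.genideal_self[OF cring.axioms(1)[OF cring_series_ring] relations_in_series])
  then show "svar 0 \<in> rel_ideal" "ser (\<lambda>n. pvar (l + m) - fpart pconst F n (pvar l) (pvar m)) \<in> rel_ideal"
    unfolding fga_relations_def fga_rel_ser by auto
qed

lemma seval_diff: assumes "coherent p" "coherent q"
  shows "se.seval (ser (\<lambda>n. p n - q n)) = se.seval (ser p) - se.seval (ser q)"
proof -
  have c: "coherent (\<lambda>n. p n - q n)" using coherent_add[OF assms(1) coherent_minus[OF assms(2)]] by simp
  have "se.seval (ser (\<lambda>n. (p n - q n) + q n)) = se.seval (ser (\<lambda>n. p n - q n)) + se.seval (ser q)"
    by (rule se.seval_add[OF c assms(2)])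
  then show ?thesis by simp
qed

lemma seval_rel_ideal: assumes "s \<in> rel_ideal" shows "se.seval s = 0"
proof -
  interpret h: ring_hom_ring "series_ring :: ('r, 'l) series ring" type_ring se.seval by (rule seval_ring_hom)
  have "{x \<in> carrier type_ring. x = (0::'r scalars fps)} = {\<zero>\<^bsub>type_ring\<^esub>}" by simp
  have id: "ideal {s \<in> carrier series_ring. se.seval s \<in> {\<zero>\<^bsub>type_ring\<^esub>}} series_ring"
    by (rule h.ideal_vimage) (rule ring.zeroideal[OF cring.axioms(1)[OF cring_type_ring]])
  have "fga_relations F \<subseteq> {s \<in> carrier series_ring. se.seval s \<in> {\<zero>\<^bsub>type_ring\<^esub>}}"
  proof -
    have "se.seval (ser (\<lambda>n. pvar (l + m) - fpart pconst F n (pvar l) (pvar m))) = 0" for l m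
      using seval_diff[OF coherent_const coherent_fgl_sum, of "pvar (l + m)" l m]
        seval_svar[of "l + m"] seval_fgl_sum[of l m]
      by (simp add: svar_ser fgl_sum_ser fgl_point_add)
    then show ?thesis using relations_in_series unfolding fga_relations_def fga_rel_ser
      by (auto simp: seval_svar fgl_point_zero intro!: ser_in coherent_fga_rel)
  qed
  then have "rel_ideal \<subseteq> {s \<in> carrier series_ring. se.seval s \<in> {\<zero>\<^bsub>type_ring\<^esub>}}"
    unfolding rel_ideal_def by (rule ring.genideal_minimal[OF cring.axioms(1)[OF cring_series_ring] id])
  then show ?thesis using assms by auto
qed

text \<open>
  The polynomials that agree with an element of the ideal up to degree n. As an element of the
  closure is tested degree by degree, all congruences can be made between polynomials.
\<close>

definition rel_trunc :: "nat \<Rightarrow> ('r, 'l) polynomials set" where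
  "rel_trunc n = {p. \<exists>t\<in>rel_ideal. t n = coset n p}"

lemma rel_trunc_I: "ser w \<in> rel_ideal \<Longrightarrow> coset n (w n) = coset n p \<Longrightarrow> p \<in> rel_trunc n"
  unfolding rel_trunc_def by (rule CollectI, rule bexI[of _ "ser w"]) (simp add: ser_def, assumption)

lemma ev_rel_trunc: assumes "p \<in> rel_trunc n" "k < n" shows "se.ev p $ k = 0"
proof -
  obtain t where t: "t \<in> rel_ideal" "t n = coset n p" using assms by (auto simp: rel_trunc_def)
  have "t \<in> carrier series_ring" by (rule ideal.Icarr[OF ideal_rel_ideal t(1)])
  then obtain w where w: "t = ser w" "coherent w" by (rule series_cases)
  have "p - w n \<in> deg_ge n" using t(2) unfolding w ser_def coset_eq_iff[symmetric] by (rule sym)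
  then have "se.ev p $ k = se.ev (w n) $ k" using se.ev_deg_ge[of "p - w n" n k] assms(2) by (simp add: se.eval_poly_diff)
  also have "\<dots> = se.seval t $ k" using se.seval_nth[OF w(2) assms(2)] by (simp add: w)
  finally show ?thesis using seval_rel_ideal[OF t(1)] by simp
qed

lemma rel_trunc_deg_ge: "deg_ge n \<subseteq> rel_trunc n"
proof
  fix p :: "('r, 'l) polynomials" assume "p \<in> deg_ge n"
  then have "coset n p = coset n 0" by (simp add: coset_eq_iff)
  moreover have "\<zero>\<^bsub>series_ring\<^esub> \<in> rel_ideal"
    using additive_subgroup.zero_closed[OF ideal.axioms(1)[OF ideal_rel_ideal]] .
  then have "ser (\<lambda>n. 0) \<in> rel_ideal" by (simp add: series_simps)
  ultimately show "p \<in> rel_trunc n" using rel_trunc_I[of "\<lambda>n. 0"] by simp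
qed

lemma rel_trunc_cases: assumes "p \<in> rel_trunc n" obtains w where "ser w \<in> rel_ideal" "coherent w" "coset n (w n) = coset n p"
proof -
  obtain t where t: "t \<in> rel_ideal" "t n = coset n p" using assms by (auto simp: rel_trunc_def)
  have "t \<in> carrier series_ring" by (rule ideal.Icarr[OF ideal_rel_ideal t(1)])
  then obtain w where w: "t = ser w" "coherent w" by (rule series_cases)
  show ?thesis by (rule that[of w]) (use t w in \<open>simp_all add: ser_def\<close>)
qed

lemma rel_trunc_add: assumes "p \<in> rel_trunc n" "q \<in> rel_trunc n" shows "p + q \<in> rel_trunc n"
proof -
  obtain v where v: "ser v \<in> rel_ideal" "coherent v" "coset n (v n) = coset n p" using rel_trunc_cases[OF assms(1)] .
  obtain w where w: "ser w \<in> rel_ideal" "coherent w" "coset n (w n) = coset n q" using rel_trunc_cases[OF assms(2)] .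
  have "ser v \<oplus>\<^bsub>series_ring\<^esub> ser w \<in> rel_ideal"
    using additive_subgroup.a_closed[OF ideal.axioms(1)[OF ideal_rel_ideal] v(1) w(1)] .
  then have "ser (\<lambda>n. v n + w n) \<in> rel_ideal" by (simp add: series_simps)
  moreover have "coset n (v n + w n) = coset n (p + q)"
    using v(3) w(3) deg_ge_add[of "v n - p" n "w n - q"] by (simp add: coset_eq_iff algebra_simps)
  ultimately show ?thesis by (rule rel_trunc_I)
qed

lemma rel_trunc_mult: assumes "p \<in> rel_trunc n" shows "q * p \<in> rel_trunc n"
proof -
  obtain v where v: "ser v \<in> rel_ideal" "coherent v" "coset n (v n) = coset n p" using rel_trunc_cases[OF assms] .
  have "ser (\<lambda>_. q) \<otimes>\<^bsub>series_ring\<^esub> ser v \<in> rel_ideal"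
    by (rule ideal.I_l_closed[OF ideal_rel_ideal v(1) ser_in[OF coherent_const]])
  then have "ser (\<lambda>n. q * v n) \<in> rel_ideal" by (simp add: series_simps)
  moreover have "coset n (q * v n) = coset n (q * p)"
    using v(3) deg_ge_mult_left[of "v n - p" n q] by (simp add: coset_eq_iff right_diff_distrib)
  ultimately show ?thesis by (rule rel_trunc_I)
qed

lemma rel_trunc_minus: "p \<in> rel_trunc n \<Longrightarrow> - p \<in> rel_trunc n" using rel_trunc_mult[of p n "- 1"] by simp

lemma rel_trunc_var_0: "pvar 0 \<in> rel_trunc n"
  using rel_ideal_generators(1) unfolding svar_ser by (rule rel_trunc_I) (rule refl)

lemma rel_trunc_var_add: "pvar (l + m) - fpart pconst F n (pvar l) (pvar m) \<in> rel_trunc n"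
  using rel_ideal_generators(2)[of l m] by (rule rel_trunc_I) (rule refl)

definition basis_polys :: "('r, 'l) polynomials set" where
  "basis_polys = {p. \<forall>m\<in>Poly_Mapping.keys p. set_mset m \<subseteq> B}"

lemma basis_polys_add: "p \<in> basis_polys \<Longrightarrow> q \<in> basis_polys \<Longrightarrow> p + q \<in> basis_polys"
  and basis_polys_mult: "p \<in> basis_polys \<Longrightarrow> q \<in> basis_polys \<Longrightarrow> p * q \<in> basis_polys"
  and basis_polys_zero: "0 \<in> basis_polys" and basis_polys_const: "pconst r \<in> basis_polys" and basis_polys_var: "b \<in> B \<Longrightarrow> pvar b \<in> basis_polys"
  using keys_add[of p q] keys_mult[of p q] by (fastforce simp: basis_polys_def pconst_def pvar_def)+

text \<open>
  The polynomials that are congruent, modulo relations and terms of degree n, to a polynomial in the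
  basis variables.
\<close>

definition reducible :: "nat \<Rightarrow> ('r, 'l) polynomials set" where
  "reducible n = {p. \<exists>q\<in>basis_polys. p - q \<in> rel_trunc n}"

lemma reducible_BP: "p \<in> basis_polys \<Longrightarrow> p \<in> reducible n"
  using rel_trunc_deg_ge deg_ge_zero by (force simp: reducible_def)

lemma reducible_rel_trunc: "p \<in> rel_trunc n \<Longrightarrow> p \<in> reducible n"
  using basis_polys_zero by (auto simp: reducible_def intro!: bexI[of _ 0])

lemma reducible_add: assumes "p \<in> reducible n" "p' \<in> reducible n" shows "p + p' \<in> reducible n"
proof -
  obtain q q' where q: "q \<in> basis_polys" "p - q \<in> rel_trunc n" "q' \<in> basis_polys" "p' - q' \<in> rel_trunc n" using assms by (auto simp: reducible_def)
  have "p + p' - (q + q') \<in> rel_trunc n" using rel_trunc_add[OF q(2,4)] by (simp add: algebra_simps)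
  then show ?thesis using basis_polys_add[OF q(1,3)] by (auto simp: reducible_def)
qed

lemma reducible_mult: assumes "p \<in> reducible n" "p' \<in> reducible n" shows "p * p' \<in> reducible n"
proof -
  obtain q q' where q: "q \<in> basis_polys" "p - q \<in> rel_trunc n" "q' \<in> basis_polys" "p' - q' \<in> rel_trunc n" using assms by (auto simp: reducible_def)
  have "p * p' - q * q' = p' * (p - q) + q * (p' - q')" by (simp add: algebra_simps)
  then have "p * p' - q * q' \<in> rel_trunc n" using rel_trunc_add[OF rel_trunc_mult[OF q(2)] rel_trunc_mult[OF q(4)]] by simp
  then show ?thesis using basis_polys_mult[OF q(1,3)] by (auto simp: reducible_def)
qed

lemma reducible_const: "pconst r \<in> reducible n" by (rule reducible_BP[OF basis_polys_const])

lemma reducible_sum: "(\<And>x. x \<in> S \<Longrightarrow> h x \<in> reducible n) \<Longrightarrow> sum h S \<in> reducible n"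
  by (induction S rule: infinite_finite_induct) (auto simp: reducible_BP basis_polys_zero reducible_add)

lemma reducible_power: "p \<in> reducible n \<Longrightarrow> p ^ k \<in> reducible n"
  by (induction k) (auto simp: reducible_mult reducible_const[of 1, unfolded pconst_one])

lemma reducible_minus: assumes "p \<in> reducible n" shows "- p \<in> reducible n"
proof -
  obtain q where q: "q \<in> basis_polys" "p - q \<in> rel_trunc n" using assms by (auto simp: reducible_def)
  have "- p - (- q) \<in> rel_trunc n" using rel_trunc_minus[OF q(2)] by simp
  moreover have "- q \<in> basis_polys" using q(1) by (simp add: basis_polys_def)
  ultimately show ?thesis unfolding reducible_def by blast
qed

lemma reducible_diff: "p \<in> reducible n \<Longrightarrow> q \<in> reducible n \<Longrightarrow> p - q \<in> reducible n"
  using reducible_add[of p n "- q"] reducible_minus by simp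

lemma reducible_fpart: "p \<in> reducible n \<Longrightarrow> q \<in> reducible n \<Longrightarrow> fpart pconst F k p q \<in> reducible n"
  unfolding fpart_def by (intro reducible_sum reducible_mult reducible_const reducible_power)

lemma reducible_var_0: "pvar 0 \<in> reducible n" by (rule reducible_rel_trunc[OF rel_trunc_var_0])

lemma reducible_var_add: assumes "pvar l \<in> reducible n" "pvar m \<in> reducible n" shows "pvar (l + m) \<in> reducible n"
  using reducible_add[OF reducible_rel_trunc[OF rel_trunc_var_add[of l m n]] reducible_fpart[OF assms, of n]] by simp

lemma power_diff_deg_ge: "y - r \<in> deg_ge k \<Longrightarrow> y ^ b - r ^ b \<in> deg_ge k"
proof (induction b)
  case (Suc b)
  have "y ^ Suc b - r ^ Suc b = y ^ b * (y - r) + r * (y ^ b - r ^ b)" by (simp add: algebra_simps)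
  then show ?case using Suc deg_ge_add deg_ge_mult_left by metis
qed (simp add: deg_ge_zero)

text \<open>
  The relation \<open>F(x, y) = 0\<close> for \<open>x = x\<^sub>l\<close> and \<open>y = x\<^sub>-\<^sub>l\<close> reads
  \<open>y = F(x, y) - \<Sum> F\<^sub>a\<^sub>b x\<^sup>a y\<^sup>b\<close> over \<open>a \<ge> 1\<close>. Inserting an approximation of y of order k on the right gives one of
  order \<open>k + 1\<close>, and n steps suffice.
\<close>

lemma reducible_var_minus: assumes "pvar l \<in> reducible n" shows "pvar (- l) \<in> reducible n"
proof (cases "n < 2")
  case True
  then have "pvar (- l) \<in> deg_ge n" by (intro subsetD[OF deg_ge_mono deg_ge_pvar]) simp
  then show ?thesis using rel_trunc_deg_ge reducible_rel_trunc by blast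
next
  case False
  define x y :: "('r, 'l) polynomials" where "x = pvar l" and "y = pvar (- l)"
  note xy = x_def y_def
  let ?t = "\<lambda>a b. pconst (F $ a $ b) * x ^ a * y ^ b"
  obtain n' where n': "n = Suc n'" using False by (metis not_less_zero not_less_eq old.nat.exhaust zero_less_numeral)
  have "fpart pconst F n x y = (\<Sum>b<n. ?t 0 b) + (\<Sum>a<n'. \<Sum>b<n. ?t (Suc a) b)"
    unfolding fpart_def n' by (subst sum.lessThan_Suc_shift) simp
  also have "(\<Sum>b<n. ?t 0 b) = (\<Sum>b<n. if b = 1 then y else 0)"
    by (intro sum.cong refl) (auto simp: F_0 pconst_one, simp add: pconst_def)
  also have "\<dots> = y" using False by simp
  finally have y: "y = fpart pconst F n x y - (\<Sum>a<n'. \<Sum>b<n. ?t (Suc a) b)" by simp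
  have F: "fpart pconst F n x y \<in> reducible n"
    using reducible_diff[OF reducible_var_0 reducible_rel_trunc[OF rel_trunc_var_add[of l "- l" n]]] by (simp add: xy)
  have "\<exists>r\<in>reducible n. y - r \<in> deg_ge k" for k
  proof (induction k)
    case 0
    show ?case using reducible_var_0 deg_ge_0 by blast
  next
    case (Suc k)
    then obtain r where r: "r \<in> reducible n" "y - r \<in> deg_ge k" by blast
    let ?r = "fpart pconst F n x y - (\<Sum>a<n'. \<Sum>b<n. pconst (F $ Suc a $ b) * x ^ Suc a * r ^ b)"
    have "?r \<in> reducible n"
      using assms by (intro reducible_diff F reducible_sum reducible_mult reducible_const reducible_power r) (simp_all add: xy)
    moreover have "y - ?r \<in> deg_ge (Suc k)"
    proof -
      have "y - ?r = - (\<Sum>a<n'. \<Sum>b<n. pconst (F $ Suc a $ b) * x ^ a * (x * (y ^ b - r ^ b)))"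
        by (subst (1) y) (simp add: algebra_simps flip: sum_subtractf sum_negf)
      also have "\<dots> \<in> deg_ge (Suc k)"
      proof (intro deg_ge_minus deg_ge_sum, rule deg_ge_mult_left)
        fix b show "x * (y ^ b - r ^ b) \<in> deg_ge (Suc k)"
          using deg_ge_mult[OF deg_ge_pvar[of l] power_diff_deg_ge[OF r(2)]] by (simp add: xy)
      qed
      finally show ?thesis .
    qed
    ultimately show ?case by blast
  qed
  then obtain r where r: "r \<in> reducible n" "y - r \<in> deg_ge n" by blast
  then have "r + (y - r) \<in> reducible n" using rel_trunc_deg_ge reducible_rel_trunc reducible_add by blast
  then show ?thesis by (simp add: xy)
qed

lemma reducible_var: "pvar l \<in> reducible n"
proof -
  let ?S = "{l. pvar l \<in> reducible n}"
  have sum: "(\<Sum>k<m. x) \<in> ?S" if "x \<in> ?S" for x and m :: nat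
    using that by (induction m) (auto simp: reducible_var_0 reducible_var_add)
  have scale: "zscale c x \<in> ?S" if "x \<in> ?S" for c x
    using reducible_var_add[of "\<Sum>k<nat c. x" n "- (\<Sum>k<nat (- c). x)"] sum[OF that] reducible_var_minus
    unfolding zscale_def by auto
  have "zmodule.subspace ?S"
    by (intro zmodule.subspaceI) (use scale in \<open>auto simp: reducible_var_0 reducible_var_add\<close>)
  moreover have "B \<subseteq> ?S" by (auto intro: reducible_BP basis_polys_var)
  ultimately have "zmodule.span B \<subseteq> ?S" by (rule zmodule.span_minimal[rotated])
  then show ?thesis by (auto simp: span)
qed

lemma reducible_all: "p \<in> reducible n"
proof -
  have "Poly_Mapping.single m r \<in> reducible n" for m r
  proof (induction m)
    case empty
    show ?case using reducible_const[of r n] by (simp add: pconst_def)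
  next
    case (add x m)
    have "Poly_Mapping.single (add_mset x m) r = pvar x * Poly_Mapping.single m r"
      by (simp add: pvar_def mult_single)
    then show ?case using reducible_mult[OF reducible_var add] by simp
  qed
  then have "(\<Sum>m\<in>Poly_Mapping.keys p. Poly_Mapping.single m (Poly_Mapping.lookup p m)) \<in> reducible n"
    by (intro reducible_sum)
  then show ?thesis by (simp add: poly_monomials)
qed

definition exponents :: "'l multiset \<Rightarrow> (nat \<Rightarrow>\<^sub>0 nat)" where
  "exponents m = (\<Sum>b\<in>#m. Poly_Mapping.single (basis_index b) 1)"

lemma lookup_exponents: "set_mset m \<subseteq> B \<Longrightarrow> b \<in> B \<Longrightarrow> Poly_Mapping.lookup (exponents m) (basis_index b) = count m b"
  by (induction m) (use inj_onD[OF inj_basis_index] in \<open>auto simp: exponents_def lookup_add lookup_single when_def\<close>)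

lemma exponents_inj: assumes "set_mset m \<subseteq> B" "set_mset m' \<subseteq> B" "exponents m = exponents m'" shows "m = m'"
proof (rule multiset_eqI)
  fix b
  show "count m b = count m' b"
  proof (cases "b \<in> B")
    case True
    then show ?thesis using lookup_exponents assms by metis
  next
    case False
    then show ?thesis using assms by (metis count_inI subsetD)
  qed
qed

lemma fgl_monomial_basis: "set_mset m \<subseteq> B \<Longrightarrow>
    fgl_monomial m = fps_X ^ size m * fps_const (Poly_Mapping.single (exponents m) 1)"
proof (induction m)
  case empty
  show ?case by (simp add: fgl_monomial_def exponents_def)
next
  case (add b m)
  then have "fgl_monomial (add_mset b m) = basis_point b * (fps_X ^ size m * fps_const (Poly_Mapping.single (exponents m) 1))"
    by (simp add: fgl_monomial_def fgl_point_basis)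
  then have "fgl_monomial (add_mset b m) = fps_X ^ Suc (size m) *
      (fps_const (Poly_Mapping.single (Poly_Mapping.single (basis_index b) 1) 1) *
       fps_const (Poly_Mapping.single (exponents m) 1))"
    unfolding basis_point_def by (simp only: power_Suc mult_ac)
  then show ?case by (simp add: exponents_def mult_single)
qed

text \<open>
  The coefficient of \<open>t\<^sup>d\<close> in the value of a polynomial in the basis variables is its homogeneous
  part of degree d, because distinct monomials go to distinct monomials in the \<open>X\<^sub>b\<close>.
\<close>

lemma basis_polys_kernel: assumes q: "q \<in> basis_polys" and 0: "\<And>k. k < n \<Longrightarrow> se.ev q $ k = 0" shows "q \<in> deg_ge n"
proof -
  have "n \<le> size m" if m: "m \<in> Poly_Mapping.keys q" for m
  proof (rule ccontr)
    assume "\<not> n \<le> size m"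
    have coeff: "(const_series (Poly_Mapping.lookup q m') * fgl_monomial m') $ size m =
        (if size m' = size m then Poly_Mapping.single (exponents m') (Poly_Mapping.lookup q m') else 0)"
      if "m' \<in> Poly_Mapping.keys q" for m'
    proof -
      have "set_mset m' \<subseteq> B" using q that by (auto simp: basis_polys_def)
      then have "const_series (Poly_Mapping.lookup q m') * fgl_monomial m' = fps_X ^ size m' *
          fps_const (Poly_Mapping.single (exponents m') (Poly_Mapping.lookup q m'))"
        by (simp add: fgl_monomial_basis scalar_def mult_single mult.left_commute)
      then show ?thesis by (auto simp: fps_X_power_mult_nth)
    qed
    have "0 = Poly_Mapping.lookup (se.ev q $ size m) (exponents m)" using 0 \<open>\<not> n \<le> size m\<close> by simp
    also have "\<dots> = (\<Sum>m'\<in>Poly_Mapping.keys q. Poly_Mapping.lookup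
        (if size m' = size m then Poly_Mapping.single (exponents m') (Poly_Mapping.lookup q m') else 0) (exponents m))"
      unfolding eval_poly_def fps_sum_nth lookup_sum by (intro sum.cong refl) (simp only: coeff)
    also have "\<dots> = (\<Sum>m'\<in>Poly_Mapping.keys q. if m' = m then Poly_Mapping.lookup q m else 0)"
    proof (intro sum.cong refl)
      fix m' assume "m' \<in> Poly_Mapping.keys q"
      then have "exponents m' = exponents m \<longleftrightarrow> m' = m" using exponents_inj[of m' m] q m by (auto simp: basis_polys_def)
      then show "Poly_Mapping.lookup (if size m' = size m then
          Poly_Mapping.single (exponents m') (Poly_Mapping.lookup q m') else 0) (exponents m) =
          (if m' = m then Poly_Mapping.lookup q m else 0)" by (auto simp: lookup_single when_def)
    qed
    also have "\<dots> = Poly_Mapping.lookup q m" using m by simp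
    finally show False using m by (simp add: in_keys_iff)
  qed
  then show ?thesis by (simp add: deg_ge_def)
qed

text \<open>
  In each degree, an element of the kernel is congruent to a polynomial q in the basis variables
  modulo relations. The relations evaluate to zero, so q does so in low degrees and has only
  terms of high degree.
\<close>

lemma fga_ideal_kernel: "(fga_ideal F :: ('r, 'l) series set) = a_kernel series_ring type_ring se.seval"
proof (intro equalityI subsetI)
  fix s :: "('r, 'l) series" assume "s \<in> fga_ideal F"
  then have s: "s \<in> carrier series_ring" "\<And>n. \<exists>t\<in>rel_ideal. t n = s n" by (auto simp: fga_ideal_eq)
  obtain p where p: "s = ser p" "coherent p" using series_cases[OF s(1)] .
  have "se.seval s = 0"
  proof (rule fps_ext)
    fix n
    have "p (Suc n) \<in> rel_trunc (Suc n)" using s(2)[of "Suc n"] by (auto simp: rel_trunc_def p ser_def)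
    then show "se.seval s $ n = 0 $ n" using ev_rel_trunc[of _ "Suc n" n] by (simp add: p se.seval_nth[OF p(2) lessI])
  qed
  then show "s \<in> a_kernel series_ring type_ring se.seval" using s(1) by (simp add: a_kernel_def kernel_def)
next
  fix s :: "('r, 'l) series" assume "s \<in> a_kernel series_ring type_ring se.seval"
  then have s: "s \<in> carrier series_ring" "se.seval s = 0" by (auto simp: a_kernel_def kernel_def)
  obtain p where p: "s = ser p" "coherent p" using series_cases[OF s(1)] .
  have "\<exists>t\<in>rel_ideal. t n = s n" for n
  proof -
    obtain q where q: "q \<in> basis_polys" "p n - q \<in> rel_trunc n" using reducible_all[of "p n" n] by (auto simp: reducible_def)
    have "q \<in> deg_ge n"
    proof (rule basis_polys_kernel[OF q(1)])
      fix k assume k: "k < n"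
      have "se.ev (p n) $ k = 0" using se.seval_nth[OF p(2) k] s(2) by (simp add: p)
      then show "se.ev q $ k = 0" using ev_rel_trunc[OF q(2) k] by (simp add: se.eval_poly_diff)
    qed
    then have "p n \<in> rel_trunc n" using rel_trunc_add[OF q(2), of q] rel_trunc_deg_ge by auto
    then show ?thesis by (simp add: rel_trunc_def p ser_def)
  qed
  then show "s \<in> fga_ideal F" using s(1) by (simp add: fga_ideal_eq)
qed

end

section \<open>Rings embedded in a type\<close>

text \<open>
  Ring axioms can be checked after an injective map that respects the operations. The additive
  inverses need a separate hypothesis, since the carrier is merely closed under sums.
\<close>

lemma cring_by_embedding:
  fixes R :: "('b, 'c) ring_scheme" and \<theta> :: "'b \<Rightarrow> 'a::comm_ring_1"
  assumes inj: "inj_on \<theta> (carrier R)"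
    and closed: "\<And>x y. x \<in> carrier R \<Longrightarrow> y \<in> carrier R \<Longrightarrow> x \<oplus>\<^bsub>R\<^esub> y \<in> carrier R"
      "\<And>x y. x \<in> carrier R \<Longrightarrow> y \<in> carrier R \<Longrightarrow> x \<otimes>\<^bsub>R\<^esub> y \<in> carrier R"
      "\<zero>\<^bsub>R\<^esub> \<in> carrier R" "\<one>\<^bsub>R\<^esub> \<in> carrier R"
    and hom: "\<And>x y. x \<in> carrier R \<Longrightarrow> y \<in> carrier R \<Longrightarrow> \<theta> (x \<oplus>\<^bsub>R\<^esub> y) = \<theta> x + \<theta> y"
      "\<And>x y. x \<in> carrier R \<Longrightarrow> y \<in> carrier R \<Longrightarrow> \<theta> (x \<otimes>\<^bsub>R\<^esub> y) = \<theta> x * \<theta> y"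
      "\<theta> \<zero>\<^bsub>R\<^esub> = 0" "\<theta> \<one>\<^bsub>R\<^esub> = 1"
    and neg: "\<And>x. x \<in> carrier R \<Longrightarrow> \<exists>y\<in>carrier R. \<theta> y = - \<theta> x"
  shows "cring R"
proof (rule cringI)
  show "abelian_group R"
  proof (rule abelian_groupI)
    fix x assume x: "x \<in> carrier R"
    obtain y where y: "y \<in> carrier R" "\<theta> y = - \<theta> x" using neg[OF x] by blast
    have "y \<oplus>\<^bsub>R\<^esub> x = \<zero>\<^bsub>R\<^esub>" by (rule inj_onD[OF inj]) (simp_all add: x y closed hom)
    then show "\<exists>y\<in>carrier R. y \<oplus>\<^bsub>R\<^esub> x = \<zero>\<^bsub>R\<^esub>" using y by blast
  qed (auto intro!: inj_onD[OF inj] simp: closed hom add_ac)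
  show "comm_monoid R"
    by (rule comm_monoidI) (auto intro!: inj_onD[OF inj] simp: closed hom mult_ac)
qed (auto intro!: inj_onD[OF inj] simp: closed hom distrib_right)

section \<open>The fraction field of an embedded ring\<close>

text \<open>
  A commutative ring embedded in an integral domain, given as a type. Its fraction field, whose elements are
  sets of pairs, then embeds in the type of fractions.
\<close>

locale embedded_ring =
  fixes A :: "('b, 'c) ring_scheme" and \<psi> :: "'b \<Rightarrow> 'a::idom"
  assumes cring_A: "cring A" and inj_psi: "inj_on \<psi> (carrier A)"
    and psi_add: "\<And>x y. x \<in> carrier A \<Longrightarrow> y \<in> carrier A \<Longrightarrow> \<psi> (x \<oplus>\<^bsub>A\<^esub> y) = \<psi> x + \<psi> y"
    and psi_mult: "\<And>x y. x \<in> carrier A \<Longrightarrow> y \<in> carrier A \<Longrightarrow> \<psi> (x \<otimes>\<^bsub>A\<^esub> y) = \<psi> x * \<psi> y"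
    and psi_one: "\<psi> \<one>\<^bsub>A\<^esub> = 1"
begin

sublocale A: cring A by (rule cring_A)

lemma psi_zero: "\<psi> \<zero>\<^bsub>A\<^esub> = 0"
  using psi_add[of "\<zero>\<^bsub>A\<^esub>" "\<zero>\<^bsub>A\<^esub>"] by (metis A.l_zero A.zero_closed add_cancel_right_right)

lemma psi_minus: "x \<in> carrier A \<Longrightarrow> \<psi> (\<ominus>\<^bsub>A\<^esub> x) = - \<psi> x"
  using psi_add[of x "\<ominus>\<^bsub>A\<^esub> x"] by (simp add: A.r_neg psi_zero eq_neg_iff_add_eq_0 add.commute)

lemma psi_eq_iff: "x \<in> carrier A \<Longrightarrow> y \<in> carrier A \<Longrightarrow> x = y \<longleftrightarrow> \<psi> x = \<psi> y"
  using inj_onD[OF inj_psi] by auto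

definition nz where "nz = carrier A - {\<zero>\<^bsub>A\<^esub>}"

lemma nz_iff: "x \<in> nz \<longleftrightarrow> x \<in> carrier A \<and> \<psi> x \<noteq> 0"
  using psi_eq_iff[of x "\<zero>\<^bsub>A\<^esub>"] by (auto simp: psi_zero nz_def)

lemma nz_carrier [simp]: "x \<in> nz \<Longrightarrow> x \<in> carrier A" by (simp add: nz_def)

lemma nz_mult: "x \<in> nz \<Longrightarrow> y \<in> nz \<Longrightarrow> x \<otimes>\<^bsub>A\<^esub> y \<in> nz"
  by (simp add: nz_iff psi_mult)

lemma nz_one: "\<one>\<^bsub>A\<^esub> \<in> nz" by (simp add: nz_iff psi_one)

lemma fraction_iff:
  assumes "a \<in> carrier A" "b \<in> nz"
  shows "p \<in> fraction A a b \<longleftrightarrow> fst p \<in> carrier A \<and> snd p \<in> nz \<and> \<psi> a * \<psi> (snd p) = \<psi> (fst p) * \<psi> b"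
proof -
  obtain c d where p: "p = (c, d)" by force
  have "a \<otimes>\<^bsub>A\<^esub> d = c \<otimes>\<^bsub>A\<^esub> b \<longleftrightarrow> \<psi> a * \<psi> d = \<psi> c * \<psi> b" if "c \<in> carrier A" "d \<in> nz"
    using that assms by (subst psi_eq_iff) (auto simp: psi_mult)
  then show ?thesis using assms by (auto simp: p fraction_def fraction_rel_def nz_def)
qed

lemma fraction_self: "a \<in> carrier A \<Longrightarrow> b \<in> nz \<Longrightarrow> (a, b) \<in> fraction A a b"
  by (subst fraction_iff) auto

lemma fraction_eq_iff:
  assumes ab: "a \<in> carrier A" "b \<in> nz" and cd: "c \<in> carrier A" "d \<in> nz"
  shows "fraction A a b = fraction A c d \<longleftrightarrow> \<psi> a * \<psi> d = \<psi> c * \<psi> b"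
proof
  assume "fraction A a b = fraction A c d"
  then have "(a, b) \<in> fraction A c d" using fraction_self[OF ab] by simp
  then show "\<psi> a * \<psi> d = \<psi> c * \<psi> b" using fraction_iff[OF cd] by simp
next
  assume e: "\<psi> a * \<psi> d = \<psi> c * \<psi> b"
  have "\<psi> a * y = x * \<psi> b \<longleftrightarrow> \<psi> c * y = x * \<psi> d" if "y \<noteq> 0" for x y
  proof -
    have "\<psi> b \<noteq> 0" "\<psi> d \<noteq> 0" using ab cd by (auto simp: nz_iff)
    moreover have "\<psi> b * (\<psi> c * y - x * \<psi> d) = \<psi> d * (\<psi> a * y - x * \<psi> b)"
      using e by (simp add: algebra_simps)
    ultimately show ?thesis by (metis eq_iff_diff_eq_0 mult_eq_0_iff)
  qed
  then show "fraction A a b = fraction A c d"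
    using fraction_iff[OF ab] fraction_iff[OF cd] by (auto simp: nz_iff)
qed

abbreviation FF where "FF \<equiv> fraction_field A"

lemma carrier_FF: "carrier FF = {fraction A a b |a b. a \<in> carrier A \<and> b \<in> nz}"
  by (auto simp: fraction_field_def quotient_def fraction_def nz_def)

lemma FF_cases:
  assumes "x \<in> carrier FF" obtains a b where "x = fraction A a b" "a \<in> carrier A" "b \<in> nz"
  using assms by (auto simp: carrier_FF)

lemma fraction_in: "a \<in> carrier A \<Longrightarrow> b \<in> nz \<Longrightarrow> fraction A a b \<in> carrier FF"
  by (auto simp: carrier_FF)

lemma FF_mult:
  assumes ab: "a \<in> carrier A" "b \<in> nz" and cd: "c \<in> carrier A" "d \<in> nz"
  shows "fraction A a b \<otimes>\<^bsub>FF\<^esub> fraction A c d = fraction A (a \<otimes>\<^bsub>A\<^esub> c) (b \<otimes>\<^bsub>A\<^esub> d)"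
proof -
  let ?r = "fraction A (a \<otimes>\<^bsub>A\<^esub> c) (b \<otimes>\<^bsub>A\<^esub> d)"
  have *: "fraction A (fst p \<otimes>\<^bsub>A\<^esub> fst q) (snd p \<otimes>\<^bsub>A\<^esub> snd q) = ?r"
    if "p \<in> fraction A a b" "q \<in> fraction A c d" for p q
  proof -
    have p: "fst p \<in> carrier A" "snd p \<in> nz" "\<psi> a * \<psi> (snd p) = \<psi> (fst p) * \<psi> b"
      and q: "fst q \<in> carrier A" "snd q \<in> nz" "\<psi> c * \<psi> (snd q) = \<psi> (fst q) * \<psi> d"
      using that fraction_iff[OF ab] fraction_iff[OF cd] by auto
    have "(\<psi> (fst p) * \<psi> (fst q)) * (\<psi> b * \<psi> d) = (\<psi> a * \<psi> c) * (\<psi> (snd p) * \<psi> (snd q))"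
      using p(3) q(3) by (metis mult.assoc mult.left_commute)
    then show ?thesis
      using p q ab cd nz_mult[OF p(2) q(2)] nz_mult[OF ab(2) cd(2)]
      by (subst fraction_eq_iff) (auto simp: psi_mult)
  qed
  have "fraction A a b \<otimes>\<^bsub>FF\<^esub> fraction A c d = (\<Union>p\<in>fraction A a b. \<Union>q\<in>fraction A c d.
      fraction A (fst p \<otimes>\<^bsub>A\<^esub> fst q) (snd p \<otimes>\<^bsub>A\<^esub> snd q))"
    by (simp add: fraction_field_def case_prod_unfold)
  also have "\<dots> = (\<Union>p\<in>fraction A a b. \<Union>q\<in>fraction A c d. ?r)" by (intro SUP_cong refl *)
  also have "\<dots> = ?r" using fraction_self[OF ab] fraction_self[OF cd] by auto
  finally show ?thesis .
qed

lemma FF_add: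
  assumes ab: "a \<in> carrier A" "b \<in> nz" and cd: "c \<in> carrier A" "d \<in> nz"
  shows "fraction A a b \<oplus>\<^bsub>FF\<^esub> fraction A c d = fraction A (a \<otimes>\<^bsub>A\<^esub> d \<oplus>\<^bsub>A\<^esub> c \<otimes>\<^bsub>A\<^esub> b) (b \<otimes>\<^bsub>A\<^esub> d)"
proof -
  let ?r = "fraction A (a \<otimes>\<^bsub>A\<^esub> d \<oplus>\<^bsub>A\<^esub> c \<otimes>\<^bsub>A\<^esub> b) (b \<otimes>\<^bsub>A\<^esub> d)"
  have *: "fraction A (fst p \<otimes>\<^bsub>A\<^esub> snd q \<oplus>\<^bsub>A\<^esub> fst q \<otimes>\<^bsub>A\<^esub> snd p) (snd p \<otimes>\<^bsub>A\<^esub> snd q) = ?r"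
    if "p \<in> fraction A a b" "q \<in> fraction A c d" for p q
  proof -
    have p: "fst p \<in> carrier A" "snd p \<in> nz" "\<psi> a * \<psi> (snd p) = \<psi> (fst p) * \<psi> b"
      and q: "fst q \<in> carrier A" "snd q \<in> nz" "\<psi> c * \<psi> (snd q) = \<psi> (fst q) * \<psi> d"
      using that fraction_iff[OF ab] fraction_iff[OF cd] by auto
    have "(\<psi> (fst p) * \<psi> (snd q) + \<psi> (fst q) * \<psi> (snd p)) * (\<psi> b * \<psi> d) =
        (\<psi> (fst p) * \<psi> b) * (\<psi> (snd q) * \<psi> d) + (\<psi> (fst q) * \<psi> d) * (\<psi> (snd p) * \<psi> b)"
      by (simp add: algebra_simps)
    also have "\<dots> = (\<psi> a * \<psi> d + \<psi> c * \<psi> b) * (\<psi> (snd p) * \<psi> (snd q))"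
      unfolding p(3)[symmetric] q(3)[symmetric] by (simp add: algebra_simps)
    finally show ?thesis
      using p q ab cd nz_mult[OF p(2) q(2)] nz_mult[OF ab(2) cd(2)]
      by (subst fraction_eq_iff) (auto simp: psi_mult psi_add)
  qed
  have "fraction A a b \<oplus>\<^bsub>FF\<^esub> fraction A c d = (\<Union>p\<in>fraction A a b. \<Union>q\<in>fraction A c d.
      fraction A (fst p \<otimes>\<^bsub>A\<^esub> snd q \<oplus>\<^bsub>A\<^esub> fst q \<otimes>\<^bsub>A\<^esub> snd p) (snd p \<otimes>\<^bsub>A\<^esub> snd q))"
    by (simp add: fraction_field_def case_prod_unfold)
  also have "\<dots> = (\<Union>p\<in>fraction A a b. \<Union>q\<in>fraction A c d. ?r)" by (intro SUP_cong refl *)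
  also have "\<dots> = ?r" using fraction_self[OF ab] fraction_self[OF cd] by auto
  finally show ?thesis .
qed

lemma FF_one: "\<one>\<^bsub>FF\<^esub> = fraction A \<one>\<^bsub>A\<^esub> \<one>\<^bsub>A\<^esub>" and FF_zero: "\<zero>\<^bsub>FF\<^esub> = fraction A \<zero>\<^bsub>A\<^esub> \<one>\<^bsub>A\<^esub>"
  by (simp_all add: fraction_field_def)

text \<open>
  The embedding of the fraction field; any representative of the class may be chosen.
\<close>

definition \<theta> :: "('b \<times> 'b) set \<Rightarrow> 'a fract" where
  "\<theta> x = (let p = (SOME p. p \<in> x) in Fract (\<psi> (fst p)) (\<psi> (snd p)))"

lemma theta_fraction:
  assumes ab: "a \<in> carrier A" "b \<in> nz" shows "\<theta> (fraction A a b) = Fract (\<psi> a) (\<psi> b)"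
proof -
  define p where "p = (SOME p. p \<in> fraction A a b)"
  have "p \<in> fraction A a b" unfolding p_def by (rule someI[of _ "(a, b)"]) (rule fraction_self[OF ab])
  then have "fst p \<in> carrier A" "snd p \<in> nz" "\<psi> a * \<psi> (snd p) = \<psi> (fst p) * \<psi> b"
    using fraction_iff[OF ab] by auto
  then have "Fract (\<psi> (fst p)) (\<psi> (snd p)) = Fract (\<psi> a) (\<psi> b)"
    using ab(2) by (subst eq_fract(1)) (auto simp: nz_iff)
  then show ?thesis by (simp add: \<theta>_def Let_def flip: p_def)
qed

lemma inj_theta: "inj_on \<theta> (carrier FF)"
proof (rule inj_onI)
  fix x y assume x: "x \<in> carrier FF" and y: "y \<in> carrier FF" and e: "\<theta> x = \<theta> y"
  obtain a b where ab: "x = fraction A a b" "a \<in> carrier A" "b \<in> nz" using FF_cases[OF x] .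
  obtain c d where cd: "y = fraction A c d" "c \<in> carrier A" "d \<in> nz" using FF_cases[OF y] .
  have "Fract (\<psi> a) (\<psi> b) = Fract (\<psi> c) (\<psi> d)" using e ab cd by (simp only: theta_fraction)
  then have "\<psi> a * \<psi> d = \<psi> c * \<psi> b" using ab(3) cd(3) eq_fract(1)[of "\<psi> b" "\<psi> d"] by (auto simp: nz_iff)
  then show "x = y" using fraction_eq_iff[OF ab(2,3) cd(2,3)] ab(1) cd(1) by simp
qed

lemma theta_mult:
  assumes "x \<in> carrier FF" "y \<in> carrier FF"
  shows "x \<otimes>\<^bsub>FF\<^esub> y \<in> carrier FF" "\<theta> (x \<otimes>\<^bsub>FF\<^esub> y) = \<theta> x * \<theta> y"
proof -
  obtain a b where ab: "x = fraction A a b" "a \<in> carrier A" "b \<in> nz" using FF_cases[OF assms(1)] .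
  obtain c d where cd: "y = fraction A c d" "c \<in> carrier A" "d \<in> nz" using FF_cases[OF assms(2)] .
  have xy: "x \<otimes>\<^bsub>FF\<^esub> y = fraction A (a \<otimes>\<^bsub>A\<^esub> c) (b \<otimes>\<^bsub>A\<^esub> d)" using FF_mult ab cd by metis
  have m: "a \<otimes>\<^bsub>A\<^esub> c \<in> carrier A" "b \<otimes>\<^bsub>A\<^esub> d \<in> nz" using ab cd nz_mult by auto
  show "x \<otimes>\<^bsub>FF\<^esub> y \<in> carrier FF" unfolding xy by (rule fraction_in[OF m])
  have "\<theta> (x \<otimes>\<^bsub>FF\<^esub> y) = Fract (\<psi> (a \<otimes>\<^bsub>A\<^esub> c)) (\<psi> (b \<otimes>\<^bsub>A\<^esub> d))"
    unfolding xy by (rule theta_fraction[OF m])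
  then show "\<theta> (x \<otimes>\<^bsub>FF\<^esub> y) = \<theta> x * \<theta> y"
    using ab cd by (simp add: theta_fraction psi_mult)
qed

lemma theta_add:
  assumes "x \<in> carrier FF" "y \<in> carrier FF"
  shows "x \<oplus>\<^bsub>FF\<^esub> y \<in> carrier FF" "\<theta> (x \<oplus>\<^bsub>FF\<^esub> y) = \<theta> x + \<theta> y"
proof -
  obtain a b where ab: "x = fraction A a b" "a \<in> carrier A" "b \<in> nz" using FF_cases[OF assms(1)] .
  obtain c d where cd: "y = fraction A c d" "c \<in> carrier A" "d \<in> nz" using FF_cases[OF assms(2)] .
  have xy: "x \<oplus>\<^bsub>FF\<^esub> y = fraction A (a \<otimes>\<^bsub>A\<^esub> d \<oplus>\<^bsub>A\<^esub> c \<otimes>\<^bsub>A\<^esub> b) (b \<otimes>\<^bsub>A\<^esub> d)" using FF_add ab cd by metis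
  have m: "a \<otimes>\<^bsub>A\<^esub> d \<oplus>\<^bsub>A\<^esub> c \<otimes>\<^bsub>A\<^esub> b \<in> carrier A" "b \<otimes>\<^bsub>A\<^esub> d \<in> nz" using ab cd nz_mult by auto
  show "x \<oplus>\<^bsub>FF\<^esub> y \<in> carrier FF" unfolding xy by (rule fraction_in[OF m])
  have "\<psi> b \<noteq> 0" "\<psi> d \<noteq> 0" using ab cd by (auto simp: nz_iff)
  moreover have "\<theta> (x \<oplus>\<^bsub>FF\<^esub> y) = Fract (\<psi> (a \<otimes>\<^bsub>A\<^esub> d \<oplus>\<^bsub>A\<^esub> c \<otimes>\<^bsub>A\<^esub> b)) (\<psi> (b \<otimes>\<^bsub>A\<^esub> d))"
    unfolding xy by (rule theta_fraction[OF m])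
  ultimately show "\<theta> (x \<oplus>\<^bsub>FF\<^esub> y) = \<theta> x + \<theta> y"
    using ab cd by (simp add: theta_fraction psi_mult psi_add)
qed

lemma theta_one: "\<one>\<^bsub>FF\<^esub> \<in> carrier FF" "\<theta> \<one>\<^bsub>FF\<^esub> = 1"
  unfolding FF_one by (simp_all only: fraction_in nz_one A.one_closed theta_fraction psi_one One_fract_def)

lemma theta_zero: "\<zero>\<^bsub>FF\<^esub> \<in> carrier FF" "\<theta> \<zero>\<^bsub>FF\<^esub> = 0"
  unfolding FF_zero by (simp_all only: fraction_in nz_one A.zero_closed theta_fraction psi_zero psi_one Zero_fract_def)

lemma cring_FF: "cring FF"
proof (rule cring_by_embedding[OF inj_theta])
  fix x assume "x \<in> carrier FF"
  then obtain a b where ab: "x = fraction A a b" "a \<in> carrier A" "b \<in> nz" by (rule FF_cases)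
  have m: "\<ominus>\<^bsub>A\<^esub> a \<in> carrier A" using ab by simp
  have "\<theta> (fraction A (\<ominus>\<^bsub>A\<^esub> a) b) = - \<theta> x"
    unfolding theta_fraction[OF m ab(3)] ab(1) theta_fraction[OF ab(2,3)] using ab(2) by (simp add: psi_minus)
  then show "\<exists>y\<in>carrier FF. \<theta> y = - \<theta> x" using fraction_in[OF m ab(3)] by blast
qed (auto simp: theta_add theta_mult theta_one theta_zero)

sublocale FF: cring FF by (rule cring_FF)

lemma theta_zero_iff: "x \<in> carrier FF \<Longrightarrow> \<theta> x = 0 \<longleftrightarrow> x = \<zero>\<^bsub>FF\<^esub>"
  using inj_onD[OF inj_theta, of x "\<zero>\<^bsub>FF\<^esub>"] theta_zero by auto

text \<open>
  Both inverses send zero to zero.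
\<close>

lemma theta_inverse:
  assumes x: "x \<in> carrier FF"
  shows "field_inverse FF x \<in> carrier FF" "\<theta> (field_inverse FF x) = inverse (\<theta> x)"
proof -
  have "field_inverse FF x \<in> carrier FF \<and> \<theta> (field_inverse FF x) = inverse (\<theta> x)"
  proof (cases "x = \<zero>\<^bsub>FF\<^esub>")
    case True
    then show ?thesis by (simp add: field_inverse_def theta_zero)
  next
    case False
    obtain a b where ab: "x = fraction A a b" "a \<in> carrier A" "b \<in> nz" using FF_cases[OF x] .
    have "\<theta> x \<noteq> 0" using False theta_zero_iff[OF x] by simp
    then have "\<psi> a \<noteq> 0" unfolding ab(1) theta_fraction[OF ab(2,3)] by (auto simp: fract_collapse)
    then have a: "a \<in> nz" using ab(2) by (simp add: nz_iff)
    have b: "b \<in> carrier A" using ab(3) by simp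
    have y: "fraction A b a \<in> carrier FF" by (rule fraction_in[OF b a])
    have ty: "\<theta> (fraction A b a) = inverse (\<theta> x)"
      unfolding theta_fraction[OF b a] ab(1) theta_fraction[OF ab(2,3)] by simp
    have "x \<otimes>\<^bsub>FF\<^esub> fraction A b a = \<one>\<^bsub>FF\<^esub>"
      by (rule inj_onD[OF inj_theta]) (use \<open>\<theta> x \<noteq> 0\<close> in \<open>simp_all add: theta_mult x y ty theta_one\<close>)
    then have "inv\<^bsub>FF\<^esub> x = fraction A b a" using FF.comm_inv_char[OF x y] by simp
    then show ?thesis using False y ty by (simp add: field_inverse_def)
  qed
  then show "field_inverse FF x \<in> carrier FF" "\<theta> (field_inverse FF x) = inverse (\<theta> x)" by auto
qed

end

section \<open>The action on polynomials\<close>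

lemma evaluation_image:
  fixes w :: "'l \<Rightarrow> 'l"
  shows "evaluation (pconst :: 'r::comm_ring_1 \<Rightarrow> ('r, 'l) polynomials)
    (\<lambda>m. Poly_Mapping.single (image_mset w m) 1)"
  by unfold_locales (simp_all add: pconst_add pconst_mult pconst_one mult_single flip: zero_multiset_def)

lemma poly_action_eval_poly: "poly_action w p = eval_poly pconst (\<lambda>m. Poly_Mapping.single (image_mset w m) 1) p"
  by (simp add: poly_action_def eval_poly_def pconst_def mult_single)

lemmas poly_action_simps =
  evaluation.eval_poly_add[OF evaluation_image, folded poly_action_eval_poly]
  evaluation.eval_poly_mult[OF evaluation_image, folded poly_action_eval_poly]
  evaluation.eval_poly_one[OF evaluation_image, folded poly_action_eval_poly]
  evaluation.eval_poly_zero[OF evaluation_image, folded poly_action_eval_poly]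
  evaluation.eval_poly_diff[OF evaluation_image, folded poly_action_eval_poly]
  evaluation.eval_poly_sum[OF evaluation_image, folded poly_action_eval_poly]
  evaluation.eval_poly_power[OF evaluation_image, folded poly_action_eval_poly]
  evaluation.eval_poly_pconst[OF evaluation_image, folded poly_action_eval_poly]

lemma poly_action_pvar: "poly_action w (pvar l) = pvar (w l)"
  using evaluation.eval_poly_pvar[OF evaluation_image, of w l] by (simp add: poly_action_eval_poly pvar_def)

lemma poly_action_single: "poly_action w (Poly_Mapping.single m r) = Poly_Mapping.single (image_mset w m) r"
  using evaluation.eval_poly_single[OF evaluation_image, of w m r]
  by (simp add: poly_action_eval_poly pconst_def mult_single)

lemma poly_action_comp: "poly_action v (poly_action w p) = poly_action (v \<circ> w) p"
  unfolding poly_action_def[of w] poly_action_def[of "v \<circ> w"]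
  by (simp add: poly_action_simps poly_action_single multiset.map_comp)

lemma poly_action_id: "poly_action id p = p"
  by (simp add: poly_action_def poly_monomials)

lemma poly_action_deg_ge: "p \<in> deg_ge n \<Longrightarrow> poly_action w p \<in> deg_ge n"
  unfolding poly_action_def by (intro deg_ge_sum) (auto simp: deg_ge_def)

lemma poly_action_fpart: "poly_action w (fpart pconst F n x y) = fpart pconst F n (poly_action w x) (poly_action w y)"
  by (simp add: fpart_def poly_action_simps)

lemma inverse_comp: "bij w \<Longrightarrow> inv_into UNIV w \<circ> w = id" "bij w \<Longrightarrow> w \<circ> inv_into UNIV w = id"
  by (auto simp: bij_is_inj bij_is_surj surj_iff[symmetric])

text \<open>
  The action is defined by taking images of cosets; that such an image is a whole coset uses the
  inverse of w.
\<close>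

lemma poly_action_coset:
  assumes "bij w" shows "poly_action w ` coset n p = coset n (poly_action w p)"
proof (intro equalityI subsetI)
  fix q assume "q \<in> poly_action w ` coset n p"
  then obtain r where "q = poly_action w r" "r - p \<in> deg_ge n" by (auto simp: coset_def)
  then show "q \<in> coset n (poly_action w p)"
    using poly_action_deg_ge[of "r - p" n w] by (simp add: coset_def poly_action_simps)
next
  fix q assume "q \<in> coset n (poly_action w p)"
  then have "poly_action (inv_into UNIV w) (q - poly_action w p) \<in> deg_ge n"
    by (intro poly_action_deg_ge) (simp add: coset_def)
  then have "poly_action (inv_into UNIV w) q \<in> coset n p"
    by (simp add: coset_def poly_action_simps poly_action_comp inverse_comp[OF assms] poly_action_id)
  moreover have "q = poly_action w (poly_action (inv_into UNIV w) q)"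
    by (simp add: poly_action_comp inverse_comp[OF assms] poly_action_id)
  ultimately show "q \<in> poly_action w ` coset n p" by blast
qed

lemma series_action_ser: "bij w \<Longrightarrow> series_action w (ser p) = ser (\<lambda>n. poly_action w (p n))"
  by (simp add: series_action_def ser_def poly_action_coset)

lemma coherent_action: "coherent p \<Longrightarrow> coherent (\<lambda>n. poly_action w (p n))"
  unfolding coherent_def poly_action_simps(5)[symmetric] by (simp add: poly_action_deg_ge)

lemma series_action_comp: "series_action v (series_action w x) = series_action (v \<circ> w) x"
  by (simp add: series_action_def image_image poly_action_comp)

lemma series_action_id: "series_action id x = x"
  by (simp add: series_action_def poly_action_id)

lemma series_action_closed: "bij w \<Longrightarrow> x \<in> carrier series_ring \<Longrightarrow> series_action w x \<in> carrier series_ring"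
  by (auto elim!: series_cases simp: series_action_ser intro!: ser_in coherent_action)

lemma series_action_hom: assumes "bij w"
  shows "ring_hom_ring series_ring series_ring
    (series_action w :: ('r::comm_ring_1, 'l) series \<Rightarrow> ('r, 'l) series)"
proof (rule ring_hom_ringI2)
  show "ring (series_ring :: ('r, 'l) series ring)" using cring_series_ring cring.axioms(1) by blast
  then show "ring (series_ring :: ('r, 'l) series ring)" .
  show "series_action w \<in> ring_hom series_ring (series_ring :: ('r, 'l) series ring)"
    by (rule ring_hom_memI)
       (auto simp: series_action_closed assms elim!: series_cases,
        auto simp: series_simps series_action_ser assms poly_action_simps)
qed

lemma fga_action_comp: "fga_action v (fga_action w x) = fga_action (v \<circ> w) x"
  by (simp add: fga_action_def image_image series_action_comp)

lemma fga_action_id: "fga_action id x = x"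
  by (simp add: fga_action_def series_action_id)

lemma frac_action_comp: "frac_action v (frac_action w x) = frac_action (v \<circ> w) x"
  by (simp add: frac_action_def image_image map_prod_def fga_action_comp case_prod_unfold)

lemma frac_action_id: "frac_action id x = x"
  by (simp add: frac_action_def map_prod_def fga_action_id)

section \<open>The action on the formal group algebra\<close>

context fga_basis
begin

abbreviation FA :: "('r, 'l) fga ring" where "FA \<equiv> formal_group_algebra F"

definition fga_embed :: "('r, 'l) fga \<Rightarrow> 'r scalars fps" where "fga_embed X = the_elem (se.seval ` X)"

abbreviation FI :: "('r, 'l) series set" where "FI \<equiv> fga_ideal F"

lemma ideal_FI: "ideal FI (series_ring :: ('r, 'l) series ring)"
  unfolding fga_ideal_kernel by (rule ring_hom_ring.kernel_is_ideal[OF seval_ring_hom])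

lemma embedded_FA: "embedded_ring FA fga_embed"
proof -
  interpret h: ring_hom_ring "series_ring :: ('r, 'l) series ring" type_ring se.seval by (rule seval_ring_hom)
  have FA: "FA = series_ring Quot a_kernel series_ring type_ring se.seval"
    unfolding formal_group_algebra_def fga_ideal_kernel ..
  have hom: "fga_embed \<in> ring_hom FA type_ring"
    unfolding FA fga_embed_def using h.the_elem_hom .
  show ?thesis
  proof (rule embedded_ring.intro)
    show "cring FA" unfolding formal_group_algebra_def
      by (rule ideal.quotient_is_cring[OF ideal_FI cring_series_ring])
    show "inj_on fga_embed (carrier FA)"
      unfolding FA fga_embed_def by (rule inj_onI) (rule h.the_elem_inj)
    fix x y assume "x \<in> carrier FA" "y \<in> carrier FA"
    then show "fga_embed (x \<oplus>\<^bsub>FA\<^esub> y) = fga_embed x + fga_embed y" "fga_embed (x \<otimes>\<^bsub>FA\<^esub> y) = fga_embed x * fga_embed y"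
      using ring_hom_add[OF hom] ring_hom_mult[OF hom] by auto
  next
    show "fga_embed \<one>\<^bsub>FA\<^esub> = 1" using ring_hom_one[OF hom] by simp
  qed
qed

sublocale em: embedded_ring FA fga_embed by (rule embedded_FA)

abbreviation fga_class :: "('r, 'l) series \<Rightarrow> ('r, 'l) fga" where "fga_class s \<equiv> FI +>\<^bsub>series_ring\<^esub> s"

lemma fga_class_hom: "fga_class \<in> ring_hom series_ring FA"
  unfolding formal_group_algebra_def by (rule ideal.rcos_ring_hom[OF ideal_FI])

lemma fga_class_cases: assumes "X \<in> carrier FA" obtains s where "X = fga_class s" "s \<in> carrier series_ring"
  using assms by (auto simp: formal_group_algebra_def FactRing_def A_RCOSETS_def')

lemma fga_class_in: "s \<in> carrier series_ring \<Longrightarrow> fga_class s \<in> carrier FA"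
  using ring_hom_closed[OF fga_class_hom] .

definition acting :: "('l \<Rightarrow> 'l) \<Rightarrow> bool" where "acting w \<longleftrightarrow> bij w \<and> additive w"

lemma acting_inv: assumes "acting w" shows "acting (inv_into UNIV w)"
proof -
  have b: "bij w" and a: "additive w" using assms by (auto simp: acting_def)
  have "inv_into UNIV w (x + y) = inv_into UNIV w x + inv_into UNIV w y" for x y
    using bij_inv_eq_iff[OF b] additive.add[OF a] surj_f_inv_f[OF bij_is_surj[OF b]] by metis
  then show ?thesis using bij_imp_bij_inv[OF b] by (simp add: acting_def additive_def)
qed

lemma series_action_svar: "bij w \<Longrightarrow> series_action w (svar l) = svar (w l)"
  by (simp add: svar_ser series_action_ser poly_action_pvar)

lemma series_action_rel_ideal: assumes w: "acting w" and s: "s \<in> rel_ideal" shows "series_action w s \<in> rel_ideal"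
proof -
  have b: "bij w" and a: "additive w" using w by (auto simp: acting_def)
  interpret h: ring_hom_ring "series_ring :: ('r, 'l) series ring" series_ring "series_action w"
    by (rule series_action_hom[OF b])
  let ?V = "{s \<in> carrier series_ring. series_action w s \<in> rel_ideal}"
  have "fga_relations F \<subseteq> ?V"
  proof
    fix x :: "('r, 'l) series" assume x: "x \<in> fga_relations F"
    have xc: "x \<in> carrier series_ring" using relations_in_series x by blast
    have "x = svar 0 \<or> (\<exists>l m. x = ser (\<lambda>n. pvar (l + m) - fpart pconst F n (pvar l) (pvar m)))"
      using x unfolding fga_relations_def fga_rel_ser by blast
    then have "series_action w x \<in> rel_ideal"
    proof
      assume "x = svar 0"
      then show ?thesis using rel_ideal_generators(1) additive.zero[OF a] by (simp add: series_action_svar b)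
    next
      assume "\<exists>l m. x = ser (\<lambda>n. pvar (l + m) - fpart pconst F n (pvar l) (pvar m))"
      then obtain l m where "x = ser (\<lambda>n. pvar (l + m) - fpart pconst F n (pvar l) (pvar m))" by blast
      then have "series_action w x = ser (\<lambda>n. pvar (w l + w m) - fpart pconst F n (pvar (w l)) (pvar (w m)))"
        by (simp add: series_action_ser b poly_action_simps poly_action_fpart poly_action_pvar additive.add[OF a])
      then show ?thesis using rel_ideal_generators(2) by simp
    qed
    then show "x \<in> ?V" using xc by simp
  qed
  from ring.genideal_minimal[OF cring.axioms(1)[OF cring_series_ring] h.ideal_vimage[OF ideal_rel_ideal] this]
  have "rel_ideal \<subseteq> ?V" unfolding rel_ideal_def[symmetric] .
  then show ?thesis using s by blast
qed

text \<open>
  The closure is defined by equality of components, and the action works on each component.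
\<close>

lemma series_action_FI: assumes w: "acting w" and s: "s \<in> FI" shows "series_action w s \<in> FI"
proof -
  have sc: "s \<in> carrier series_ring" and t: "\<And>n. \<exists>t\<in>rel_ideal. t n = s n" using s by (auto simp: fga_ideal_eq)
  have "\<exists>t\<in>rel_ideal. t n = series_action w s n" for n
  proof -
    obtain t where "t \<in> rel_ideal" "t n = s n" using t by blast
    then show ?thesis using series_action_rel_ideal[OF w]
      by (intro bexI[of _ "series_action w t"]) (auto simp: series_action_def)
  qed
  moreover have "series_action w s \<in> carrier series_ring"
    using series_action_closed[OF _ sc] w by (simp add: acting_def)
  ultimately show ?thesis by (simp add: fga_ideal_eq)
qed

lemma series_action_image_FI: assumes w: "acting w" shows "series_action w ` FI = FI"
proof (intro equalityI subsetI)
  fix s :: "('r, 'l) series" assume s: "s \<in> FI"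
  have "s = series_action w (series_action (inv_into UNIV w) s)"
    using w by (simp add: series_action_comp inverse_comp acting_def series_action_id)
  then show "s \<in> series_action w ` FI" using series_action_FI[OF acting_inv[OF w] s] by blast
qed (auto simp: series_action_FI[OF w])

lemma fga_action_class:
  assumes w: "acting w" and s: "s \<in> carrier series_ring"
  shows "fga_action w (fga_class s) = fga_class (series_action w s)"
proof -
  have b: "bij w" using w by (simp add: acting_def)
  interpret h: ring_hom_ring "series_ring :: ('r, 'l) series ring" series_ring "series_action w"
    by (rule series_action_hom[OF b])
  have "fga_action w (fga_class s) = (\<lambda>h. series_action w (h \<oplus>\<^bsub>series_ring\<^esub> s)) ` FI"
    by (auto simp: fga_action_def a_r_coset_def r_coset_def)
  also have "\<dots> = (\<lambda>h. series_action w h \<oplus>\<^bsub>series_ring\<^esub> series_action w s) ` FI"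
    using ideal.Icarr[OF ideal_FI] by (intro image_cong refl h.hom_add s) auto
  also have "\<dots> = (\<lambda>h. h \<oplus>\<^bsub>series_ring\<^esub> series_action w s) ` (series_action w ` FI)"
    by (simp add: image_image)
  also have "\<dots> = fga_class (series_action w s)"
    unfolding series_action_image_FI[OF w] by (auto simp: a_r_coset_def r_coset_def)
  finally show ?thesis .
qed

lemma fga_action_hom:
  assumes w: "acting w" and X: "X \<in> carrier FA" and Y: "Y \<in> carrier FA"
  shows "fga_action w X \<in> carrier FA"
    "fga_action w (X \<otimes>\<^bsub>FA\<^esub> Y) = fga_action w X \<otimes>\<^bsub>FA\<^esub> fga_action w Y"
    "fga_action w (X \<oplus>\<^bsub>FA\<^esub> Y) = fga_action w X \<oplus>\<^bsub>FA\<^esub> fga_action w Y"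
proof -
  have b: "bij w" using w by (simp add: acting_def)
  interpret h: ring_hom_ring "series_ring :: ('r, 'l) series ring" series_ring "series_action w"
    by (rule series_action_hom[OF b])
  obtain s where s: "X = fga_class s" "s \<in> carrier series_ring" using fga_class_cases[OF X] .
  obtain t where t: "Y = fga_class t" "t \<in> carrier series_ring" using fga_class_cases[OF Y] .
  note ws = series_action_closed[OF b s(2)] and wt = series_action_closed[OF b t(2)]
  show "fga_action w X \<in> carrier FA" unfolding s(1) fga_action_class[OF w s(2)] by (rule fga_class_in[OF ws])
  show "fga_action w (X \<otimes>\<^bsub>FA\<^esub> Y) = fga_action w X \<otimes>\<^bsub>FA\<^esub> fga_action w Y"
    unfolding s(1) t(1) fga_action_class[OF w s(2)] fga_action_class[OF w t(2)]
      ring_hom_mult[OF fga_class_hom s(2) t(2), symmetric] ring_hom_mult[OF fga_class_hom ws wt, symmetric]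
    using s(2) t(2) by (subst fga_action_class[OF w]) simp_all
  show "fga_action w (X \<oplus>\<^bsub>FA\<^esub> Y) = fga_action w X \<oplus>\<^bsub>FA\<^esub> fga_action w Y"
    unfolding s(1) t(1) fga_action_class[OF w s(2)] fga_action_class[OF w t(2)]
      ring_hom_add[OF fga_class_hom s(2) t(2), symmetric] ring_hom_add[OF fga_class_hom ws wt, symmetric]
    using s(2) t(2) by (subst fga_action_class[OF w]) simp_all
qed

lemma fga_action_inverse: "acting w \<Longrightarrow> fga_action (inv_into UNIV w) (fga_action w X) = X"
  "acting w \<Longrightarrow> fga_action w (fga_action (inv_into UNIV w) X) = X"
  by (simp_all add: fga_action_comp inverse_comp acting_def fga_action_id)

lemma fga_action_zero_one:
  assumes w: "acting w"
  shows "fga_action w \<zero>\<^bsub>FA\<^esub> = \<zero>\<^bsub>FA\<^esub>" "fga_action w \<one>\<^bsub>FA\<^esub> = \<one>\<^bsub>FA\<^esub>"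
proof -
  have b: "bij w" using w by (simp add: acting_def)
  interpret h: ring_hom_ring "series_ring :: ('r, 'l) series ring" series_ring "series_action w"
    by (rule series_action_hom[OF b])
  show "fga_action w \<one>\<^bsub>FA\<^esub> = \<one>\<^bsub>FA\<^esub>"
    using fga_action_class[OF w, of "\<one>\<^bsub>series_ring\<^esub>"] ring_hom_one[OF fga_class_hom] by simp
  have z: "fga_action w \<zero>\<^bsub>FA\<^esub> \<in> carrier FA" using fga_action_hom(1)[OF w em.A.zero_closed em.A.zero_closed] .
  have "fga_action w \<zero>\<^bsub>FA\<^esub> \<oplus>\<^bsub>FA\<^esub> fga_action w \<zero>\<^bsub>FA\<^esub> = fga_action w \<zero>\<^bsub>FA\<^esub>"
    using fga_action_hom(3)[OF w em.A.zero_closed em.A.zero_closed] by simp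
  then show "fga_action w \<zero>\<^bsub>FA\<^esub> = \<zero>\<^bsub>FA\<^esub>" using em.A.add.l_cancel_one[OF z z] by simp
qed

lemma fga_action_nz: assumes w: "acting w" and X: "X \<in> em.nz" shows "fga_action w X \<in> em.nz"
proof -
  have "fga_action w X \<noteq> \<zero>\<^bsub>FA\<^esub>"
  proof
    assume "fga_action w X = \<zero>\<^bsub>FA\<^esub>"
    then have "X = \<zero>\<^bsub>FA\<^esub>"
      using fga_action_inverse(1)[OF w, of X] fga_action_zero_one(1)[OF acting_inv[OF w]] by simp
    then show False using X by (simp add: em.nz_def)
  qed
  then show ?thesis using fga_action_hom(1)[OF w em.nz_carrier[OF X] em.nz_carrier[OF X]] by (simp add: em.nz_def)
qed

section \<open>The action on fractions\<close>

lemma frac_action_fraction_subset: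
  assumes w: "acting w" and a: "a \<in> carrier FA" and b: "b \<in> em.nz"
  shows "frac_action w (fraction FA a b) \<subseteq> fraction FA (fga_action w a) (fga_action w b)"
proof
  fix p assume "p \<in> frac_action w (fraction FA a b)"
  then obtain c d where cd: "(c, d) \<in> fraction FA a b" and p: "p = (fga_action w c, fga_action w d)"
    by (auto simp: frac_action_def)
  have c: "c \<in> carrier FA" "d \<in> em.nz" "fga_embed a * fga_embed d = fga_embed c * fga_embed b"
    using cd em.fraction_iff[OF a b] by auto
  have d: "d \<in> carrier FA" "b \<in> carrier FA" using c(2) b by simp_all
  have "a \<otimes>\<^bsub>FA\<^esub> d = c \<otimes>\<^bsub>FA\<^esub> b"
    using c a d by (subst em.psi_eq_iff) (auto simp: em.psi_mult)
  then have "fga_action w a \<otimes>\<^bsub>FA\<^esub> fga_action w d = fga_action w c \<otimes>\<^bsub>FA\<^esub> fga_action w b"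
    using fga_action_hom(2)[OF w] a c(1) d by metis
  then have "fga_embed (fga_action w a) * fga_embed (fga_action w d) = fga_embed (fga_action w c) * fga_embed (fga_action w b)"
    using em.psi_mult fga_action_hom(1)[OF w] a c(1) d by metis
  then show "p \<in> fraction FA (fga_action w a) (fga_action w b)"
    using fga_action_hom(1)[OF w] fga_action_nz[OF w] a b c
    by (subst em.fraction_iff) (auto simp: p)
qed

lemma frac_action_fraction:
  assumes w: "acting w" and a: "a \<in> carrier FA" and b: "b \<in> em.nz"
  shows "frac_action w (fraction FA a b) = fraction FA (fga_action w a) (fga_action w b)"
proof
  let ?v = "inv_into UNIV w"
  have wa: "fga_action w a \<in> carrier FA" "fga_action w b \<in> em.nz"
    using fga_action_hom(1)[OF w a a] fga_action_nz[OF w b] .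
  have "frac_action ?v (fraction FA (fga_action w a) (fga_action w b)) \<subseteq> fraction FA a b"
    using frac_action_fraction_subset[OF acting_inv[OF w] wa] by (simp only: fga_action_inverse(1)[OF w])
  then have "frac_action w (frac_action ?v (fraction FA (fga_action w a) (fga_action w b)))
      \<subseteq> frac_action w (fraction FA a b)"
    unfolding frac_action_def[of w] by (rule image_mono)
  then show "fraction FA (fga_action w a) (fga_action w b) \<subseteq> frac_action w (fraction FA a b)"
    using w by (simp add: frac_action_comp inverse_comp acting_def frac_action_id)
qed (rule frac_action_fraction_subset[OF assms])

abbreviation FR :: "('r, 'l) fga_frac ring" where "FR \<equiv> fga_fraction_field F"

lemma FR_eq: "FR = em.FF" by (simp add: fga_fraction_field_def)

lemma frac_action_hom:
  assumes w: "acting w" and x: "x \<in> carrier FR" and y: "y \<in> carrier FR"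
  shows "frac_action w x \<in> carrier FR"
    "frac_action w (x \<otimes>\<^bsub>FR\<^esub> y) = frac_action w x \<otimes>\<^bsub>FR\<^esub> frac_action w y"
    "frac_action w (x \<oplus>\<^bsub>FR\<^esub> y) = frac_action w x \<oplus>\<^bsub>FR\<^esub> frac_action w y"
proof -
  obtain a b where ab: "x = fraction FA a b" "a \<in> carrier FA" "b \<in> em.nz"
    using em.FF_cases[OF x[unfolded FR_eq]] .
  obtain c d where cd: "y = fraction FA c d" "c \<in> carrier FA" "d \<in> em.nz"
    using em.FF_cases[OF y[unfolded FR_eq]] .
  note fw = frac_action_fraction[OF w] and hw = fga_action_hom[OF w]
  have b: "b \<in> carrier FA" "d \<in> carrier FA" using ab cd by simp_all
  have wab: "fga_action w a \<in> carrier FA" "fga_action w b \<in> em.nz"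
    and wcd: "fga_action w c \<in> carrier FA" "fga_action w d \<in> em.nz"
    using hw(1) fga_action_nz[OF w] ab cd by auto
  show "frac_action w x \<in> carrier FR"
    unfolding ab(1) fw[OF ab(2,3)] FR_eq by (rule em.fraction_in[OF wab])
  show "frac_action w (x \<otimes>\<^bsub>FR\<^esub> y) = frac_action w x \<otimes>\<^bsub>FR\<^esub> frac_action w y"
    unfolding ab(1) cd(1) FR_eq em.FF_mult[OF ab(2,3) cd(2,3)] fw[OF ab(2,3)] fw[OF cd(2,3)]
      em.FF_mult[OF wab wcd] hw(2)[OF ab(2) cd(2), symmetric] hw(2)[OF b, symmetric]
    by (rule fw[OF em.A.m_closed[OF ab(2) cd(2)] em.nz_mult[OF ab(3) cd(3)]])
  show "frac_action w (x \<oplus>\<^bsub>FR\<^esub> y) = frac_action w x \<oplus>\<^bsub>FR\<^esub> frac_action w y"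
    unfolding ab(1) cd(1) FR_eq em.FF_add[OF ab(2,3) cd(2,3)] fw[OF ab(2,3)] fw[OF cd(2,3)]
      em.FF_add[OF wab wcd] hw(2)[OF ab(2) b(2), symmetric] hw(2)[OF cd(2) b(1), symmetric] hw(2)[OF b, symmetric]
      hw(3)[OF em.A.m_closed[OF ab(2) b(2)] em.A.m_closed[OF cd(2) b(1)], symmetric]
    by (rule fw) (use ab cd b em.nz_mult in auto)
qed

lemma frac_action_zero_one:
  assumes w: "acting w"
  shows "frac_action w \<zero>\<^bsub>FR\<^esub> = \<zero>\<^bsub>FR\<^esub>" "frac_action w \<one>\<^bsub>FR\<^esub> = \<one>\<^bsub>FR\<^esub>"
  unfolding FR_eq em.FF_zero em.FF_one
  by (simp_all only: frac_action_fraction[OF w] em.A.zero_closed em.A.one_closed em.nz_one fga_action_zero_one[OF w])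

lemma frac_action_inverse: "acting w \<Longrightarrow> frac_action (inv_into UNIV w) (frac_action w X) = X"
  by (simp add: frac_action_comp inverse_comp acting_def frac_action_id)

lemma frac_action_minus: assumes w: "acting w" and x: "x \<in> carrier FR"
  shows "frac_action w (\<ominus>\<^bsub>FR\<^esub> x) = \<ominus>\<^bsub>FR\<^esub> frac_action w x"
proof -
  interpret FR: cring FR unfolding FR_eq by (rule em.cring_FF)
  have "frac_action w x \<oplus>\<^bsub>FR\<^esub> frac_action w (\<ominus>\<^bsub>FR\<^esub> x) = \<zero>\<^bsub>FR\<^esub>"
    using frac_action_hom(3)[OF w x FR.a_inv_closed[OF x]] frac_action_zero_one(1)[OF w] x by (simp add: FR.r_neg)
  then show ?thesis
    using FR.minus_equality[of "frac_action w (\<ominus>\<^bsub>FR\<^esub> x)" "frac_action w x"] frac_action_hom(1)[OF w] x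
    by (simp add: FR.a_comm)
qed

lemma field_inverse_cases: assumes "x \<in> carrier FR" "x \<noteq> \<zero>\<^bsub>FR\<^esub>"
  shows "field_inverse FR x \<in> carrier FR" "x \<otimes>\<^bsub>FR\<^esub> field_inverse FR x = \<one>\<^bsub>FR\<^esub>"
proof -
  have "em.\<theta> x \<noteq> 0" using em.theta_zero_iff assms by (simp add: FR_eq)
  have x: "x \<in> carrier em.FF" and basis_index: "field_inverse em.FF x \<in> carrier em.FF"
    using assms em.theta_inverse(1) by (simp_all add: FR_eq)
  show "field_inverse FR x \<in> carrier FR" using basis_index by (simp add: FR_eq)
  show "x \<otimes>\<^bsub>FR\<^esub> field_inverse FR x = \<one>\<^bsub>FR\<^esub>"
    unfolding FR_eq
    by (rule inj_onD[OF em.inj_theta])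
       (simp_all add: em.theta_mult[OF x basis_index] em.theta_inverse[OF x] em.theta_one \<open>em.\<theta> x \<noteq> 0\<close>)
qed

lemma frac_action_field_inverse: assumes w: "acting w" and x: "x \<in> carrier FR"
  shows "frac_action w (field_inverse FR x) = field_inverse FR (frac_action w x)"
proof (cases "x = \<zero>\<^bsub>FR\<^esub>")
  case True
  then show ?thesis by (simp add: field_inverse_def frac_action_zero_one[OF w])
next
  case False
  interpret FR: cring FR unfolding FR_eq by (rule em.cring_FF)
  have wx: "frac_action w x \<in> carrier FR" using frac_action_hom(1)[OF w x x] .
  have nz: "frac_action w x \<noteq> \<zero>\<^bsub>FR\<^esub>"
  proof
    assume "frac_action w x = \<zero>\<^bsub>FR\<^esub>"
    then show False using frac_action_inverse[OF w, of x] frac_action_zero_one(1)[OF acting_inv[OF w]] False by simp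
  qed
  note basis_index = field_inverse_cases[OF x False]
  have "frac_action w x \<otimes>\<^bsub>FR\<^esub> frac_action w (field_inverse FR x) = \<one>\<^bsub>FR\<^esub>"
    using frac_action_hom(2)[OF w x basis_index(1)] basis_index(2) frac_action_zero_one(2)[OF w] by simp
  then have "inv\<^bsub>FR\<^esub> (frac_action w x) = frac_action w (field_inverse FR x)"
    using FR.comm_inv_char[OF wx frac_action_hom(1)[OF w basis_index(1) basis_index(1)]] by simp
  then show ?thesis using nz by (simp add: field_inverse_def)
qed

section \<open>The elements x and their inverses\<close>

lemma var_in: "fga_var F l \<in> carrier FA"
  unfolding fga_var_def by (rule fga_class_in) (simp add: svar_ser ser_in coherent_const)

lemma to_frac_in: "a \<in> carrier FA \<Longrightarrow> to_frac F a \<in> carrier FR"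
  unfolding to_frac_def FR_eq by (rule em.fraction_in[OF _ em.nz_one])

lemma xvar_in: "xvar F l \<in> carrier FR"
  unfolding xvar_def by (rule to_frac_in[OF var_in])

lemma frac_action_to_frac: "acting w \<Longrightarrow> a \<in> carrier FA \<Longrightarrow> frac_action w (to_frac F a) = to_frac F (fga_action w a)"
  unfolding to_frac_def by (simp only: frac_action_fraction em.nz_one fga_action_zero_one)

lemma frac_action_xvar: assumes w: "acting w" shows "frac_action w (xvar F l) = xvar F (w l)"
proof -
  have "fga_action w (fga_var F l) = fga_var F (w l)"
    unfolding fga_var_def using w
    by (subst fga_action_class[OF w]) (auto simp: svar_ser ser_in coherent_const series_action_ser poly_action_pvar acting_def)
  then show ?thesis unfolding xvar_def by (simp add: frac_action_to_frac[OF w var_in])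
qed

abbreviation xprod :: "'l list \<Rightarrow> ('r, 'l) fga_frac" where
  "xprod ls \<equiv> foldr (\<lambda>l y. xvar F l \<otimes>\<^bsub>FR\<^esub> y) ls \<one>\<^bsub>FR\<^esub>"

lemma xprod_in: "xprod ls \<in> carrier FR"
  by (induction ls) (use em.theta_one(1) em.theta_mult(1) xvar_in in \<open>auto simp: FR_eq\<close>)

lemma xrecip_in: "xrecip F ls \<in> carrier FR"
  unfolding xrecip_def using em.theta_inverse(1) xprod_in by (simp add: FR_eq)

lemma frac_action_xrecip: assumes w: "acting w" shows "frac_action w (xrecip F ls) = xrecip F (map w ls)"
proof -
  have "frac_action w (xprod ls) = xprod (map w ls)"
    by (induction ls)
       (use frac_action_hom(2)[OF w xvar_in xprod_in] frac_action_zero_one(2)[OF w] frac_action_xvar[OF w] in auto)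
  then show ?thesis unfolding xrecip_def using frac_action_field_inverse[OF w xprod_in] by simp
qed

text \<open>
  The reciprocals in terms of which all coefficients are polynomials.
\<close>

definition xinv :: "'l \<Rightarrow> 'r scalars fps fract" where "xinv l = em.\<theta> (xrecip F [l])"

lemma theta_xrecip: "em.\<theta> (xrecip F ls) = prod_list (map xinv ls)"
proof -
  have "em.\<theta> (xprod ls) = prod_list (map (\<lambda>l. em.\<theta> (xvar F l)) ls)" for ls
    by (induction ls) (use em.theta_one(2) em.theta_mult(2) xvar_in xprod_in in \<open>auto simp: FR_eq\<close>)
  then have e: "em.\<theta> (xrecip F ls) = inverse (prod_list (map (\<lambda>l. em.\<theta> (xvar F l)) ls))" for ls
    unfolding xrecip_def using em.theta_inverse(2) xprod_in by (simp add: FR_eq)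
  have xinv: "xinv l = inverse (em.\<theta> (xvar F l))" for l using e[of "[l]"] by (simp add: xinv_def)
  show ?thesis unfolding e by (induction ls) (simp_all add: xinv inverse_mult_distrib)
qed

end

section \<open>The ring Q\<close>

locale twisted_fga = fga_basis F B + reduced_based_root_datum D
  for F :: "'r::idom fps fps" and B :: "'l::ab_group_add set" and D :: "('l, 'i) based_root_datum"
begin

abbreviation Q :: "('r, 'l) fga_frac ring" where "Q \<equiv> Q_ring F"
abbreviation \<theta> where "\<theta> \<equiv> em.\<theta>"

lemma Q_ops: "mult Q = mult FR" "add Q = add FR" "one Q = one FR" "zero Q = zero FR"
  by (simp_all add: Q_ring_def)

definition Qgen where "Qgen = to_frac F ` carrier FA \<union> {xrecip F [l] |l. l \<noteq> 0}"

lemma carrier_Q: "carrier Q = generate_ring FR Qgen"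
  by (simp add: Q_ring_def Qgen_def)

lemma Qgen_FR: "Qgen \<subseteq> carrier FR"
  unfolding Qgen_def using to_frac_in xrecip_in by auto

lemma cring_FR: "cring FR" unfolding FR_eq by (rule em.cring_FF)

lemma Q_FR: "x \<in> carrier Q \<Longrightarrow> x \<in> carrier FR"
  unfolding carrier_Q using ring.generate_ring_in_carrier[OF cring.axioms(1)[OF cring_FR] Qgen_FR] .

lemma theta_FR: "x \<in> carrier FR \<Longrightarrow> y \<in> carrier FR \<Longrightarrow> \<theta> (x \<oplus>\<^bsub>FR\<^esub> y) = \<theta> x + \<theta> y"
  "x \<in> carrier FR \<Longrightarrow> y \<in> carrier FR \<Longrightarrow> \<theta> (x \<otimes>\<^bsub>FR\<^esub> y) = \<theta> x * \<theta> y"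
  "\<theta> \<one>\<^bsub>FR\<^esub> = 1" "\<theta> \<zero>\<^bsub>FR\<^esub> = 0"
  by (simp_all add: FR_eq em.theta_add em.theta_mult em.theta_one em.theta_zero)

lemma theta_minus_FR: "x \<in> carrier FR \<Longrightarrow> \<theta> (\<ominus>\<^bsub>FR\<^esub> x) = - \<theta> x"
proof -
  interpret FR: cring FR by (rule cring_FR)
  assume x: "x \<in> carrier FR"
  have "\<theta> (x \<oplus>\<^bsub>FR\<^esub> \<ominus>\<^bsub>FR\<^esub> x) = 0" using x by (simp only: FR.r_neg theta_FR)
  then show ?thesis using x by (simp add: theta_FR eq_neg_iff_add_eq_0 add.commute)
qed

lemma Q_closed:
  "x \<in> carrier Q \<Longrightarrow> y \<in> carrier Q \<Longrightarrow> x \<oplus>\<^bsub>Q\<^esub> y \<in> carrier Q"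
  "x \<in> carrier Q \<Longrightarrow> y \<in> carrier Q \<Longrightarrow> x \<otimes>\<^bsub>Q\<^esub> y \<in> carrier Q"
  "\<zero>\<^bsub>Q\<^esub> \<in> carrier Q" "\<one>\<^bsub>Q\<^esub> \<in> carrier Q"
  unfolding Q_ops carrier_Q
  by (auto intro: generate_ring.intros ring.zero_in_generate[OF cring.axioms(1)[OF cring_FR]])

lemma theta_Q:
  "x \<in> carrier Q \<Longrightarrow> y \<in> carrier Q \<Longrightarrow> \<theta> (x \<oplus>\<^bsub>Q\<^esub> y) = \<theta> x + \<theta> y"
  "x \<in> carrier Q \<Longrightarrow> y \<in> carrier Q \<Longrightarrow> \<theta> (x \<otimes>\<^bsub>Q\<^esub> y) = \<theta> x * \<theta> y"
  "\<theta> \<one>\<^bsub>Q\<^esub> = 1" "\<theta> \<zero>\<^bsub>Q\<^esub> = 0"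
  by (simp_all add: Q_ops theta_FR Q_FR)

lemma inj_theta_Q: "inj_on \<theta> (carrier Q)"
  using em.inj_theta Q_FR by (auto intro: inj_on_subset simp: FR_eq)

lemma cring_Q: "cring Q"
proof (rule cring_by_embedding[OF inj_theta_Q])
  fix x assume x: "x \<in> carrier Q"
  then have "\<ominus>\<^bsub>FR\<^esub> x \<in> carrier Q" unfolding carrier_Q by (rule generate_ring.a_inv)
  then show "\<exists>y\<in>carrier Q. \<theta> y = - \<theta> x" using theta_minus_FR[OF Q_FR[OF x]] by blast
qed (auto simp: Q_closed theta_Q)

sublocale Q: cring Q by (rule cring_Q)

lemma theta_Q_minus: "x \<in> carrier Q \<Longrightarrow> \<theta> (\<ominus>\<^bsub>Q\<^esub> x) = - \<theta> x"
proof -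
  assume x: "x \<in> carrier Q"
  have "\<theta> (x \<oplus>\<^bsub>Q\<^esub> \<ominus>\<^bsub>Q\<^esub> x) = 0" using x by (simp only: Q.r_neg theta_Q)
  then show ?thesis using x by (simp add: theta_Q eq_neg_iff_add_eq_0 add.commute)
qed

lemma theta_Q_diff: "x \<in> carrier Q \<Longrightarrow> y \<in> carrier Q \<Longrightarrow> \<theta> (x \<ominus>\<^bsub>Q\<^esub> y) = \<theta> x - \<theta> y"
  by (simp add: a_minus_def theta_Q theta_Q_minus)

lemma theta_Q_sum: "finite S \<Longrightarrow> (\<And>x. x \<in> S \<Longrightarrow> h x \<in> carrier Q) \<Longrightarrow>
    \<theta> (finsum Q h S) = (\<Sum>x\<in>S. \<theta> (h x))"
  by (induction S rule: finite_induct) (simp_all add: theta_Q Pi_def Q.finsum_closed)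

lemma Q_eqI: "x \<in> carrier Q \<Longrightarrow> y \<in> carrier Q \<Longrightarrow> \<theta> x = \<theta> y \<Longrightarrow> x = y"
  using inj_onD[OF inj_theta_Q] by blast

lemma weyl_acting: "w \<in> W \<Longrightarrow> acting w"
  by (simp add: acting_def weyl_bij weyl_additive)

lemma acting_nonzero: "acting w \<Longrightarrow> l \<noteq> 0 \<Longrightarrow> w l \<noteq> 0"
  unfolding acting_def by (metis additive.zero bij_is_inj injD)

text \<open>
  An injective additive map sends nonzero weights to nonzero weights, so it permutes the generators
  of Q.
\<close>

lemma frac_action_Q: assumes w: "acting w" and x: "x \<in> carrier Q" shows "frac_action w x \<in> carrier Q"
  using x unfolding carrier_Q
proof induction
  case one
  show ?case unfolding frac_action_zero_one[OF w] by (rule generate_ring.one)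
next
  case (incl h)
  then have "frac_action w h \<in> Qgen"
    unfolding Qgen_def using frac_action_to_frac[OF w] fga_action_hom(1)[OF w] frac_action_xrecip[OF w]
      acting_nonzero[OF w] by auto
  then show ?case by (rule generate_ring.incl)
next
  case (a_inv h)
  then have "h \<in> carrier FR" using Q_FR carrier_Q by blast
  then show ?case using frac_action_minus[OF w] a_inv generate_ring.a_inv by metis
next
  case (eng_add h k)
  then have "h \<in> carrier FR" "k \<in> carrier FR" using Q_FR carrier_Q by blast+
  then show ?case using frac_action_hom(3)[OF w] eng_add generate_ring.eng_add by metis
next
  case (eng_mult h k)
  then have "h \<in> carrier FR" "k \<in> carrier FR" using Q_FR carrier_Q by blast+
  then show ?case using frac_action_hom(2)[OF w] eng_mult generate_ring.eng_mult by metis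
qed

lemma frac_action_Q_hom:
  assumes w: "acting w" and x: "x \<in> carrier Q" and y: "y \<in> carrier Q"
  shows "frac_action w (x \<oplus>\<^bsub>Q\<^esub> y) = frac_action w x \<oplus>\<^bsub>Q\<^esub> frac_action w y"
    "frac_action w (\<ominus>\<^bsub>Q\<^esub> x) = \<ominus>\<^bsub>Q\<^esub> frac_action w x"
    "frac_action w (x \<ominus>\<^bsub>Q\<^esub> y) = frac_action w x \<ominus>\<^bsub>Q\<^esub> frac_action w y"
proof -
  have add: "frac_action w (x \<oplus>\<^bsub>Q\<^esub> y) = frac_action w x \<oplus>\<^bsub>Q\<^esub> frac_action w y"
    if "x \<in> carrier Q" "y \<in> carrier Q" for x y
    unfolding Q_ops using frac_action_hom(3)[OF w Q_FR[OF that(1)] Q_FR[OF that(2)]] .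
  have neg: "frac_action w (\<ominus>\<^bsub>Q\<^esub> x) = \<ominus>\<^bsub>Q\<^esub> frac_action w x" if x: "x \<in> carrier Q" for x
  proof -
    have "frac_action w (\<ominus>\<^bsub>Q\<^esub> x) \<oplus>\<^bsub>Q\<^esub> frac_action w x = frac_action w (\<ominus>\<^bsub>Q\<^esub> x \<oplus>\<^bsub>Q\<^esub> x)"
      using add[of "\<ominus>\<^bsub>Q\<^esub> x" x] x by simp
    also have "\<dots> = \<zero>\<^bsub>Q\<^esub>" using x frac_action_zero_one(1)[OF w] unfolding Q_ops(4)[symmetric] by (simp add: Q.l_neg)
    finally show ?thesis
      using Q.minus_equality frac_action_Q[OF w x] frac_action_Q[OF w Q.a_inv_closed[OF x]] by simp
  qed
  show "frac_action w (x \<ominus>\<^bsub>Q\<^esub> y) = frac_action w x \<ominus>\<^bsub>Q\<^esub> frac_action w y"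
    using add[of x "\<ominus>\<^bsub>Q\<^esub> y"] neg[of y] x y by (simp add: a_minus_def)
  show "frac_action w (x \<oplus>\<^bsub>Q\<^esub> y) = frac_action w x \<oplus>\<^bsub>Q\<^esub> frac_action w y"
    "frac_action w (\<ominus>\<^bsub>Q\<^esub> x) = \<ominus>\<^bsub>Q\<^esub> frac_action w x"
    using add[OF x y] neg[OF x] .
qed

lemma xrecip_Q: "0 \<notin> set ls \<Longrightarrow> xrecip F ls \<in> carrier Q"
proof (induction ls)
  case Nil
  have "xrecip F [] = \<one>\<^bsub>FR\<^esub>"
    by (rule inj_onD[OF em.inj_theta]) (use xrecip_in theta_xrecip[of "[]"] em.theta_one in \<open>auto simp: FR_eq\<close>)
  then show ?case using Q_closed(4) by (simp add: Q_ops)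
next
  case (Cons l ls)
  have "xrecip F (l # ls) = xrecip F [l] \<otimes>\<^bsub>FR\<^esub> xrecip F ls"
  proof (rule inj_onD[OF em.inj_theta])
    show "\<theta> (xrecip F (l # ls)) = \<theta> (xrecip F [l] \<otimes>\<^bsub>FR\<^esub> xrecip F ls)"
      by (simp add: theta_xrecip theta_FR xrecip_in)
    show "xrecip F [l] \<otimes>\<^bsub>FR\<^esub> xrecip F ls \<in> carrier em.FF"
      using em.theta_mult(1) xrecip_in by (simp add: FR_eq)
    show "xrecip F (l # ls) \<in> carrier em.FF" using xrecip_in[of "l # ls"] by (simp add: FR_eq)
  qed
  moreover have "xrecip F [l] \<in> carrier Q"
    unfolding carrier_Q Qgen_def using Cons.prems by (intro generate_ring.incl) auto
  ultimately show ?case using Q_closed(2)[of "xrecip F [l]" "xrecip F ls"] Cons by (simp add: Q_ops)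
qed

section \<open>The twisted algebra, pointwise\<close>

abbreviation QW where "QW \<equiv> twisted_algebra F D"

lemma QW_carrier: "f \<in> carrier QW \<longleftrightarrow> (\<forall>w\<in>W. f w \<in> carrier Q) \<and> (\<forall>w. w \<notin> W \<longrightarrow> f w = \<zero>\<^bsub>Q\<^esub>)"
  by (simp add: twisted_algebra_def)

lemma QW_value: "f \<in> carrier QW \<Longrightarrow> f w \<in> carrier Q"
  unfolding QW_carrier using Q_closed(3) by metis

lemma QW_add: "f \<oplus>\<^bsub>QW\<^esub> g = (\<lambda>w. f w \<oplus>\<^bsub>Q\<^esub> g w)"
  and QW_zero: "\<zero>\<^bsub>QW\<^esub> = (\<lambda>w. \<zero>\<^bsub>Q\<^esub>)"
  and QW_one: "\<one>\<^bsub>QW\<^esub> = (\<lambda>w. if w = id then \<one>\<^bsub>Q\<^esub> else \<zero>\<^bsub>Q\<^esub>)"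
  by (simp_all add: twisted_algebra_def weyl_one)

text \<open>
  The coefficient of \<open>\<delta>\<^sub>w\<close>, seen in the type of fractions. There, equations become
  accessible to computation with polynomials.
\<close>

definition coeff_at where "coeff_at f w = \<theta> (f w)"

lemma QW_eqI: assumes "f \<in> carrier QW" "g \<in> carrier QW" "\<And>w. w \<in> W \<Longrightarrow> coeff_at f w = coeff_at g w" shows "f = g"
proof
  fix w
  show "f w = g w"
  proof (cases "w \<in> W")
    case True
    then show ?thesis using assms QW_value Q_eqI by (auto simp: coeff_at_def)
  next
    case False
    then show ?thesis using assms(1,2) by (simp add: QW_carrier)
  qed
qed

lemma abelian_group_QW: "abelian_group QW"
proof (rule abelian_groupI)
  fix f assume f: "f \<in> carrier QW"
  show "\<exists>g\<in>carrier QW. g \<oplus>\<^bsub>QW\<^esub> f = \<zero>\<^bsub>QW\<^esub>"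
  proof (rule bexI[of _ "\<lambda>w. \<ominus>\<^bsub>Q\<^esub> f w"])
    show "(\<lambda>w. \<ominus>\<^bsub>Q\<^esub> f w) \<oplus>\<^bsub>QW\<^esub> f = \<zero>\<^bsub>QW\<^esub>"
      using QW_value[OF f] by (simp add: QW_add QW_zero Q.l_neg)
    show "(\<lambda>w. \<ominus>\<^bsub>Q\<^esub> f w) \<in> carrier QW" using f by (simp add: QW_carrier)
  qed
qed (auto simp: QW_add QW_zero fun_eq_iff QW_value Q.a_ac, auto simp: QW_carrier)

sublocale QW: abelian_group QW by (rule abelian_group_QW)

lemma QW_minus: assumes f: "f \<in> carrier QW" shows "\<ominus>\<^bsub>QW\<^esub> f = (\<lambda>w. \<ominus>\<^bsub>Q\<^esub> f w)"
proof (rule QW.minus_equality)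
  show "(\<lambda>w. \<ominus>\<^bsub>Q\<^esub> f w) \<oplus>\<^bsub>QW\<^esub> f = \<zero>\<^bsub>QW\<^esub>"
    using QW_value[OF f] by (simp add: QW_add QW_zero Q.l_neg)
  show "(\<lambda>w. \<ominus>\<^bsub>Q\<^esub> f w) \<in> carrier QW" using f by (simp add: QW_carrier)
qed (rule f)

lemma coeff_at_add: "f \<in> carrier QW \<Longrightarrow> g \<in> carrier QW \<Longrightarrow> coeff_at (f \<oplus>\<^bsub>QW\<^esub> g) w = coeff_at f w + coeff_at g w"
  by (simp add: coeff_at_def QW_add theta_Q QW_value)

lemma coeff_at_minus: "f \<in> carrier QW \<Longrightarrow> coeff_at (\<ominus>\<^bsub>QW\<^esub> f) w = - coeff_at f w"
  by (simp add: coeff_at_def QW_minus theta_Q_minus QW_value)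

lemma coeff_at_diff: "f \<in> carrier QW \<Longrightarrow> g \<in> carrier QW \<Longrightarrow> coeff_at (f \<ominus>\<^bsub>QW\<^esub> g) w = coeff_at f w - coeff_at g w"
  by (simp add: a_minus_def coeff_at_add coeff_at_minus)

lemma coeff_at_zero: "coeff_at \<zero>\<^bsub>QW\<^esub> w = 0" by (simp add: coeff_at_def QW_zero theta_Q)

lemma coeff_at_one: "coeff_at \<one>\<^bsub>QW\<^esub> w = (if w = id then 1 else 0)" by (simp add: coeff_at_def QW_one theta_Q)

lemma QW_one_closed: "\<one>\<^bsub>QW\<^esub> \<in> carrier QW"
  using weyl_id by (auto simp: QW_carrier QW_one)

lemma coeff_at_sum: "finite S \<Longrightarrow> (\<And>x. x \<in> S \<Longrightarrow> h x \<in> carrier QW) \<Longrightarrow>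
    coeff_at (finsum QW h S) w = (\<Sum>x\<in>S. coeff_at (h x) w)"
  by (induction S rule: finite_induct) (simp_all add: coeff_at_add coeff_at_zero Pi_def QW.finsum_closed)

definition pairs where "pairs v = {(w', w). w' \<in> W \<and> w \<in> W \<and> w' \<otimes>\<^bsub>WG\<^esub> w = v}"

lemma finite_pairs: "finite (pairs v)"
  using finite_subset[of "pairs v" "W \<times> W"] finite_weyl by (auto simp: pairs_def)

lemma QW_mult: "(f \<otimes>\<^bsub>QW\<^esub> g) v = finsum Q (\<lambda>(w', w). frac_action (inv_into UNIV w) (f w') \<otimes>\<^bsub>Q\<^esub> g w) (pairs v)"
  if "f \<in> carrier QW" "g \<in> carrier QW"
proof -
  have "(f \<otimes>\<^bsub>QW\<^esub> g) v = finsum Q (\<lambda>(w', w). frac_action (inv\<^bsub>WG\<^esub> w) (f w') \<otimes>\<^bsub>Q\<^esub> g w) (pairs v)"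
    by (simp add: twisted_algebra_def pairs_def)
  also have "\<dots> = finsum Q (\<lambda>(w', w). frac_action (inv_into UNIV w) (f w') \<otimes>\<^bsub>Q\<^esub> g w) (pairs v)"
    by (rule Q.finsum_cong')
       (use that in \<open>auto simp: pairs_def weyl_inv QW_value intro!: Q.m_closed frac_action_Q weyl_acting\<close>)
  finally show ?thesis .
qed

lemma QW_mult_closed: assumes f: "f \<in> carrier QW" and g: "g \<in> carrier QW" shows "f \<otimes>\<^bsub>QW\<^esub> g \<in> carrier QW"
  unfolding QW_carrier
proof (intro conjI ballI allI impI)
  fix v assume "v \<in> W"
  show "(f \<otimes>\<^bsub>QW\<^esub> g) v \<in> carrier Q"
    unfolding QW_mult[OF f g]
    by (rule Q.finsum_closed)
       (auto simp: pairs_def weyl_inv QW_value f g intro!: Q.m_closed frac_action_Q weyl_acting)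
next
  fix v assume "v \<notin> W"
  then have "pairs v = {}" using weyl_mult weyl_comp by (auto simp: pairs_def)
  then show "(f \<otimes>\<^bsub>QW\<^esub> g) v = \<zero>\<^bsub>Q\<^esub>" by (simp add: QW_mult[OF f g])
qed

text \<open>
  The pairs with product v are parametrised by their first component.
\<close>

lemma coeff_at_mult:
  assumes f: "f \<in> carrier QW" and g: "g \<in> carrier QW" and v: "v \<in> W"
  shows "coeff_at (f \<otimes>\<^bsub>QW\<^esub> g) v =
    (\<Sum>w'\<in>W. \<theta> (frac_action (inv_into UNIV (inv_into UNIV w' \<circ> v)) (f w')) * coeff_at g (inv_into UNIV w' \<circ> v))"
proof -
  let ?t = "\<lambda>w' w. \<theta> (frac_action (inv_into UNIV w) (f w')) * coeff_at g w"
  have inv: "inv_into UNIV w' \<circ> v \<in> W" if "w' \<in> W" for w' using that v by (intro weyl_comp weyl_inv)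
  have "coeff_at (f \<otimes>\<^bsub>QW\<^esub> g) v = (\<Sum>(w', w)\<in>pairs v. ?t w' w)"
    unfolding coeff_at_def QW_mult[OF f g]
    by (subst theta_Q_sum[OF finite_pairs])
       (auto simp: pairs_def weyl_inv QW_value f g theta_Q frac_action_Q weyl_acting
         intro!: Q.m_closed sum.cong)
  also have "pairs v = (\<lambda>w'. (w', inv_into UNIV w' \<circ> v)) ` W"
  proof (intro equalityI subsetI)
    fix p assume "p \<in> pairs v"
    then obtain w' w where p: "p = (w', w)" "w' \<in> W" "w \<in> W" "w' \<circ> w = v"
      using weyl_mult by (auto simp: pairs_def)
    have "inv_into UNIV w' \<circ> v = w"
      unfolding p(4)[symmetric] comp_assoc[symmetric] using inverse_comp[OF weyl_bij[OF p(2)]] by simp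
    then show "p \<in> (\<lambda>w'. (w', inv_into UNIV w' \<circ> v)) ` W" using p by blast
  next
    fix p assume "p \<in> (\<lambda>w'. (w', inv_into UNIV w' \<circ> v)) ` W"
    then obtain w' where p: "p = (w', inv_into UNIV w' \<circ> v)" "w' \<in> W" by blast
    have "w' \<circ> (inv_into UNIV w' \<circ> v) = v"
      unfolding comp_assoc[symmetric] using inverse_comp[OF weyl_bij[OF p(2)]] by simp
    then show "p \<in> pairs v" using p(2) inv[OF p(2)] weyl_mult unfolding p(1) pairs_def by auto
  qed
  also have "(\<Sum>(w', w)\<in>(\<lambda>w'. (w', inv_into UNIV w' \<circ> v)) ` W. ?t w' w) = (\<Sum>w'\<in>W. ?t w' (inv_into UNIV w' \<circ> v))"
    by (subst sum.reindex) (auto simp: inj_on_def)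
  finally show ?thesis .
qed

lemma theta_frac_zero: "acting w \<Longrightarrow> \<theta> (frac_action w \<zero>\<^bsub>Q\<^esub>) = 0"
  using frac_action_zero_one(1) by (simp add: Q_ops theta_FR)

abbreviation \<iota> where "\<iota> \<equiv> Q_embed F D"

lemma iota_eq: "\<iota> q = (\<lambda>v. if v = id then q else \<zero>\<^bsub>Q\<^esub>)"
  by (simp add: Q_embed_def weyl_one)

lemma iota_closed: "q \<in> carrier Q \<Longrightarrow> \<iota> q \<in> carrier QW"
  using weyl_id by (auto simp: iota_eq QW_carrier)

lemma coeff_at_iota_left:
  assumes q: "q \<in> carrier Q" and g: "g \<in> carrier QW" and v: "v \<in> W"
  shows "coeff_at (\<iota> q \<otimes>\<^bsub>QW\<^esub> g) v = \<theta> (frac_action (inv_into UNIV v) q) * coeff_at g v"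
proof -
  have inv: "acting (inv_into UNIV (inv_into UNIV w' \<circ> v))" if "w' \<in> W" for w'
    using that v by (intro weyl_acting weyl_comp weyl_inv)
  have "coeff_at (\<iota> q \<otimes>\<^bsub>QW\<^esub> g) v = (\<Sum>w'\<in>W. if w' = id then \<theta> (frac_action (inv_into UNIV v) q) * coeff_at g v else 0)"
    unfolding coeff_at_mult[OF iota_closed[OF q] g v]
  proof (intro sum.cong refl)
    fix w' assume "w' \<in> W"
    have i: "inv_into UNIV id \<circ> v = v" by (simp add: inv_id)
    show "\<theta> (frac_action (inv_into UNIV (inv_into UNIV w' \<circ> v)) (\<iota> q w')) * coeff_at g (inv_into UNIV w' \<circ> v) =
      (if w' = id then \<theta> (frac_action (inv_into UNIV v) q) * coeff_at g v else 0)"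
    proof (cases "w' = id")
      case True
      show ?thesis unfolding True i by (simp add: iota_eq)
    next
      case False
      then show ?thesis using theta_frac_zero[OF inv[OF \<open>w' \<in> W\<close>]] by (simp add: iota_eq)
    qed
  qed
  also have "\<dots> = \<theta> (frac_action (inv_into UNIV v) q) * coeff_at g v"
    using weyl_id finite_weyl by (simp add: sum.delta)
  finally show ?thesis .
qed

lemma coeff_at_iota_right:
  assumes q: "q \<in> carrier Q" and f: "f \<in> carrier QW" and v: "v \<in> W"
  shows "coeff_at (f \<otimes>\<^bsub>QW\<^esub> \<iota> q) v = coeff_at f v * \<theta> q"
proof -
  have "coeff_at (f \<otimes>\<^bsub>QW\<^esub> \<iota> q) v = (\<Sum>w'\<in>W. if w' = v then coeff_at f v * \<theta> q else 0)"
    unfolding coeff_at_mult[OF f iota_closed[OF q] v]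
  proof (intro sum.cong refl)
    fix w' assume w': "w' \<in> W"
    have id_iff: "inv_into UNIV w' \<circ> v = id \<longleftrightarrow> w' = v"
    proof
      assume "inv_into UNIV w' \<circ> v = id"
      then have "w' \<circ> (inv_into UNIV w' \<circ> v) = w'" by simp
      then show "w' = v" unfolding comp_assoc[symmetric] using inverse_comp[OF weyl_bij[OF w']] by simp
    qed (use inverse_comp[OF weyl_bij[OF v]] in auto)
    show "\<theta> (frac_action (inv_into UNIV (inv_into UNIV w' \<circ> v)) (f w')) * coeff_at (\<iota> q) (inv_into UNIV w' \<circ> v) =
      (if w' = v then coeff_at f v * \<theta> q else 0)"
    proof (cases "w' = v")
      case True
      have i: "inv_into UNIV v \<circ> v = id" using inverse_comp[OF weyl_bij[OF v]] by simp
      show ?thesis unfolding True i by (simp only: iota_eq coeff_at_def inv_id frac_action_id if_True refl)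
    next
      case False
      then show ?thesis using id_iff by (simp add: iota_eq coeff_at_def theta_Q)
    qed
  qed
  also have "\<dots> = coeff_at f v * \<theta> q" using v finite_weyl by (simp add: sum.delta)
  finally show ?thesis .
qed

lemma delta_closed: "w \<in> W \<Longrightarrow> delta F w \<in> carrier QW"
  by (auto simp: delta_def QW_carrier)

lemma coeff_at_delta: "coeff_at (delta F w) v = (if v = w then 1 else 0)"
  by (simp add: coeff_at_def delta_def theta_Q)

abbreviation Xa where "Xa \<equiv> demazure_element F D"

lemma Xa_closed: assumes "a \<in> \<Phi>" shows "Xa a \<in> carrier QW"
  unfolding demazure_element_def
  by (intro QW_mult_closed iota_closed xrecip_Q QW.minus_closed QW_one_closed delta_closed weyl_refl)
     (use assms root_nonzero in auto)

lemma theta_frac_xrecip: "acting w \<Longrightarrow> \<theta> (frac_action w (xrecip F ls)) = prod_list (map (\<lambda>l. xinv (w l)) ls)"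
  by (simp add: frac_action_xrecip theta_xrecip comp_def)

lemma coeff_at_Xa: assumes a: "a \<in> \<Phi>" and v: "v \<in> W"
  shows "coeff_at (Xa a) v = xinv (inv_into UNIV v a) * ((if v = id then 1 else 0) - (if v = refl a then 1 else 0))"
proof -
  have q: "xrecip F [a] \<in> carrier Q" using root_nonzero[OF a] by (intro xrecip_Q) auto
  have d: "\<one>\<^bsub>QW\<^esub> \<ominus>\<^bsub>QW\<^esub> delta F (refl a) \<in> carrier QW"
    by (intro QW.minus_closed QW_one_closed delta_closed weyl_refl a)
  show ?thesis
    unfolding demazure_element_def coeff_at_iota_left[OF q d v]
    using v by (simp add: coeff_at_diff QW_one_closed delta_closed weyl_refl a coeff_at_one coeff_at_delta theta_frac_xrecip
        weyl_acting weyl_inv)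
qed

lemma refl_not_id: "a \<in> \<Phi> \<Longrightarrow> refl a \<noteq> id"
proof
  assume a: "a \<in> \<Phi>" and "refl a = id"
  then have "a = - a" using refl_self[OF a] by simp
  then have "cr a a = - cr a a" using cr_minus[OF a] by metis
  then show False using coroot_self[OF a] by simp
qed

text \<open>
  The element \<open>X\<^sub>a\<close> is \<open>\<delta>\<^sub>1 y\<^sub>a - \<delta> y\<^sub>-\<^sub>a\<close>, with \<open>\<delta>\<close> belonging to \<open>s\<^sub>a\<close>: moving \<open>y\<^sub>a\<close> to the right
  of \<open>\<delta>\<close> applies \<open>s\<^sub>a\<close> to it.
\<close>

lemma Xa_values: assumes a: "a \<in> \<Phi>"
  shows "Xa a id = xrecip F [a]" "Xa a (refl a) = \<ominus>\<^bsub>Q\<^esub> xrecip F [- a]"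
    "w \<in> W \<Longrightarrow> w \<noteq> id \<Longrightarrow> w \<noteq> refl a \<Longrightarrow> Xa a w = \<zero>\<^bsub>Q\<^esub>"
proof -
  have q: "xrecip F [a] \<in> carrier Q" "xrecip F [- a] \<in> carrier Q"
    using root_nonzero[OF a] by (auto intro: xrecip_Q)
  note val = QW_value[OF Xa_closed[OF a]]
  have ir: "inv_into UNIV (refl a) a = - a"
  proof -
    have "refl a (- a) = a" using refl_refl[OF a, of a] refl_self[OF a] by simp
    then show ?thesis using bij_inv_eq_iff[OF bij_refl[OF a]] by metis
  qed
  show "Xa a id = xrecip F [a]"
    by (rule Q_eqI[OF val q(1)])
       (use coeff_at_Xa[OF a weyl_id] refl_not_id[OF a] in \<open>auto simp: coeff_at_def theta_xrecip inv_id\<close>)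
  show "Xa a (refl a) = \<ominus>\<^bsub>Q\<^esub> xrecip F [- a]"
    by (rule Q_eqI[OF val Q.a_inv_closed[OF q(2)]])
       (use coeff_at_Xa[OF a weyl_refl[OF a]] refl_not_id[OF a] in \<open>auto simp: coeff_at_def theta_xrecip theta_Q_minus q ir\<close>)
  show "Xa a w = \<zero>\<^bsub>Q\<^esub>" if "w \<in> W" "w \<noteq> id" "w \<noteq> refl a"
    by (rule Q_eqI[OF val Q_closed(3)]) (use coeff_at_Xa[OF a that(1)] that in \<open>auto simp: coeff_at_def theta_Q\<close>)
qed

text \<open>
  Only the two summands of \<open>X\<^sub>a\<close> contribute. The reciprocals agree because
  \<open>(s\<^sub>a v)\<^sup>-\<^sup>1 (- a) = v\<^sup>-\<^sup>1 a\<close>.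
\<close>

lemma coeff_at_Xa_mult:
  assumes a: "a \<in> \<Phi>" and f: "f \<in> carrier QW" and v: "v \<in> W"
  shows "coeff_at (Xa a \<otimes>\<^bsub>QW\<^esub> f) v = xinv (inv_into UNIV v a) * (coeff_at f v - coeff_at f (refl a \<circ> v))"
proof -
  have inv: "acting (inv_into UNIV (inv_into UNIV w' \<circ> v))" if "w' \<in> W" for w'
    using that v by (intro weyl_acting weyl_comp weyl_inv)
  let ?t = "\<lambda>w'. \<theta> (frac_action (inv_into UNIV (inv_into UNIV w' \<circ> v)) (Xa a w')) * coeff_at f (inv_into UNIV w' \<circ> v)"
  have rinv: "inv_into UNIV (refl a) = refl a"
    by (rule inv_unique_comp) (auto simp: refl_refl a)
  have q: "xrecip F [- a] \<in> carrier Q" using root_nonzero[OF a] by (intro xrecip_Q) auto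
  have "coeff_at (Xa a \<otimes>\<^bsub>QW\<^esub> f) v = (\<Sum>w'\<in>W. ?t w')" by (rule coeff_at_mult[OF Xa_closed[OF a] f v])
  also have "\<dots> = (\<Sum>w'\<in>{id, refl a}. ?t w')"
    by (rule sum.mono_neutral_right)
       (use finite_weyl weyl_id weyl_refl[OF a] Xa_values(3)[OF a] inv theta_frac_zero in auto)
  also have "\<dots> = ?t id + ?t (refl a)" using refl_not_id[OF a] by (subst sum.insert) auto
  also have "?t id = xinv (inv_into UNIV v a) * coeff_at f v"
  proof -
    have i: "inv_into UNIV id \<circ> v = v" by (simp add: inv_id)
    show ?thesis unfolding i Xa_values(1)[OF a] using weyl_acting[OF weyl_inv(2)[OF v]]
      by (simp add: theta_frac_xrecip)
  qed
  also have "?t (refl a) = - (xinv (inv_into UNIV v a) * coeff_at f (refl a \<circ> v))"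
  proof -
    let ?u = "inv_into UNIV (refl a \<circ> v)"
    have u: "acting ?u" using inv[OF weyl_refl[OF a]] unfolding rinv .
    have "(refl a \<circ> v) (inv_into UNIV v a) = - a"
      using refl_self[OF a] weyl_bij[OF v] by (simp add: bij_is_surj surj_f_inv_f)
    then have "?u (- a) = inv_into UNIV v a"
      using bij_inv_eq_iff[OF weyl_bij[OF weyl_comp[OF weyl_refl[OF a] v]]] by metis
    then have "\<theta> (frac_action ?u (\<ominus>\<^bsub>Q\<^esub> xrecip F [- a])) = - xinv (inv_into UNIV v a)"
      using frac_action_Q_hom(2)[OF u q q] theta_Q_minus[OF frac_action_Q[OF u q]] theta_frac_xrecip[OF u, of "[- a]"]
      by simp
    then show ?thesis unfolding rinv Xa_values(2)[OF a] by simp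
  qed
  finally show ?thesis by (simp add: right_diff_distrib)
qed

section \<open>Coefficients of products of Demazure elements\<close>

abbreviation X where "X \<equiv> demazure_word F D"

lemma X_Cons: "X (k # u) = Xa (\<alpha> k) \<otimes>\<^bsub>QW\<^esub> X u" by (simp add: demazure_word_def)

lemma X_closed: "set u \<subseteq> I \<Longrightarrow> X u \<in> carrier QW"
proof (induction u)
  case Nil
  show ?case using QW_one_closed by (simp add: demazure_word_def)
next
  case (Cons k u)
  then show ?case using QW_mult_closed[OF Xa_closed] simple_root by (simp add: X_Cons)
qed

text \<open>
  The coefficient at the inverse of v. With this convention the recursion multiplies v by simple
  reflections on the right, and the weights that occur are \<open>v (\<alpha> k)\<close>.
\<close>

definition word_coeff where "word_coeff u v = coeff_at (X u) (inv_into UNIV v)"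

lemma word_coeff_Nil: assumes v: "v \<in> W" shows "word_coeff [] v = (if v = id then 1 else 0)"
proof -
  have "inv_into UNIV v = id \<longleftrightarrow> v = id" using inverse_comp[OF weyl_bij[OF v]] by (metis comp_id id_comp)
  then show ?thesis by (simp add: word_coeff_def demazure_word_def coeff_at_one)
qed

lemma word_coeff_Cons: assumes v: "v \<in> W" and u: "set u \<subseteq> I" and k: "k \<in> I"
  shows "word_coeff (k # u) v = xinv (v (\<alpha> k)) * (word_coeff u v - word_coeff u (v \<circ> s k))"
proof -
  have vv: "inv_into UNIV (inv_into UNIV v) = v" using inv_inv_eq[OF weyl_bij[OF v]] .
  have ks: "inv_into UNIV (s k) = s k" by (rule inv_unique_comp) (auto simp: s_s k)
  have "inv_into UNIV (v \<circ> s k) = refl (\<alpha> k) \<circ> inv_into UNIV v"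
    using o_inv_distrib[OF weyl_bij[OF v] weyl_bij[OF s_weyl[OF k]]] ks by (simp add: simple_reflection_def)
  then show ?thesis
    unfolding word_coeff_def X_Cons coeff_at_Xa_mult[OF simple_root[OF k] X_closed[OF u] weyl_inv(2)[OF v]] vv by simp
qed

end

section \<open>Coefficients as polynomials in independent variables\<close>

text \<open>
  The recursion \<open>word_coeff_Cons\<close> with v replaced by its matrix M and with the reciprocal at each
  weight replaced by a variable.
\<close>

fun model_coeff :: "(vec2 \<Rightarrow> 'a::comm_ring_1) \<Rightarrow> int \<Rightarrow> int \<Rightarrow> bool list \<Rightarrow> vec2 \<times> vec2 \<Rightarrow> 'a" where
  "model_coeff Z x y [] M = (if M = ((1, 0), (0, 1)) then 1 else 0)"
| "model_coeff Z x y (t # u) M = Z (if t then fst M else snd M) * (model_coeff Z x y u M - model_coeff Z x y u (mat_step x y t M))"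

lemma mat_step_simps:
  "mat_step x y True ((a, b), (c, d)) = ((- a, - b), (c - x * a, d - x * b))"
  "mat_step x y False ((a, b), (c, d)) = ((a - y * c, b - y * d), (- c, - d))"
  by (simp_all add: mat_step_def)

fun vadd :: "vec2 \<Rightarrow> vec2 \<Rightarrow> vec2" where "vadd (a, b) (c, d) = (a + c, b + d)"
fun vneg :: "vec2 \<Rightarrow> vec2" where "vneg (a, b) = (- a, - b)"

definition kappa_poly :: "(vec2 \<Rightarrow> 'a::comm_ring_1) \<Rightarrow> vec2 \<Rightarrow> vec2 \<Rightarrow> 'a" where
  "kappa_poly Z p q = Z (vadd p q) * Z q - Z (vadd p q) * Z (vneg p) - Z p * Z q"

definition xi_ij_poly :: "(vec2 \<Rightarrow> 'a::comm_ring_1) \<Rightarrow> 'a" where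
  "xi_ij_poly Z = Z (1,0) * Z (1,1) * Z (1,2) * Z (2,3) + Z (1,0) * Z (0,1) * Z (1,2) * Z (-2,-3)
    + Z (1,0) * Z (0,1) * Z (2,3) * Z (-1,-1) - Z (1,0) * Z (1,1) * Z (1,2) * Z (-1,-3)
    - Z (1,0) * Z (1,1) * Z (1,3) * Z (0,-1) + Z (1,1) * Z (1,3) * Z (0,-1) * Z (-2,-3)
    + Z (1,3) * Z (2,3) * Z (0,-1) * Z (-1,-2) + Z (1,1) * Z (1,2) * Z (-1,-3) * Z (-2,-3)
    - Z (1,0) * Z (0,1) * Z (1,2) * Z (1,3)"

definition xi_ji_poly :: "(vec2 \<Rightarrow> 'a::comm_ring_1) \<Rightarrow> 'a" where
  "xi_ji_poly Z = Z (1,0) * Z (0,1) * Z (2,3) * Z (-1,-2) + Z (1,0) * Z (0,1) * Z (1,2) * Z (-1,-3)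
    + Z (0,1) * Z (1,2) * Z (1,3) * Z (2,3) - Z (1,0) * Z (0,1) * Z (1,1) * Z (2,3)
    + Z (1,1) * Z (1,2) * Z (-1,0) * Z (-2,-3) + Z (1,3) * Z (2,3) * Z (-1,-1) * Z (-1,-2)
    + Z (1,1) * Z (1,3) * Z (-1,0) * Z (-1,-2) - Z (0,1) * Z (1,3) * Z (2,3) * Z (-1,-1)
    - Z (0,1) * Z (1,1) * Z (1,3) * Z (-1,0)"


definition orbit2 :: "(vec2 \<times> vec2) set" where
  "orbit2 = {((1,0),(0,1)), ((-1,0),(0,1)), ((1,0),(0,-1)), ((-1,0),(0,-1))}"

definition orbit3 :: "(vec2 \<times> vec2) set" where
  "orbit3 = {((1,0),(0,1)), ((-1,0),(1,1)), ((-1,-1),(1,0)), ((1,1),(0,-1)), ((0,1),(-1,-1)), ((0,-1),(-1,0))}"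

definition orbit4 :: "(vec2 \<times> vec2) set" where
  "orbit4 = {((1,0),(0,1)), ((-1,0),(1,1)), ((1,2),(0,-1)), ((1,0),(-1,-1)), ((-1,0),(0,-1)),
    ((-1,-2),(0,1)), ((-1,-2),(1,1)), ((1,2),(-1,-1))}"

definition orbit6 :: "(vec2 \<times> vec2) set" where
  "orbit6 = {((1,0),(0,1)), ((1,3),(0,-1)), ((-2,-3),(1,2)), ((-1,-3),(1,2)), ((-1,-3),(0,1)),
    ((-1,0),(0,-1)), ((1,3),(-1,-2)), ((-1,0),(1,1)), ((1,0),(-1,-1)), ((2,3),(-1,-1)),
    ((2,3),(-1,-2)), ((-2,-3),(1,1))}"

lemma orbit_closed:
  "M \<in> orbit2 \<Longrightarrow> mat_step 0 0 t M \<in> orbit2"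
  "M \<in> orbit3 \<Longrightarrow> mat_step (-1) (-1) t M \<in> orbit3"
  "M \<in> orbit4 \<Longrightarrow> mat_step (-1) (-2) t M \<in> orbit4"
  "M \<in> orbit6 \<Longrightarrow> mat_step (-1) (-3) t M \<in> orbit6"
  by (cases t; auto simp: orbit2_def orbit3_def orbit4_def orbit6_def mat_step_simps)+

lemma orbit_id: "((1, 0), (0, 1)) \<in> orbit2" "((1, 0), (0, 1)) \<in> orbit3" "((1, 0), (0, 1)) \<in> orbit4"
  "((1, 0), (0, 1)) \<in> orbit6"
  by (simp_all add: orbit2_def orbit3_def orbit4_def orbit6_def)

lemma identity2: assumes "M \<in> orbit2" shows "model_coeff Z 0 0 [True, False] M = model_coeff Z 0 0 [False, True] M"
  using assms by (auto simp: orbit2_def mat_step_simps)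

definition demazure_poly :: "int \<Rightarrow> int \<Rightarrow> bool \<Rightarrow> ((vec2 \<Rightarrow> 'a::comm_ring_1) \<Rightarrow> 'a) \<Rightarrow> (vec2 \<Rightarrow> 'a) \<Rightarrow> 'a" where
  "demazure_poly x y t q Z = (q Z - q (\<lambda>p. Z (reflect2 x y t p))) * Z (if t then (1, 0) else (0, 1))"

text \<open>
  The coefficients of \<open>X\<^sub>i\<^sub>j\<close> and \<open>X\<^sub>j\<^sub>i\<close> for \<open>m = 4\<close>, and of \<open>X\<^sub>i\<^sub>j\<^sub>i\<^sub>j\<close> and \<open>X\<^sub>j\<^sub>i\<^sub>j\<^sub>i\<close> for \<open>m = 6\<close>.
\<close>

definition coeff4_ij :: "(vec2 \<Rightarrow> 'a::comm_ring_1) \<Rightarrow> 'a" where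
  "coeff4_ij Z = kappa_poly Z (1,2) (0,-1) + kappa_poly Z (0,1) (1,0)"

definition coeff4_ji :: "(vec2 \<Rightarrow> 'a::comm_ring_1) \<Rightarrow> 'a" where
  "coeff4_ji Z = kappa_poly Z (1,1) (0,1) + kappa_poly Z (1,0) (0,1)"

definition coeff6_ij :: "(vec2 \<Rightarrow> 'a::comm_ring_1) \<Rightarrow> 'a" where
  "coeff6_ij Z = kappa_poly Z (0,1) (1,0) + kappa_poly Z (2,3) (-1,-2) + kappa_poly Z (-1,-3) (1,2) + kappa_poly Z (1,2) (0,-1)"

definition coeff6_ji :: "(vec2 \<Rightarrow> 'a::comm_ring_1) \<Rightarrow> 'a" where
  "coeff6_ji Z = kappa_poly Z (1,0) (0,1) + kappa_poly Z (-2,-3) (1,2) + kappa_poly Z (-1,-2) (1,3) + kappa_poly Z (1,1) (0,1)"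

text \<open>
  In this lemma and the next two, the coefficients at each matrix are polynomials in at most twelve
  variables. Replacing the values of Z by atoms keeps the normalisation of these polynomials fast.
\<close>

lemma identity3: assumes "M \<in> orbit3"
  shows "model_coeff Z (-1) (-1) [False, True, False] M - model_coeff Z (-1) (-1) [True, False, True] M =
    model_coeff Z (-1) (-1) [True] M * kappa_poly Z (1,0) (0,1) - model_coeff Z (-1) (-1) [False] M * kappa_poly Z (0,1) (1,0)"
proof -
  obtain z0 z1 z2 z3 z4 z5 where z:
    "Z (1, 0) = z0"
    "Z (0, 1) = z1"
    "Z (1, 1) = z2"
    "Z (- 1, 0) = z3"
    "Z (0, - 1) = z4"
    "Z (- 1, - 1) = z5"
    by blast
  show ?thesis
    using assms unfolding orbit3_def insert_iff empty_iff
    by (elim disjE; simp add: mat_step_simps kappa_poly_def z; simp add: algebra_simps)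
qed

lemma identity4: assumes "M \<in> orbit4"
  shows "model_coeff Z (-1) (-2) [False, True, False, True] M - model_coeff Z (-1) (-2) [True, False, True, False] M =
    model_coeff Z (-1) (-2) [True, False] M * coeff4_ij Z - model_coeff Z (-1) (-2) [False, True] M * coeff4_ji Z
    + model_coeff Z (-1) (-2) [False] M * demazure_poly (-1) (-2) True coeff4_ji Z - model_coeff Z (-1) (-2) [True] M * demazure_poly (-1) (-2) False coeff4_ij Z"
proof -
  obtain z0 z1 z2 z3 z4 z5 z6 z7 where z:
    "Z (1, 0) = z0"
    "Z (0, 1) = z1"
    "Z (1, 1) = z2"
    "Z (1, 2) = z3"
    "Z (- 1, 0) = z4"
    "Z (0, - 1) = z5"
    "Z (- 1, - 1) = z6"
    "Z (- 1, - 2) = z7"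
    by blast
  show ?thesis
    using assms unfolding orbit4_def insert_iff empty_iff
    by (elim disjE; simp add: mat_step_simps kappa_poly_def coeff4_ij_def coeff4_ji_def demazure_poly_def z; simp add: algebra_simps)
qed

lemma identity6: assumes "M \<in> orbit6"
  shows "model_coeff Z (-1) (-3) [False, True, False, True, False, True] M
      - model_coeff Z (-1) (-3) [True, False, True, False, True, False] M =
    model_coeff Z (-1) (-3) [True, False, True, False] M * coeff6_ij Z - model_coeff Z (-1) (-3) [False, True, False, True] M * coeff6_ji Z
    + model_coeff Z (-1) (-3) [False, True, False] M * demazure_poly (-1) (-3) True coeff6_ji Z
    - model_coeff Z (-1) (-3) [True, False, True] M * demazure_poly (-1) (-3) False coeff6_ij Z
    + model_coeff Z (-1) (-3) [True, False] M * xi_ij_poly Z - model_coeff Z (-1) (-3) [False, True] M * xi_ji_poly Z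
    + model_coeff Z (-1) (-3) [False] M * demazure_poly (-1) (-3) True xi_ji_poly Z - model_coeff Z (-1) (-3) [True] M * demazure_poly (-1) (-3) False xi_ij_poly Z"
proof -
  obtain z0 z1 z2 z3 z4 z5 z6 z7 z8 z9 z10 z11 where z:
    "Z (1, 0) = z0"
    "Z (0, 1) = z1"
    "Z (1, 1) = z2"
    "Z (1, 2) = z3"
    "Z (1, 3) = z4"
    "Z (2, 3) = z5"
    "Z (- 1, 0) = z6"
    "Z (0, - 1) = z7"
    "Z (- 1, - 1) = z8"
    "Z (- 1, - 2) = z9"
    "Z (- 1, - 3) = z10"
    "Z (- 2, - 3) = z11"
    by blast
  show ?thesis
    using assms unfolding orbit6_def insert_iff empty_iff
    by (elim disjE; simp add: mat_step_simps kappa_poly_def coeff6_ij_def coeff6_ji_def xi_ij_poly_def xi_ji_poly_def demazure_poly_def z; simp add: algebra_simps)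
qed

section \<open>The relations for a pair of simple roots\<close>

locale twisted_pair = twisted_fga F B D + simple_root_pair D i j
  for F :: "'r::idom fps fps" and B :: "'l::ab_group_add set" and D :: "('l, 'i) based_root_datum"
    and i j :: 'i
begin

abbreviation Z where "Z p \<equiv> xinv (lc p)"

lemma word_coeff_has_matrix: "has_matrix v M \<Longrightarrow> word_coeff (map letter u) v = model_coeff Z cij cji u M"
proof (induction u arbitrary: v M)
  case Nil
  then show ?case using has_matrix_id_iff[OF Nil] by (simp add: word_coeff_Nil has_matrix_weyl)
next
  case (Cons t u)
  have "v (\<alpha> (letter t)) = lc (if t then fst M else snd M)"
    using Cons.prems by (simp add: has_matrix_def letter_def)
  then show ?case
    unfolding list.map word_coeff_Cons[OF has_matrix_weyl[OF Cons.prems] letters letter_index]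
      Cons.IH[OF Cons.prems] Cons.IH[OF has_matrix_step[OF Cons.prems, of t]] by simp
qed

lemma word_coeff_not_dihedral: "v \<in> W \<Longrightarrow> v \<notin> range (\<lambda>u. wp (map letter u)) \<Longrightarrow> word_coeff (map letter u) v = 0"
proof (induction u arbitrary: v)
  case Nil
  then show ?case using not_dihedral_not_id[of v] by (simp add: word_coeff_Nil)
next
  case (Cons t u)
  have "word_coeff (map letter u) v = 0" "word_coeff (map letter u) (v \<circ> s (letter t)) = 0"
    using Cons.IH[OF Cons.prems]
      Cons.IH[OF weyl_comp[OF Cons.prems(1) s_weyl[OF letter_index]] not_dihedral_step[OF Cons.prems(2)]] .
  then show ?case by (simp add: word_coeff_Cons[OF Cons.prems(1) letters letter_index])
qed

text \<open>
  The element q is given by the expression \<open>qf\<close> in the reciprocals at the weights of the plane. The second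
  equation says how the simple reflections act on q, which is what the Demazure operators need.
\<close>

definition represents :: "('r, 'l) fga_frac \<Rightarrow> ((vec2 \<Rightarrow> 'r scalars fps fract) \<Rightarrow> 'r scalars fps fract) \<Rightarrow> bool" where
  "represents q qf \<longleftrightarrow> q \<in> carrier Q \<and> \<theta> q = qf Z \<and>
    (\<forall>t. \<theta> (frac_action (s (letter t)) q) = qf (\<lambda>p. Z (reflect2 cij cji t p)))"

lemma acting_s: "acting (s (letter t))" by (intro weyl_acting s_weyl letter_index)

lemma represents_add: "represents q qf \<Longrightarrow> represents q' qf' \<Longrightarrow> represents (q \<oplus>\<^bsub>Q\<^esub> q') (\<lambda>Z. qf Z + qf' Z)"
  by (simp add: represents_def theta_Q frac_action_Q_hom acting_s frac_action_Q)

lemma represents_diff: "represents q qf \<Longrightarrow> represents q' qf' \<Longrightarrow> represents (q \<ominus>\<^bsub>Q\<^esub> q') (\<lambda>Z. qf Z - qf' Z)"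
  by (simp add: represents_def theta_Q_diff frac_action_Q_hom acting_s frac_action_Q)

lemma lc_zero_iff: "lc p = 0 \<longleftrightarrow> p = (0, 0)"
  using lc_inj[of p "(0, 0)"] by (simp add: lincomb_def)

lemma represents_xrecip: assumes "(0, 0) \<notin> set ps"
  shows "represents (xrecip2 F (\<alpha> i) (\<alpha> j) ps) (\<lambda>Z. prod_list (map Z ps))"
proof -
  have "0 \<notin> set (map lc ps)" using assms lc_zero_iff by (metis imageE set_map)
  then show ?thesis
    by (simp add: represents_def xrecip2_def xrecip_Q theta_xrecip theta_frac_xrecip acting_s s_letter comp_def)
qed

lemma lc_vadd: "lc p + lc q = lc (vadd p q)" and lc_vneg: "- lc p = lc (vneg p)"
  by (cases p; cases q; simp add: lincomb_def zscale_add_left zmodule.scale_minus_left)+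

lemma represents_kappa:
  assumes "p \<noteq> (0, 0)" "q \<noteq> (0, 0)" "vadd p q \<noteq> (0, 0)"
  shows "represents (kappa2 F (\<alpha> i) (\<alpha> j) p q) (\<lambda>Z. kappa_poly Z p q)"
proof -
  have p: "vneg p \<noteq> (0, 0)" using assms(1) by (cases p) auto
  have k: "kappa2 F (\<alpha> i) (\<alpha> j) p q = xrecip2 F (\<alpha> i) (\<alpha> j) [vadd p q, q]
      \<ominus>\<^bsub>Q\<^esub> xrecip2 F (\<alpha> i) (\<alpha> j) [vadd p q, vneg p] \<ominus>\<^bsub>Q\<^esub> xrecip2 F (\<alpha> i) (\<alpha> j) [p, q]"
    by (simp add: kappa2_def kappa_def xrecip2_def lc_vadd lc_vneg)
  have "represents (kappa2 F (\<alpha> i) (\<alpha> j) p q) (\<lambda>Z. prod_list (map Z [vadd p q, q])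
      - prod_list (map Z [vadd p q, vneg p]) - prod_list (map Z [p, q]))"
    unfolding k by (intro represents_diff represents_xrecip) (use assms p in auto)
  then show ?thesis by (simp add: kappa_poly_def)
qed

lemma represents_xi: "represents (xi_ij F (\<alpha> i) (\<alpha> j)) xi_ij_poly" "represents (xi_ji F (\<alpha> i) (\<alpha> j)) xi_ji_poly"
proof -
  note rs = represents_add represents_diff represents_xrecip
  have "represents (xi_ij F (\<alpha> i) (\<alpha> j)) (\<lambda>Z. prod_list (map Z [(1,0), (1,1), (1,2), (2,3)])
    + prod_list (map Z [(1,0), (0,1), (1,2), (-2,-3)]) + prod_list (map Z [(1,0), (0,1), (2,3), (-1,-1)])
    - prod_list (map Z [(1,0), (1,1), (1,2), (-1,-3)]) - prod_list (map Z [(1,0), (1,1), (1,3), (0,-1)])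
    + prod_list (map Z [(1,1), (1,3), (0,-1), (-2,-3)]) + prod_list (map Z [(1,3), (2,3), (0,-1), (-1,-2)])
    + prod_list (map Z [(1,1), (1,2), (-1,-3), (-2,-3)]) - prod_list (map Z [(1,0), (0,1), (1,2), (1,3)]))"
    unfolding xi_ij_def by (intro rs) simp_all
  moreover have "(\<lambda>Z. prod_list (map Z [(1,0), (1,1), (1,2), (2,3)])
    + prod_list (map Z [(1,0), (0,1), (1,2), (-2,-3)]) + prod_list (map Z [(1,0), (0,1), (2,3), (-1,-1)])
    - prod_list (map Z [(1,0), (1,1), (1,2), (-1,-3)]) - prod_list (map Z [(1,0), (1,1), (1,3), (0,-1)])
    + prod_list (map Z [(1,1), (1,3), (0,-1), (-2,-3)]) + prod_list (map Z [(1,3), (2,3), (0,-1), (-1,-2)])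
    + prod_list (map Z [(1,1), (1,2), (-1,-3), (-2,-3)]) - prod_list (map Z [(1,0), (0,1), (1,2), (1,3)]))
    = (xi_ij_poly :: (vec2 \<Rightarrow> 'r scalars fps fract) \<Rightarrow> _)"
    by (rule ext) (simp only: xi_ij_poly_def list.map prod_list.Cons prod_list.Nil mult_1_right mult.assoc)
  ultimately show "represents (xi_ij F (\<alpha> i) (\<alpha> j)) xi_ij_poly" by (simp only:)
  have "represents (xi_ji F (\<alpha> i) (\<alpha> j)) (\<lambda>Z. prod_list (map Z [(1,0), (0,1), (2,3), (-1,-2)])
    + prod_list (map Z [(1,0), (0,1), (1,2), (-1,-3)]) + prod_list (map Z [(0,1), (1,2), (1,3), (2,3)])
    - prod_list (map Z [(1,0), (0,1), (1,1), (2,3)]) + prod_list (map Z [(1,1), (1,2), (-1,0), (-2,-3)])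
    + prod_list (map Z [(1,3), (2,3), (-1,-1), (-1,-2)]) + prod_list (map Z [(1,1), (1,3), (-1,0), (-1,-2)])
    - prod_list (map Z [(0,1), (1,3), (2,3), (-1,-1)]) - prod_list (map Z [(0,1), (1,1), (1,3), (-1,0)]))"
    unfolding xi_ji_def by (intro rs) simp_all
  moreover have "(\<lambda>Z. prod_list (map Z [(1,0), (0,1), (2,3), (-1,-2)])
    + prod_list (map Z [(1,0), (0,1), (1,2), (-1,-3)]) + prod_list (map Z [(0,1), (1,2), (1,3), (2,3)])
    - prod_list (map Z [(1,0), (0,1), (1,1), (2,3)]) + prod_list (map Z [(1,1), (1,2), (-1,0), (-2,-3)])
    + prod_list (map Z [(1,3), (2,3), (-1,-1), (-1,-2)]) + prod_list (map Z [(1,1), (1,3), (-1,0), (-1,-2)])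
    - prod_list (map Z [(0,1), (1,3), (2,3), (-1,-1)]) - prod_list (map Z [(0,1), (1,1), (1,3), (-1,0)]))
    = (xi_ji_poly :: (vec2 \<Rightarrow> 'r scalars fps fract) \<Rightarrow> _)"
    by (rule ext) (simp only: xi_ji_poly_def list.map prod_list.Cons prod_list.Nil mult_1_right mult.assoc)
  ultimately show "represents (xi_ji F (\<alpha> i) (\<alpha> j)) xi_ji_poly" by (simp only:)
qed

abbreviation \<kappa> where "\<kappa> \<equiv> kappa2 F (\<alpha> i) (\<alpha> j)"
abbreviation \<Delta> where "\<Delta> k \<equiv> demazure_operator F D (\<alpha> k)"

lemma represents_coeff4_ij: "represents (\<kappa> (1,2) (0,-1) \<oplus>\<^bsub>Q\<^esub> \<kappa> (0,1) (1,0)) coeff4_ij"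
  and represents_coeff4_ji: "represents (\<kappa> (1,1) (0,1) \<oplus>\<^bsub>Q\<^esub> \<kappa> (1,0) (0,1)) coeff4_ji"
  and represents_coeff6_ij: "represents (\<kappa> (0,1) (1,0) \<oplus>\<^bsub>Q\<^esub> \<kappa> (2,3) (-1,-2) \<oplus>\<^bsub>Q\<^esub> \<kappa> (-1,-3) (1,2) \<oplus>\<^bsub>Q\<^esub> \<kappa> (1,2) (0,-1)) coeff6_ij"
  and represents_coeff6_ji: "represents (\<kappa> (1,0) (0,1) \<oplus>\<^bsub>Q\<^esub> \<kappa> (-2,-3) (1,2) \<oplus>\<^bsub>Q\<^esub> \<kappa> (-1,-2) (1,3) \<oplus>\<^bsub>Q\<^esub> \<kappa> (1,1) (0,1)) coeff6_ji"
  unfolding coeff4_ij_def[abs_def] coeff4_ji_def[abs_def] coeff6_ij_def[abs_def] coeff6_ji_def[abs_def]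
  by (intro represents_add represents_kappa; simp)+

lemma represents_delta:
  assumes q: "represents q qf"
  shows "\<Delta> (letter t) q \<in> carrier Q" "\<theta> (\<Delta> (letter t) q) = demazure_poly cij cji t qf Z"
proof -
  let ?r = "xrecip F [\<alpha> (letter t)]" and ?q' = "frac_action (s (letter t)) q"
  have r: "?r \<in> carrier Q" using root_nonzero[OF simple_root[OF letter_index]] by (intro xrecip_Q) auto
  have q': "q \<in> carrier Q" "?q' \<in> carrier Q" using q frac_action_Q[OF acting_s] by (simp_all add: represents_def)
  have d: "\<Delta> (letter t) q = (q \<ominus>\<^bsub>Q\<^esub> ?q') \<otimes>\<^bsub>Q\<^esub> ?r"
    by (simp add: demazure_operator_def simple_reflection_def)
  show "\<Delta> (letter t) q \<in> carrier Q" unfolding d using q' r by simp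
  have "\<theta> ?r = Z (if t then (1, 0) else (0, 1))" by (simp add: theta_xrecip letter_def lc_unit)
  then show "\<theta> (\<Delta> (letter t) q) = demazure_poly cij cji t qf Z"
    unfolding d using q q' r by (simp add: theta_Q theta_Q_diff represents_def demazure_poly_def)
qed

lemmas represents_delta_i = represents_delta[of _ _ True, unfolded letter_def if_True]
lemmas represents_delta_j = represents_delta[of _ _ False, unfolded letter_def if_False]

lemma representsD: "represents q qf \<Longrightarrow> q \<in> carrier Q" "represents q qf \<Longrightarrow> \<theta> q = qf Z"
  by (simp_all add: represents_def)

lemma term_closed: "set u \<subseteq> I \<Longrightarrow> q \<in> carrier Q \<Longrightarrow> X u \<otimes>\<^bsub>QW\<^esub> \<iota> q \<in> carrier QW"
  by (intro QW_mult_closed X_closed iota_closed)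

lemma coeff_at_term: "set u \<subseteq> I \<Longrightarrow> q \<in> carrier Q \<Longrightarrow> v \<in> W \<Longrightarrow>
    coeff_at (X u \<otimes>\<^bsub>QW\<^esub> \<iota> q) (inv_into UNIV v) = word_coeff u v * \<theta> q"
  by (simp add: coeff_at_iota_right X_closed weyl_inv word_coeff_def)

lemma coeff_at_word: "coeff_at (X u) (inv_into UNIV v) = word_coeff u v" by (simp add: word_coeff_def)

lemma QW_eqI_inv:
  assumes "f \<in> carrier QW" "g \<in> carrier QW" "\<And>v. v \<in> W \<Longrightarrow> coeff_at f (inv_into UNIV v) = coeff_at g (inv_into UNIV v)"
  shows "f = g"
proof (rule QW_eqI[OF assms(1,2)])
  fix w assume "w \<in> W"
  then show "coeff_at f w = coeff_at g w" using assms(3)[OF weyl_inv(2)] inv_inv_eq[OF weyl_bij] by metis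
qed

text \<open>
  A relation P between coefficients of words in two letters holds at every element of W once it
  holds on the matrices of the dihedral group and for zero coefficients.
\<close>

lemma word_coeff_identity:
  assumes "((1, 0), (0, 1)) \<in> Ms" "\<And>M t. M \<in> Ms \<Longrightarrow> mat_step cij cji t M \<in> Ms"
    and "\<And>M. M \<in> Ms \<Longrightarrow> P (\<lambda>u. model_coeff Z cij cji u M)" and "P (\<lambda>u. 0)" and v: "v \<in> W"
  shows "P (\<lambda>u. word_coeff (map letter u) v)"
proof (cases "v \<in> range (\<lambda>u. wp (map letter u))")
  case True
  then obtain M where "M \<in> Ms" "has_matrix v M" using has_matrix_closed[OF assms(1,2)] by blast
  then show ?thesis using assms(3)[of M] by (simp add: word_coeff_has_matrix)
next
  case False
  then show ?thesis using assms(4) by (simp add: word_coeff_not_dihedral[OF v])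
qed

lemma coefficients2: assumes "cij = 0" "cji = 0" and v: "v \<in> W" shows "word_coeff [i, j] v = word_coeff [j, i] v"
  using word_coeff_identity[of orbit2 "\<lambda>C. C [True, False] = C [False, True]", OF _ _ _ _ v] assms(1,2)
  by (simp add: orbit_id orbit_closed identity2 letter_def del: model_coeff.simps)

lemma coefficients3: assumes "cij = -1" "cji = -1" and v: "v \<in> W"
  shows "word_coeff [j, i, j] v - word_coeff [i, j, i] v = word_coeff [i] v * kappa_poly Z (1,0) (0,1) - word_coeff [j] v * kappa_poly Z (0,1) (1,0)"
  using word_coeff_identity[of orbit3 "\<lambda>C. C [False, True, False] - C [True, False, True] =
      C [True] * kappa_poly Z (1,0) (0,1) - C [False] * kappa_poly Z (0,1) (1,0)", OF _ _ _ _ v] assms(1,2)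
  by (simp add: orbit_id orbit_closed identity3 letter_def del: model_coeff.simps)

lemma coefficients4: assumes "cij = -1" "cji = -2" and v: "v \<in> W"
  shows "word_coeff [j, i, j, i] v - word_coeff [i, j, i, j] v = word_coeff [i, j] v * coeff4_ij Z - word_coeff [j, i] v * coeff4_ji Z
    + word_coeff [j] v * demazure_poly cij cji True coeff4_ji Z - word_coeff [i] v * demazure_poly cij cji False coeff4_ij Z"
  using word_coeff_identity[of orbit4 "\<lambda>C. C [False, True, False, True] - C [True, False, True, False] =
      C [True, False] * coeff4_ij Z - C [False, True] * coeff4_ji Z
      + C [False] * demazure_poly (-1) (-2) True coeff4_ji Z - C [True] * demazure_poly (-1) (-2) False coeff4_ij Z", OF _ _ _ _ v] assms(1,2)
  by (simp add: orbit_id orbit_closed identity4 letter_def del: model_coeff.simps)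

lemma coefficients6: assumes "cij = -1" "cji = -3" and v: "v \<in> W"
  shows "word_coeff [j, i, j, i, j, i] v - word_coeff [i, j, i, j, i, j] v =
    word_coeff [i, j, i, j] v * coeff6_ij Z - word_coeff [j, i, j, i] v * coeff6_ji Z
    + word_coeff [j, i, j] v * demazure_poly cij cji True coeff6_ji Z - word_coeff [i, j, i] v * demazure_poly cij cji False coeff6_ij Z
    + word_coeff [i, j] v * xi_ij_poly Z - word_coeff [j, i] v * xi_ji_poly Z
    + word_coeff [j] v * demazure_poly cij cji True xi_ji_poly Z - word_coeff [i] v * demazure_poly cij cji False xi_ij_poly Z"
  using word_coeff_identity[of orbit6 "\<lambda>C. C [False, True, False, True, False, True] - C [True, False, True, False, True, False] =
      C [True, False, True, False] * coeff6_ij Z - C [False, True, False, True] * coeff6_ji Z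
      + C [False, True, False] * demazure_poly (-1) (-3) True coeff6_ji Z - C [True, False, True] * demazure_poly (-1) (-3) False coeff6_ij Z
      + C [True, False] * xi_ij_poly Z - C [False, True] * xi_ji_poly Z
      + C [False] * demazure_poly (-1) (-3) True xi_ji_poly Z - C [True] * demazure_poly (-1) (-3) False xi_ij_poly Z", OF _ _ _ _ v] assms(1,2)
  by (simp add: orbit_id orbit_closed identity6 letter_def del: model_coeff.simps)

lemma relation2: assumes "cij = 0" shows "X [i, j] = X [j, i]"
  using assms cartan_zero_iff i j by (intro QW_eqI_inv X_closed) (auto simp: coeff_at_word coefficients2)

lemma relation3: assumes "cij = -1" "cji = -1"
  shows "X [j, i, j] \<ominus>\<^bsub>QW\<^esub> X [i, j, i] =
    X [i] \<otimes>\<^bsub>QW\<^esub> \<iota> (\<kappa> (1,0) (0,1)) \<ominus>\<^bsub>QW\<^esub> X [j] \<otimes>\<^bsub>QW\<^esub> \<iota> (\<kappa> (0,1) (1,0))"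
proof -
  have k: "represents (\<kappa> (1,0) (0,1)) (\<lambda>Z. kappa_poly Z (1,0) (0,1))" "represents (\<kappa> (0,1) (1,0)) (\<lambda>Z. kappa_poly Z (0,1) (1,0))"
    by (rule represents_kappa; simp)+
  show ?thesis
    by (rule QW_eqI_inv)
       (simp_all add: X_closed term_closed representsD[OF k(1)] representsD[OF k(2)] i j coeff_at_diff coeff_at_term coeff_at_word
          coefficients3[OF assms])
qed

lemma relation4: assumes "cij = -1" "cji = -2"
  and P: "represents P coeff4_ij" and P': "represents P' coeff4_ji"
  shows "X [j, i, j, i] \<ominus>\<^bsub>QW\<^esub> X [i, j, i, j] = X [i, j] \<otimes>\<^bsub>QW\<^esub> \<iota> P \<ominus>\<^bsub>QW\<^esub> X [j, i] \<otimes>\<^bsub>QW\<^esub> \<iota> P'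
    \<oplus>\<^bsub>QW\<^esub> X [j] \<otimes>\<^bsub>QW\<^esub> \<iota> (\<Delta> i P') \<ominus>\<^bsub>QW\<^esub> X [i] \<otimes>\<^bsub>QW\<^esub> \<iota> (\<Delta> j P)"
  by (rule QW_eqI_inv)
     (simp_all add: X_closed term_closed representsD[OF P] representsD[OF P']
        represents_delta_i[OF P'] represents_delta_j[OF P] i j coeff_at_diff coeff_at_add coeff_at_term coeff_at_word
        coefficients4[OF assms(1,2)])

lemma relation6: assumes "cij = -1" "cji = -3"
  and P: "represents P coeff6_ij" and P': "represents P' coeff6_ji"
  and R: "represents R xi_ij_poly" and R': "represents R' xi_ji_poly"
  shows "X [j, i, j, i, j, i] \<ominus>\<^bsub>QW\<^esub> X [i, j, i, j, i, j] =
    X [i, j, i, j] \<otimes>\<^bsub>QW\<^esub> \<iota> P \<ominus>\<^bsub>QW\<^esub> X [j, i, j, i] \<otimes>\<^bsub>QW\<^esub> \<iota> P'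
    \<oplus>\<^bsub>QW\<^esub> X [j, i, j] \<otimes>\<^bsub>QW\<^esub> \<iota> (\<Delta> i P') \<ominus>\<^bsub>QW\<^esub> X [i, j, i] \<otimes>\<^bsub>QW\<^esub> \<iota> (\<Delta> j P)
    \<oplus>\<^bsub>QW\<^esub> X [i, j] \<otimes>\<^bsub>QW\<^esub> \<iota> R \<ominus>\<^bsub>QW\<^esub> X [j, i] \<otimes>\<^bsub>QW\<^esub> \<iota> R'
    \<oplus>\<^bsub>QW\<^esub> X [j] \<otimes>\<^bsub>QW\<^esub> \<iota> (\<Delta> i R') \<ominus>\<^bsub>QW\<^esub> X [i] \<otimes>\<^bsub>QW\<^esub> \<iota> (\<Delta> j R)"
  by (rule QW_eqI_inv)
     (simp_all add: X_closed term_closed representsD[OF P] representsD[OF P'] representsD[OF R] representsD[OF R']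
        represents_delta_i[OF P'] represents_delta_j[OF P] represents_delta_i[OF R'] represents_delta_j[OF R]
        i j coeff_at_diff coeff_at_add coeff_at_term coeff_at_word coefficients6[OF assms(1,2)])

section \<open>Expansion in reduced words\<close>

abbreviation m where "m \<equiv> reflection_order D i j"

definition short_words where
  "short_words = {w \<in> W. 1 \<le> weyl_length D w \<and> weyl_length D w + 2 \<le> m}"

definition short_alt :: "'i list \<Rightarrow> bool" where
  "short_alt u \<longleftrightarrow> (\<exists>n x y. u = alt_end y x n \<and> {x, y} = {i, j} \<and> 1 \<le> n \<and> n + 2 \<le> m)"

text \<open>
  Because alternating words shorter than m are the only reduced words of their products, the words in
  the list \<open>al\<close> are among the chosen reduced decompositions; the other coefficients are zero.
\<close>

lemma expansion:
  assumes red: "\<And>w. w \<in> W \<Longrightarrow> reduced_decomposition D w (red w)"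
    and f: "f \<in> carrier QW"
    and dist: "distinct (map fst al)"
    and al: "\<And>u q. (u, q) \<in> set al \<Longrightarrow> short_alt u \<and> q \<in> carrier Q"
    and eq: "\<And>v. v \<in> W \<Longrightarrow> coeff_at f (inv_into UNIV v) = (\<Sum>(u, q)\<leftarrow>al. word_coeff u v * \<theta> q)"
  shows "\<exists>\<eta>. (\<forall>w\<in>W. \<eta> w \<in> carrier Q) \<and>
    f = finsum QW (\<lambda>w. X (red w) \<otimes>\<^bsub>QW\<^esub> \<iota> (\<eta> w)) short_words"
proof -
  define c where "c u = (case map_of al u of Some q \<Rightarrow> q | None \<Rightarrow> \<zero>\<^bsub>Q\<^esub>)" for u
  have c_al: "c u = q" if "(u, q) \<in> set al" for u q
    using that dist by (simp add: c_def)
  have c_none: "c u = \<zero>\<^bsub>Q\<^esub>" if "u \<notin> fst ` set al" for u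
    using that by (simp add: c_def map_of_eq_None_iff[THEN iffD2])
  have c_Q: "c u \<in> carrier Q" for u
  proof (cases "u \<in> fst ` set al")
    case True
    then show ?thesis using c_al al by force
  qed (simp add: c_none Q_closed(3))
  have fin: "finite short_words" using finite_weyl by (simp add: short_words_def)
  have set_red: "set (red w) \<subseteq> I" and wp_red: "wp (red w) = w" if "w \<in> W" for w
    using red[OF that] by (auto simp: reduced_decomposition_def)
  have tc: "X (red w) \<otimes>\<^bsub>QW\<^esub> \<iota> (c (red w)) \<in> carrier QW" if "w \<in> short_words" for w
    using that by (intro term_closed set_red c_Q) (simp add: short_words_def)
  have "f = finsum QW (\<lambda>w. X (red w) \<otimes>\<^bsub>QW\<^esub> \<iota> (c (red w))) short_words"
  proof (rule QW_eqI_inv[OF f])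
    show "finsum QW (\<lambda>w. X (red w) \<otimes>\<^bsub>QW\<^esub> \<iota> (c (red w))) short_words \<in> carrier QW"
      using tc by (intro QW.finsum_closed) auto
    fix v assume v: "v \<in> W"
    let ?S = "{w \<in> short_words. red w \<in> fst ` set al}"
    have short: "wp u \<in> short_words \<and> red (wp u) = u" if u: "u \<in> fst ` set al" for u
    proof -
      obtain n x y where n: "u = alt_end y x n" "{x, y} = {i, j}" "1 \<le> n" "n + 2 \<le> m"
        using al u by (force simp: short_alt_def)
      have "set u \<subseteq> I" using set_alt_end[of y x n] n i j by auto
      then have w: "wp u \<in> W" by (rule wp_weyl)
      have l: "weyl_length D (wp u) = n" unfolding n(1) using n by (intro alt_word_length) auto
      have "red (wp u) = u" using reduced_alt_word[OF _ n(2), of n "red (wp u)"] red[OF w] n by simp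
      then show ?thesis using w l n by (simp add: short_words_def)
    qed
    have "coeff_at (finsum QW (\<lambda>w. X (red w) \<otimes>\<^bsub>QW\<^esub> \<iota> (c (red w))) short_words) (inv_into UNIV v)
        = (\<Sum>w\<in>short_words. coeff_at (X (red w) \<otimes>\<^bsub>QW\<^esub> \<iota> (c (red w))) (inv_into UNIV v))"
      by (rule coeff_at_sum[OF fin]) (rule tc)
    also have "\<dots> = (\<Sum>w\<in>short_words. word_coeff (red w) v * \<theta> (c (red w)))"
      by (intro sum.cong refl coeff_at_term set_red c_Q v) (simp add: short_words_def)
    also have "\<dots> = (\<Sum>w\<in>?S. word_coeff (red w) v * \<theta> (c (red w)))"
      by (rule sum.mono_neutral_right[OF fin]) (auto simp: c_none theta_Q)
    also have "\<dots> = (\<Sum>u\<in>fst ` set al. word_coeff u v * \<theta> (c u))"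
      by (rule sum.reindex_bij_witness[of _ wp red]) (use short wp_red in \<open>auto simp: short_words_def\<close>)
    also have "\<dots> = (\<Sum>(u, q)\<in>set al. word_coeff u v * \<theta> q)"
      using dist by (subst sum.reindex) (auto simp: distinct_map c_al intro!: sum.cong)
    also have "\<dots> = (\<Sum>(u, q)\<leftarrow>al. word_coeff u v * \<theta> q)"
      using dist by (simp add: sum_list_distinct_conv_sum_set distinct_map)
    finally show "coeff_at f (inv_into UNIV v) =
        coeff_at (finsum QW (\<lambda>w. X (red w) \<otimes>\<^bsub>QW\<^esub> \<iota> (c (red w))) short_words) (inv_into UNIV v)"
      using eq[OF v] by simp
  qed
  then show ?thesis using c_Q by (intro exI[of _ "\<lambda>w. c (red w)"]) simp
qed

lemma short_altI: "n + 2 \<le> m \<Longrightarrow> 1 \<le> n \<Longrightarrow> short_alt (alt_end i j n)" "n + 2 \<le> m \<Longrightarrow> 1 \<le> n \<Longrightarrow> short_alt (alt_end j i n)"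
  unfolding short_alt_def by blast+

lemma short_alt_words:
  "3 \<le> m \<Longrightarrow> short_alt [i]" "3 \<le> m \<Longrightarrow> short_alt [j]"
  "4 \<le> m \<Longrightarrow> short_alt [i, j]" "4 \<le> m \<Longrightarrow> short_alt [j, i]"
  "5 \<le> m \<Longrightarrow> short_alt [i, j, i]" "5 \<le> m \<Longrightarrow> short_alt [j, i, j]"
  "6 \<le> m \<Longrightarrow> short_alt [i, j, i, j]" "6 \<le> m \<Longrightarrow> short_alt [j, i, j, i]"
  using short_altI[of 1] short_altI[of 2] short_altI[of 3] short_altI[of 4]
  by (simp_all add: eval_nat_numeral)

lemma alternating_words:
  "alternating i j 2 = [i, j]" "alternating i j 3 = [i, j, i]" "alternating i j 4 = [i, j, i, j]"
  "alternating i j 6 = [i, j, i, j, i, j]"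
  "alternating j i 2 = [j, i]" "alternating j i 3 = [j, i, j]" "alternating j i 4 = [j, i, j, i]"
  "alternating j i 6 = [j, i, j, i, j, i]"
  by (simp_all add: alternating_def upt_rec)

definition expands where
  "expands red \<longleftrightarrow> (\<exists>\<eta>. (\<forall>w\<in>W. \<eta> w \<in> carrier Q) \<and>
    X (alternating j i m) \<ominus>\<^bsub>QW\<^esub> X (alternating i j m) =
    finsum QW (\<lambda>w. X (red w) \<otimes>\<^bsub>QW\<^esub> \<iota> (\<eta> w)) short_words)"

text \<open>
  For these Cartan integers the explicit relations give the coefficients. The remaining two cases
  arise by exchanging the two simple roots.
\<close>

lemma expands_half:
  assumes red: "\<And>w. w \<in> W \<Longrightarrow> reduced_decomposition D w (red w)"
    and c: "(cij, cji) \<in> {(0, 0), (-1, -1), (-1, -2), (-1, -3)}"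
  shows "expands red"
proof -
  consider "cij = 0" "cji = 0" | "cij = -1" "cji = -1" | "cij = -1" "cji = -2" | "cij = -1" "cji = -3"
    using c by auto
  then show ?thesis
  proof cases
    case 1
    have m: "m = 2" using 1 by (simp add: reflection_order_pair cartan_order_def)
    show ?thesis unfolding expands_def m alternating_words
      by (rule expansion[OF red, where al = "[]"])
         (use i j 1 in \<open>auto simp: X_closed coeff_at_diff coeff_at_word coefficients2\<close>)
  next
    case 2
    have m: "m = 3" using 2 by (simp add: reflection_order_pair cartan_order_def)
    have k: "represents (\<kappa> (1,0) (0,1)) (\<lambda>Z. kappa_poly Z (1,0) (0,1))" "represents (\<kappa> (0,1) (1,0)) (\<lambda>Z. kappa_poly Z (0,1) (1,0))"
      by (rule represents_kappa; simp)+
    show ?thesis unfolding expands_def m alternating_words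
      by (rule expansion[OF red, where al = "[([i], \<kappa> (1,0) (0,1)), ([j], \<ominus>\<^bsub>Q\<^esub> \<kappa> (0,1) (1,0))]"])
         (use i j ij m k in \<open>auto simp: X_closed coeff_at_diff coeff_at_word coefficients3[OF 2] representsD theta_Q_minus
            short_alt_words\<close>)
  next
    case 3
    have m: "m = 4" using 3 by (simp add: reflection_order_pair cartan_order_def)
    note P = represents_coeff4_ij and P' = represents_coeff4_ji
    let ?P = "\<kappa> (1,2) (0,-1) \<oplus>\<^bsub>Q\<^esub> \<kappa> (0,1) (1,0)" and ?P' = "\<kappa> (1,1) (0,1) \<oplus>\<^bsub>Q\<^esub> \<kappa> (1,0) (0,1)"
    note val = representsD[OF P] representsD[OF P'] represents_delta_i[OF P'] represents_delta_j[OF P]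
    show ?thesis unfolding expands_def m alternating_words
      by (rule expansion[OF red, where al = "[([i, j], ?P), ([j, i], \<ominus>\<^bsub>Q\<^esub> ?P'), ([j], \<Delta> i ?P'),
            ([i], \<ominus>\<^bsub>Q\<^esub> \<Delta> j ?P)]"])
         (use i j ij m in \<open>auto simp: X_closed coeff_at_diff coeff_at_word coefficients4[OF 3] theta_Q_minus val
            short_alt_words\<close>)
  next
    case 4
    have m: "m = 6" using 4 by (simp add: reflection_order_pair cartan_order_def)
    obtain P where P: "represents P coeff6_ij" using represents_coeff6_ij by blast
    obtain P' where P': "represents P' coeff6_ji" using represents_coeff6_ji by blast
    obtain R where R: "represents R xi_ij_poly" using represents_xi(1) by blast
    obtain R' where R': "represents R' xi_ji_poly" using represents_xi(2) by blast
    note val = representsD[OF P] representsD[OF P'] representsD[OF R] representsD[OF R']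
        represents_delta_i[OF P'] represents_delta_j[OF P] represents_delta_i[OF R'] represents_delta_j[OF R]
    show ?thesis unfolding expands_def m alternating_words
      by (rule expansion[OF red, where al = "[([i, j, i, j], P), ([j, i, j, i], \<ominus>\<^bsub>Q\<^esub> P'),
            ([j, i, j], \<Delta> i P'), ([i, j, i], \<ominus>\<^bsub>Q\<^esub> \<Delta> j P), ([i, j], R), ([j, i], \<ominus>\<^bsub>Q\<^esub> R'),
            ([j], \<Delta> i R'), ([i], \<ominus>\<^bsub>Q\<^esub> \<Delta> j R)]"])
         (use i j ij m in \<open>auto simp: X_closed coeff_at_diff coeff_at_word coefficients6[OF 4] theta_Q_minus val
            short_alt_words\<close>)
  qed
qed

lemma pair_swapped: "twisted_pair F B D j i"
  using fga_basis_axioms reduced_based_root_datum_axioms swapped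
  by (simp add: twisted_pair_def twisted_fga_def)

lemma expands:
  assumes red: "\<And>w. w \<in> W \<Longrightarrow> reduced_decomposition D w (red w)"
  shows "expands red"
proof (cases "(cij, cji) \<in> {(0, 0), (-1, -1), (-1, -2), (-1, -3)}")
  case True
  then show ?thesis using expands_half[OF red] by blast
next
  case False
  interpret sw: twisted_pair F B D j i by (rule pair_swapped)
  have m: "sw.m = m"
    unfolding reflection_order_pair sw.reflection_order_pair by (simp add: cartan_order_def mult.commute)
  have s: "sw.short_words = short_words" unfolding short_words_def sw.short_words_def m ..
  have "(cji, cij) \<in> {(0, 0), (-1, -1), (-1, -2), (-1, -3)}"
    using False cartan_finite by (auto simp: finite_cartan_def)
  then have "sw.expands red" using sw.expands_half[OF red] by blast
  then obtain \<eta> where \<eta>: "\<And>w. w \<in> W \<Longrightarrow> \<eta> w \<in> carrier Q"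
    and e: "X (alternating i j m) \<ominus>\<^bsub>QW\<^esub> X (alternating j i m) =
      finsum QW (\<lambda>w. X (red w) \<otimes>\<^bsub>QW\<^esub> \<iota> (\<eta> w)) short_words"
    unfolding sw.expands_def m s by blast
  have fin: "finite short_words" using finite_weyl by (simp add: short_words_def)
  have set_red: "set (red w) \<subseteq> I" if "w \<in> short_words" for w
    using red that by (auto simp: reduced_decomposition_def short_words_def)
  have wW: "w \<in> W" if "w \<in> short_words" for w using that by (simp add: short_words_def)
  have alt: "X (alternating i j m) \<in> carrier QW" "X (alternating j i m) \<in> carrier QW"
    using i j by (auto intro!: X_closed simp: alternating_def)
  have "X (alternating j i m) \<ominus>\<^bsub>QW\<^esub> X (alternating i j m) =
      finsum QW (\<lambda>w. X (red w) \<otimes>\<^bsub>QW\<^esub> \<iota> (\<ominus>\<^bsub>Q\<^esub> \<eta> w)) short_words"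
  proof (rule QW_eqI_inv)
    fix v assume v: "v \<in> W"
    have "coeff_at (X (alternating j i m) \<ominus>\<^bsub>QW\<^esub> X (alternating i j m)) (inv_into UNIV v) =
        - coeff_at (X (alternating i j m) \<ominus>\<^bsub>QW\<^esub> X (alternating j i m)) (inv_into UNIV v)"
      using alt by (simp add: coeff_at_diff)
    also have "\<dots> = - (\<Sum>w\<in>short_words. word_coeff (red w) v * \<theta> (\<eta> w))"
      unfolding e by (subst coeff_at_sum[OF fin]) (auto simp: term_closed coeff_at_term set_red \<eta> wW v)
    also have "\<dots> = coeff_at (finsum QW (\<lambda>w. X (red w) \<otimes>\<^bsub>QW\<^esub> \<iota> (\<ominus>\<^bsub>Q\<^esub> \<eta> w)) short_words) (inv_into UNIV v)"
      by (subst coeff_at_sum[OF fin]) (auto simp: term_closed coeff_at_term set_red \<eta> wW v theta_Q_minus sum_negf)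
    finally show "coeff_at (X (alternating j i m) \<ominus>\<^bsub>QW\<^esub> X (alternating i j m)) (inv_into UNIV v) = \<dots>" .
  next
    show "X (alternating j i m) \<ominus>\<^bsub>QW\<^esub> X (alternating i j m) \<in> carrier QW"
      using alt by simp
    show "finsum QW (\<lambda>w. X (red w) \<otimes>\<^bsub>QW\<^esub> \<iota> (\<ominus>\<^bsub>Q\<^esub> \<eta> w)) short_words \<in> carrier QW"
      by (intro QW.finsum_closed) (auto simp: term_closed set_red \<eta> wW)
  qed
  then show ?thesis unfolding expands_def using \<eta>
    by (intro exI[of _ "\<lambda>w. \<ominus>\<^bsub>Q\<^esub> \<eta> w"]) auto
qed

end

context reduced_based_root_datum
begin

lemma reflection_order_same: assumes "i \<in> I" shows "reflection_order D i i = 1"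
proof -
  have "s i \<otimes>\<^bsub>WG\<^esub> s i = \<one>\<^bsub>WG\<^esub>"
    using weyl_mult[OF s_weyl[OF assms] s_weyl[OF assms]] s_s[OF assms] by (auto simp: weyl_one)
  then have "reflection_order D i i = group.ord WG \<one>\<^bsub>WG\<^esub>" by (simp add: reflection_order_def)
  also have "group.ord WG \<one>\<^bsub>WG\<^esub> dvd 1"
    using group.pow_eq_id[OF group_weyl, of "\<one>\<^bsub>WG\<^esub>" 1] monoid.one_closed[OF group.is_monoid[OF group_weyl]]
      monoid.nat_pow_one[OF group.is_monoid[OF group_weyl], of 1] by simp
  finally show ?thesis by simp
qed

end

section \<open>Braid relations for formal Demazure elements\<close>

theorem proposition6p8:
  fixes F :: "'r::idom fps fps"
    and D :: "('l::ab_group_add, 'i) based_root_datum"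
    and red :: "('l \<Rightarrow> 'l) \<Rightarrow> 'i list"
    and i j :: 'i
  assumes "formal_group_law F"
    and "reduced_based_root_datum D"
    and "\<And>w. w \<in> carrier (weyl_group D) \<Longrightarrow> reduced_decomposition D w (red w)"
    and "i \<in> index_set D" and "j \<in> index_set D"
  defines "Q \<equiv> Q_ring F :: ('r, 'l) fga_frac ring"
    and "QW \<equiv> twisted_algebra F D"
    and "m \<equiv> reflection_order D i j"
    and "cij \<equiv> coroot D (simple_root D i) (simple_root D j)"
    and "cji \<equiv> coroot D (simple_root D j) (simple_root D i)"
    and "X \<equiv> demazure_word F D"
    and "\<iota> \<equiv> Q_embed F D"
    and "\<Delta> \<equiv> (\<lambda>k. demazure_operator F D (simple_root D k))"
    and "\<kappa> \<equiv> kappa2 F (simple_root D i) (simple_root D j)"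
    and "\<xi>ij \<equiv> xi_ij F (simple_root D i) (simple_root D j)"
    and "\<xi>ji \<equiv> xi_ji F (simple_root D i) (simple_root D j)"
  shows
    "(\<exists>\<eta>. (\<forall>w\<in>carrier (weyl_group D). \<eta> w \<in> carrier Q) \<and>
        X (alternating j i m) \<ominus>\<^bsub>QW\<^esub> X (alternating i j m) =
        (\<Oplus>\<^bsub>QW\<^esub>w\<in>{w \<in> carrier (weyl_group D). 1 \<le> weyl_length D w \<and> weyl_length D w + 2 \<le> m}.
           X (red w) \<otimes>\<^bsub>QW\<^esub> \<iota> (\<eta> w))) \<and>
     (cij = 0 \<longrightarrow> m = 2 \<and> X [i, j] = X [j, i]) \<and>
     (cij = -1 \<and> cji = -1 \<longrightarrow> m = 3 \<and>
        X [j, i, j] \<ominus>\<^bsub>QW\<^esub> X [i, j, i] =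
        X [i] \<otimes>\<^bsub>QW\<^esub> \<iota> (\<kappa> (1,0) (0,1)) \<ominus>\<^bsub>QW\<^esub> X [j] \<otimes>\<^bsub>QW\<^esub> \<iota> (\<kappa> (0,1) (1,0))) \<and>
     (cij = -1 \<and> cji = -2 \<longrightarrow> m = 4 \<and>
        (let P = \<kappa> (1,2) (0,-1) \<oplus>\<^bsub>Q\<^esub> \<kappa> (0,1) (1,0);
             P' = \<kappa> (1,1) (0,1) \<oplus>\<^bsub>Q\<^esub> \<kappa> (1,0) (0,1)
         in X [j, i, j, i] \<ominus>\<^bsub>QW\<^esub> X [i, j, i, j] =
            X [i, j] \<otimes>\<^bsub>QW\<^esub> \<iota> P
            \<ominus>\<^bsub>QW\<^esub> X [j, i] \<otimes>\<^bsub>QW\<^esub> \<iota> P'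
            \<oplus>\<^bsub>QW\<^esub> X [j] \<otimes>\<^bsub>QW\<^esub> \<iota> (\<Delta> i P')
            \<ominus>\<^bsub>QW\<^esub> X [i] \<otimes>\<^bsub>QW\<^esub> \<iota> (\<Delta> j P))) \<and>
     (cij = -1 \<and> cji = -3 \<longrightarrow> m = 6 \<and>
        (let P = \<kappa> (0,1) (1,0) \<oplus>\<^bsub>Q\<^esub> \<kappa> (2,3) (-1,-2) \<oplus>\<^bsub>Q\<^esub> \<kappa> (-1,-3) (1,2) \<oplus>\<^bsub>Q\<^esub> \<kappa> (1,2) (0,-1);
             P' = \<kappa> (1,0) (0,1) \<oplus>\<^bsub>Q\<^esub> \<kappa> (-2,-3) (1,2) \<oplus>\<^bsub>Q\<^esub> \<kappa> (-1,-2) (1,3) \<oplus>\<^bsub>Q\<^esub> \<kappa> (1,1) (0,1)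
         in X [j, i, j, i, j, i] \<ominus>\<^bsub>QW\<^esub> X [i, j, i, j, i, j] =
            X [i, j, i, j] \<otimes>\<^bsub>QW\<^esub> \<iota> P
            \<ominus>\<^bsub>QW\<^esub> X [j, i, j, i] \<otimes>\<^bsub>QW\<^esub> \<iota> P'
            \<oplus>\<^bsub>QW\<^esub> X [j, i, j] \<otimes>\<^bsub>QW\<^esub> \<iota> (\<Delta> i P')
            \<ominus>\<^bsub>QW\<^esub> X [i, j, i] \<otimes>\<^bsub>QW\<^esub> \<iota> (\<Delta> j P)
            \<oplus>\<^bsub>QW\<^esub> X [i, j] \<otimes>\<^bsub>QW\<^esub> \<iota> \<xi>ij
            \<ominus>\<^bsub>QW\<^esub> X [j, i] \<otimes>\<^bsub>QW\<^esub> \<iota> \<xi>ji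
            \<oplus>\<^bsub>QW\<^esub> X [j] \<otimes>\<^bsub>QW\<^esub> \<iota> (\<Delta> i \<xi>ji)
            \<ominus>\<^bsub>QW\<^esub> X [i] \<otimes>\<^bsub>QW\<^esub> \<iota> (\<Delta> j \<xi>ij)))"
proof -
  interpret rd: reduced_based_root_datum D by (rule assms(2))
  obtain B :: "'l set" where B: "finite B" "zmodule.independent B" "zmodule.span B = UNIV"
    using rd.free_finite_rank by blast
  interpret tw: twisted_fga F B D
    by (intro twisted_fga.intro fga_basis.intro assms(1,2) B)
  note red = assms(3)
  note defs = Q_def QW_def m_def cij_def cji_def X_def \<iota>_def \<Delta>_def \<kappa>_def \<xi>ij_def \<xi>ji_def
  \<comment> \<open>For \<open>i = j\<close> one has \<open>m = 1\<close>: the two words coincide, and no length satisfies the bounds.\<close>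
  show ?thesis
  proof (cases "i = j")
    case True
    have m: "m = 1" unfolding m_def True by (rule rd.reflection_order_same[OF assms(5)])
    have cij: "cij = 2" unfolding cij_def True by (rule rd.coroot_self[OF rd.simple_root[OF assms(5)]])
    have X: "X (alternating j i m) \<in> carrier QW"
      unfolding X_def QW_def using assms(4,5) by (intro tw.X_closed) (auto simp: alternating_def)
    have diff: "X (alternating j i m) \<ominus>\<^bsub>QW\<^esub> X (alternating i j m) = \<zero>\<^bsub>QW\<^esub>"
      using X tw.QW.r_neg unfolding True QW_def a_minus_def by blast
    have empty: "{w \<in> carrier (weyl_group D). 1 \<le> weyl_length D w \<and> weyl_length D w + 2 \<le> m} = {}"
      by (auto simp: m)
    have "\<exists>\<eta>. (\<forall>w\<in>carrier (weyl_group D). \<eta> w \<in> carrier Q) \<and>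
        X (alternating j i m) \<ominus>\<^bsub>QW\<^esub> X (alternating i j m) =
        (\<Oplus>\<^bsub>QW\<^esub>w\<in>{w \<in> carrier (weyl_group D). 1 \<le> weyl_length D w \<and> weyl_length D w + 2 \<le> m}.
           X (red w) \<otimes>\<^bsub>QW\<^esub> \<iota> (\<eta> w))"
      unfolding QW_def Q_def diff[unfolded QW_def] empty tw.QW.finsum_empty
      by (rule exI[of _ "\<lambda>w. \<zero>\<^bsub>Q_ring F\<^esub>"]) (intro conjI ballI tw.Q_closed(3) refl)
    then show ?thesis by (rule conjI) (simp add: cij)
  next
    case False
    interpret tp: twisted_pair F B D i j
      by (intro twisted_pair.intro tw.twisted_fga_axioms simple_root_pair.intro assms(2)
          simple_root_pair_axioms.intro assms(4,5) False)
    have any: "\<exists>\<eta>. (\<forall>w\<in>carrier (weyl_group D). \<eta> w \<in> carrier Q) \<and>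
        X (alternating j i m) \<ominus>\<^bsub>QW\<^esub> X (alternating i j m) =
        (\<Oplus>\<^bsub>QW\<^esub>w\<in>{w \<in> carrier (weyl_group D). 1 \<le> weyl_length D w \<and> weyl_length D w + 2 \<le> m}.
           X (red w) \<otimes>\<^bsub>QW\<^esub> \<iota> (\<eta> w))"
      using tp.expands[OF red] unfolding tp.expands_def tp.short_words_def defs .
    have c2: "m = 2 \<and> X [i, j] = X [j, i]" if "cij = 0"
      using that tp.relation2 unfolding defs by (simp add: tp.reflection_order_pair cartan_order_def)
    have c3: "m = 3 \<and> X [j, i, j] \<ominus>\<^bsub>QW\<^esub> X [i, j, i] =
        X [i] \<otimes>\<^bsub>QW\<^esub> \<iota> (\<kappa> (1,0) (0,1)) \<ominus>\<^bsub>QW\<^esub> X [j] \<otimes>\<^bsub>QW\<^esub> \<iota> (\<kappa> (0,1) (1,0))"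
      if "cij = -1 \<and> cji = -1"
      using that tp.relation3 unfolding defs by (simp add: tp.reflection_order_pair cartan_order_def)
    have c4: "m = 4 \<and>
        (let P = \<kappa> (1,2) (0,-1) \<oplus>\<^bsub>Q\<^esub> \<kappa> (0,1) (1,0);
             P' = \<kappa> (1,1) (0,1) \<oplus>\<^bsub>Q\<^esub> \<kappa> (1,0) (0,1)
         in X [j, i, j, i] \<ominus>\<^bsub>QW\<^esub> X [i, j, i, j] =
            X [i, j] \<otimes>\<^bsub>QW\<^esub> \<iota> P
            \<ominus>\<^bsub>QW\<^esub> X [j, i] \<otimes>\<^bsub>QW\<^esub> \<iota> P'
            \<oplus>\<^bsub>QW\<^esub> X [j] \<otimes>\<^bsub>QW\<^esub> \<iota> (\<Delta> i P')
            \<ominus>\<^bsub>QW\<^esub> X [i] \<otimes>\<^bsub>QW\<^esub> \<iota> (\<Delta> j P))"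
      if "cij = -1 \<and> cji = -2"
      using that tp.relation4[OF _ _ tp.represents_coeff4_ij tp.represents_coeff4_ji] unfolding defs Let_def
      by (simp add: tp.reflection_order_pair cartan_order_def)
    have c6: "m = 6 \<and>
        (let P = \<kappa> (0,1) (1,0) \<oplus>\<^bsub>Q\<^esub> \<kappa> (2,3) (-1,-2) \<oplus>\<^bsub>Q\<^esub> \<kappa> (-1,-3) (1,2) \<oplus>\<^bsub>Q\<^esub> \<kappa> (1,2) (0,-1);
             P' = \<kappa> (1,0) (0,1) \<oplus>\<^bsub>Q\<^esub> \<kappa> (-2,-3) (1,2) \<oplus>\<^bsub>Q\<^esub> \<kappa> (-1,-2) (1,3) \<oplus>\<^bsub>Q\<^esub> \<kappa> (1,1) (0,1)
         in X [j, i, j, i, j, i] \<ominus>\<^bsub>QW\<^esub> X [i, j, i, j, i, j] =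
            X [i, j, i, j] \<otimes>\<^bsub>QW\<^esub> \<iota> P
            \<ominus>\<^bsub>QW\<^esub> X [j, i, j, i] \<otimes>\<^bsub>QW\<^esub> \<iota> P'
            \<oplus>\<^bsub>QW\<^esub> X [j, i, j] \<otimes>\<^bsub>QW\<^esub> \<iota> (\<Delta> i P')
            \<ominus>\<^bsub>QW\<^esub> X [i, j, i] \<otimes>\<^bsub>QW\<^esub> \<iota> (\<Delta> j P)
            \<oplus>\<^bsub>QW\<^esub> X [i, j] \<otimes>\<^bsub>QW\<^esub> \<iota> \<xi>ij
            \<ominus>\<^bsub>QW\<^esub> X [j, i] \<otimes>\<^bsub>QW\<^esub> \<iota> \<xi>ji
            \<oplus>\<^bsub>QW\<^esub> X [j] \<otimes>\<^bsub>QW\<^esub> \<iota> (\<Delta> i \<xi>ji)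
            \<ominus>\<^bsub>QW\<^esub> X [i] \<otimes>\<^bsub>QW\<^esub> \<iota> (\<Delta> j \<xi>ij))"
      if "cij = -1 \<and> cji = -3"
      using that tp.relation6[OF _ _ tp.represents_coeff6_ij tp.represents_coeff6_ji tp.represents_xi]
      unfolding defs Let_def by (simp add: tp.reflection_order_pair cartan_order_def)
    show ?thesis
      by (rule conjI[OF any conjI[OF impI[OF c2] conjI[OF impI[OF c3] conjI[OF impI[OF c4] impI[OF c6]]]]])
  qed
qed

end
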